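(* Let $\Lambda$ be an Artin algebra and let $P$ be an indecomposable projective-injective $\Lambda$-module. Then there exists an indecomposable projective module $Q$ such that: (i) $P\simeq\nu Q$; (ii) $\mathrm{top}(Q)\simeq\mathrm{soc}(P)$; (iii) the almost split sequence in $\mathcal{P}(\Lambda)$ starting from $(0\to P)$ is of the form $$0\to(0\to P)\to(Q\xrightarrow{\alpha_Q}\nu Q)\to(Q\to 0)\to 0.$$
   Context: $\mathrm{mod}\text{-}\Lambda$ is the category of finitely generated $\Lambda$-modules. $\mathcal{H}(\Lambda)$ is the morphism category of $\mathrm{mod}\text{-}\Lambda$: objects are morphisms $f:X\to Y$ in $\mathrm{mod}\text{-}\Lambda$, and a morphism from $(X\xrightarrow{f}Y)$ to $(X'\xrightarrow{f'}Y')$ is a pair $(\sigma_1,\sigma_2)$ with $\sigma_1:X\to X'$, $\sigma_2:Y\to Y'$ and $\sigma_2f=f'\sigma_1$. It is abelian, with exactness computed componentwise. $\mathcal{P}(\Lambda)$ is the full subcategory of $\mathcal{H}(\Lambda)$ of objects $(P\xrightarrow{f}Q)$ with $P,Q$ projective; it is extension-closed and carries the exact structure inherited from $\mathcal{H}(\Lambda)$, with respect to which almost split sequences in $\mathcal{P}(\Lambda)$ are taken. $\nu=D\,\mathrm{Hom}_\Lambda(-,\Lambda)$ is the Nakayama functor. For an indecomposable projective module $Q$, $\alpha_Q:Q\to\nu Q$ denotes the composite $Q\xrightarrow{p}\mathrm{top}(Q)\simeq\mathrm{soc}(\nu Q)\xrightarrow{i}\nu Q$ of the canonical epimorphism, an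 isomorphism, and the canonical inclusion; as an object of $\mathcal{H}(\Lambda)$, $(Q\xrightarrow{\alpha_Q}\nu Q)$ is unique up to isomorphism. *)

theory Defs
  imports "HOL-Algebra.Module" "HOL-Algebra.Ideal"
begin

section \<open>Modules over a non-commutative ring\<close>

text \<open>
  The locale \<open>module\<close> of HOL-Algebra requires a commutative ring, so right modules are set up here
  on the same record type. The right action \<open>x \<cdot> r\<close> is written \<open>r \<odot>\<^bsub>M\<^esub> x\<close>; the fields \<open>mult\<close>
  and \<open>one\<close> of a module record carry no information. A left module over \<open>\<Lambda>\<close>, which occurs
  only as the intermediate value of the Nakayama functor, is stored in the same record, with
  \<open>r \<odot>\<^bsub>M\<^esub> x\<close> standing for \<open>r \<cdot> x\<close>.
\<close>

locale right_module = R?: ring R + M?: abelian_group M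
  for R :: "('a, 'e) ring_scheme" (structure) and M :: "('a, 'm) module" (structure) +
  assumes smult_closed [simp, intro]:
      "\<lbrakk>r \<in> carrier R; x \<in> carrier M\<rbrakk> \<Longrightarrow> r \<odot>\<^bsub>M\<^esub> x \<in> carrier M"
    and smult_l_distr:
      "\<lbrakk>r \<in> carrier R; s \<in> carrier R; x \<in> carrier M\<rbrakk>
        \<Longrightarrow> (r \<oplus>\<^bsub>R\<^esub> s) \<odot>\<^bsub>M\<^esub> x = r \<odot>\<^bsub>M\<^esub> x \<oplus>\<^bsub>M\<^esub> s \<odot>\<^bsub>M\<^esub> x"
    and smult_r_distr:
      "\<lbrakk>r \<in> carrier R; x \<in> carrier M; y \<in> carrier M\<rbrakk>
        \<Longrightarrow> r \<odot>\<^bsub>M\<^esub> (x \<oplus>\<^bsub>M\<^esub> y) = r \<odot>\<^bsub>M\<^esub> x \<oplus>\<^bsub>M\<^esub> r \<odot>\<^bsub>M\<^esub> y"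
    and smult_assoc:
      "\<lbrakk>r \<in> carrier R; s \<in> carrier R; x \<in> carrier M\<rbrakk>
        \<Longrightarrow> (r \<otimes>\<^bsub>R\<^esub> s) \<odot>\<^bsub>M\<^esub> x = s \<odot>\<^bsub>M\<^esub> (r \<odot>\<^bsub>M\<^esub> x)"
    and smult_one [simp]:
      "x \<in> carrier M \<Longrightarrow> \<one>\<^bsub>R\<^esub> \<odot>\<^bsub>M\<^esub> x = x"

definition fg_module :: "('a, 'e) ring_scheme \<Rightarrow> ('a, 'm) module \<Rightarrow> bool" where
  "fg_module R M \<longleftrightarrow> right_module R M \<and>
     (\<exists>S. finite S \<and> S \<subseteq> carrier M \<and> (\<forall>N. submodule N R M \<and> S \<subseteq> N \<longrightarrow> N = carrier M))"

text \<open>Homomorphisms are extensional, so that equality of maps is equality in the logic.\<close>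

definition mhom :: "('a, 'e) ring_scheme \<Rightarrow> ('a, 'm) module \<Rightarrow> ('a, 'n) module \<Rightarrow> ('m \<Rightarrow> 'n) set" where
  "mhom R M N = {f \<in> carrier M \<rightarrow>\<^sub>E carrier N.
     (\<forall>x\<in>carrier M. \<forall>y\<in>carrier M. f (x \<oplus>\<^bsub>M\<^esub> y) = f x \<oplus>\<^bsub>N\<^esub> f y) \<and>
     (\<forall>r\<in>carrier R. \<forall>x\<in>carrier M. f (r \<odot>\<^bsub>M\<^esub> x) = r \<odot>\<^bsub>N\<^esub> f x)}"

definition miso :: "('a, 'e) ring_scheme \<Rightarrow> ('a, 'm) module \<Rightarrow> ('a, 'n) module \<Rightarrow> ('m \<Rightarrow> 'n) set" where
  "miso R M N = {f \<in> mhom R M N. bij_betw f (carrier M) (carrier N)}"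

definition isomorphic :: "('a, 'e) ring_scheme \<Rightarrow> ('a, 'm) module \<Rightarrow> ('a, 'n) module \<Rightarrow> bool" where
  "isomorphic R M N \<longleftrightarrow> miso R M N \<noteq> {}"

definition zero_module :: "('a, unit) module" where
  "zero_module = \<lparr>carrier = {()}, mult = (\<lambda>_ _. ()), one = (), zero = (), add = (\<lambda>_ _. ()),
     smult = (\<lambda>_ _. ())\<rparr>"

definition zero_map :: "('a, 'm) module \<Rightarrow> ('a, 'n) module \<Rightarrow> 'm \<Rightarrow> 'n" where
  "zero_map M N = (\<lambda>x\<in>carrier M. \<zero>\<^bsub>N\<^esub>)"

definition regular_module :: "('a, 'e) ring_scheme \<Rightarrow> ('a, 'a) module" where
  "regular_module R = \<lparr>carrier = carrier R, mult = mult R, one = one R, zero = zero R, add = add R,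
     smult = (\<lambda>r x. x \<otimes>\<^bsub>R\<^esub> r)\<rparr>"

definition quotient_module :: "('a, 'm) module \<Rightarrow> 'm set \<Rightarrow> ('a, 'm set) module" where
  "quotient_module M N = \<lparr>carrier = a_rcosets\<^bsub>M\<^esub> N, mult = undefined, one = undefined,
     zero = N, add = set_add M,
     smult = (\<lambda>r X. N <+>\<^bsub>M\<^esub> ((\<lambda>x. r \<odot>\<^bsub>M\<^esub> x) ` X))\<rparr>"

definition restrict_scalars :: "('r \<Rightarrow> 'a) \<Rightarrow> ('a, 'm) module \<Rightarrow> ('r, 'm) module" where
  "restrict_scalars \<phi> M = \<lparr>carrier = carrier M, mult = mult M, one = one M, zero = zero M, add = add M,
     smult = (\<lambda>r x. \<phi> r \<odot>\<^bsub>M\<^esub> x)\<rparr>"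

definition maximal_submodule :: "('a, 'e) ring_scheme \<Rightarrow> ('a, 'm) module \<Rightarrow> 'm set \<Rightarrow> bool" where
  "maximal_submodule R M N \<longleftrightarrow> submodule N R M \<and> N \<noteq> carrier M \<and>
     (\<forall>K. submodule K R M \<and> N \<subseteq> K \<longrightarrow> K = N \<or> K = carrier M)"

definition simple_submodule :: "('a, 'e) ring_scheme \<Rightarrow> ('a, 'm) module \<Rightarrow> 'm set \<Rightarrow> bool" where
  "simple_submodule R M N \<longleftrightarrow> submodule N R M \<and> N \<noteq> {\<zero>\<^bsub>M\<^esub>} \<and>
     (\<forall>K. submodule K R M \<and> K \<subseteq> N \<longrightarrow> K = {\<zero>\<^bsub>M\<^esub>} \<or> K = N)"

definition module_rad :: "('a, 'e) ring_scheme \<Rightarrow> ('a, 'm) module \<Rightarrow> 'm set" where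
  "module_rad R M = carrier M \<inter> \<Inter>{N. maximal_submodule R M N}"

definition module_top :: "('a, 'e) ring_scheme \<Rightarrow> ('a, 'm) module \<Rightarrow> ('a, 'm set) module" where
  "module_top R M = quotient_module M (module_rad R M)"

text \<open>The sum of all simple submodules, that is, the least submodule containing them.\<close>

definition module_soc :: "('a, 'e) ring_scheme \<Rightarrow> ('a, 'm) module \<Rightarrow> ('a, 'm) module" where
  "module_soc R M = M\<lparr>carrier :=
     \<Inter>{N. submodule N R M \<and> (\<forall>S. simple_submodule R M S \<longrightarrow> S \<subseteq> N)}\<rparr>"

definition indecomposable :: "('a, 'e) ring_scheme \<Rightarrow> ('a, 'm) module \<Rightarrow> bool" where
  "indecomposable R M \<longleftrightarrow> right_module R M \<and> carrier M \<noteq> {\<zero>\<^bsub>M\<^esub>} \<and>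
     (\<forall>N K. submodule N R M \<and> submodule K R M \<and> N \<inter> K = {\<zero>\<^bsub>M\<^esub>} \<and> N <+>\<^bsub>M\<^esub> K = carrier M
        \<longrightarrow> N = {\<zero>\<^bsub>M\<^esub>} \<or> K = {\<zero>\<^bsub>M\<^esub>})"


section \<open>A small skeleton of the category of finitely generated modules\<close>

text \<open>
  Quantification over all finitely generated modules has to take place at one type. Such a module
  is a quotient of some \<open>R\<^sup>n\<close>, so modules whose elements are sets of sequences over \<open>R\<close>
  represent every isomorphism class; the lemma \<open>fg_module_small\<close> below makes this precise.
\<close>

type_synonym 'a small = "(nat \<Rightarrow> 'a) set"

lemma (in right_module) smult_r_null [simp]:
  assumes "r \<in> carrier R"
  shows "r \<odot>\<^bsub>M\<^esub> \<zero>\<^bsub>M\<^esub> = \<zero>\<^bsub>M\<^esub>"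
proof -
  have "r \<odot>\<^bsub>M\<^esub> \<zero>\<^bsub>M\<^esub> \<oplus>\<^bsub>M\<^esub> r \<odot>\<^bsub>M\<^esub> \<zero>\<^bsub>M\<^esub> = r \<odot>\<^bsub>M\<^esub> \<zero>\<^bsub>M\<^esub>"
    using smult_r_distr[OF assms M.zero_closed M.zero_closed] assms by simp
  then show ?thesis
    using assms by (metis M.add.r_cancel_one M.zero_closed smult_closed)
qed

lemma (in right_module) smult_l_null [simp]:
  assumes "x \<in> carrier M"
  shows "\<zero>\<^bsub>R\<^esub> \<odot>\<^bsub>M\<^esub> x = \<zero>\<^bsub>M\<^esub>"
proof -
  have "\<zero>\<^bsub>R\<^esub> \<odot>\<^bsub>M\<^esub> x \<oplus>\<^bsub>M\<^esub> \<zero>\<^bsub>R\<^esub> \<odot>\<^bsub>M\<^esub> x = \<zero>\<^bsub>R\<^esub> \<odot>\<^bsub>M\<^esub> x"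
    using smult_l_distr[OF R.zero_closed R.zero_closed assms] by simp
  then show ?thesis
    using assms by (metis M.add.r_cancel_one R.zero_closed smult_closed)
qed

lemma (in right_module) smult_minus_one:
  assumes "x \<in> carrier M"
  shows "(\<ominus>\<^bsub>R\<^esub> \<one>\<^bsub>R\<^esub>) \<odot>\<^bsub>M\<^esub> x = \<ominus>\<^bsub>M\<^esub> x"
proof -
  have "(\<ominus>\<^bsub>R\<^esub> \<one>\<^bsub>R\<^esub>) \<odot>\<^bsub>M\<^esub> x \<oplus>\<^bsub>M\<^esub> \<one>\<^bsub>R\<^esub> \<odot>\<^bsub>M\<^esub> x = \<zero>\<^bsub>M\<^esub>"
    using smult_l_distr[of "\<ominus>\<^bsub>R\<^esub> \<one>\<^bsub>R\<^esub>" "\<one>\<^bsub>R\<^esub>" x] assms by (simp add: R.l_neg)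
  then show ?thesis
    using assms by (simp add: M.minus_equality)
qed

lemma (in right_module) submoduleI:
  assumes sub: "N \<subseteq> carrier M" and zero: "\<zero>\<^bsub>M\<^esub> \<in> N"
    and add: "\<And>x y. \<lbrakk>x \<in> N; y \<in> N\<rbrakk> \<Longrightarrow> x \<oplus>\<^bsub>M\<^esub> y \<in> N"
    and smult: "\<And>r x. \<lbrakk>r \<in> carrier R; x \<in> N\<rbrakk> \<Longrightarrow> r \<odot>\<^bsub>M\<^esub> x \<in> N"
  shows "submodule N R M"
proof (intro submodule.intro subgroup.intro submodule_axioms.intro)
  fix x assume x: "x \<in> N"
  have "\<ominus>\<^bsub>M\<^esub> x \<in> N"
    using smult[of "\<ominus>\<^bsub>R\<^esub> \<one>\<^bsub>R\<^esub>" x] smult_minus_one[of x] x sub by auto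
  then show "inv\<^bsub>add_monoid M\<^esub> x \<in> N"
    by (simp add: a_inv_def)
qed (use assms in auto)

lemma (in right_module) finsum_smult:
  assumes "finite A" "r \<in> carrier R" "f \<in> A \<rightarrow> carrier M"
  shows "r \<odot>\<^bsub>M\<^esub> (\<Oplus>\<^bsub>M\<^esub>i\<in>A. f i) = (\<Oplus>\<^bsub>M\<^esub>i\<in>A. r \<odot>\<^bsub>M\<^esub> f i)"
  using assms by (induct set: finite) (simp_all add: Pi_def smult_r_distr)

lemma fg_module_transport:
  fixes R :: "('a, 'e) ring_scheme" and M :: "('a, 'm) module" and h :: "'m \<Rightarrow> 'n"
  assumes fg: "fg_module R M" and inj: "inj_on h (carrier M)"
  shows "\<exists>N :: ('a, 'n) module. fg_module R N \<and> isomorphic R M N"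
proof -
  interpret right_module R M using fg by (simp add: fg_module_def)
  define g where "g = inv_into (carrier M) h"
  have gh [simp]: "g (h x) = x" if "x \<in> carrier M" for x
    using inj that by (simp add: g_def)
  define N :: "('a, 'n) module" where
    "N = \<lparr>carrier = h ` carrier M, mult = undefined, one = undefined, zero = h \<zero>\<^bsub>M\<^esub>,
          add = (\<lambda>x y. h (g x \<oplus>\<^bsub>M\<^esub> g y)), smult = (\<lambda>r x. h (r \<odot>\<^bsub>M\<^esub> g x))\<rparr>"
  have N [simp]: "carrier N = h ` carrier M" "\<zero>\<^bsub>N\<^esub> = h \<zero>\<^bsub>M\<^esub>"
      "\<And>x y. x \<oplus>\<^bsub>N\<^esub> y = h (g x \<oplus>\<^bsub>M\<^esub> g y)" "\<And>r x. r \<odot>\<^bsub>N\<^esub> x = h (r \<odot>\<^bsub>M\<^esub> g x)"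
    by (simp_all add: N_def)
  have "abelian_group N"
  proof (rule abelian_groupI)
    fix x assume "x \<in> carrier N"
    then obtain u where "u \<in> carrier M" "x = h u" by auto
    then show "\<exists>y\<in>carrier N. y \<oplus>\<^bsub>N\<^esub> x = \<zero>\<^bsub>N\<^esub>"
      by (intro bexI[of _ "h (\<ominus>\<^bsub>M\<^esub> u)"]) (auto simp: M.l_neg)
  qed (auto simp: M.a_ac)
  then have RN: "right_module R N"
    by (intro right_module.intro right_module_axioms.intro R.ring_axioms)
      (auto simp: smult_l_distr smult_r_distr smult_assoc)
  obtain S where S: "finite S" "S \<subseteq> carrier M"
    "\<And>K. \<lbrakk>submodule K R M; S \<subseteq> K\<rbrakk> \<Longrightarrow> K = carrier M"
    using fg unfolding fg_module_def by blast
  have "K = carrier N" if K: "submodule K R N" "h ` S \<subseteq> K" for K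
  proof -
    interpret K: submodule K R N by (fact K(1))
    have KN: "K \<subseteq> h ` carrier M" using K.subset by simp
    have "submodule {x \<in> carrier M. h x \<in> K} R M"
    proof (rule submoduleI)
      show "\<zero>\<^bsub>M\<^esub> \<in> {x \<in> carrier M. h x \<in> K}" using K.one_closed by simp
    next
      fix x y assume "x \<in> {x \<in> carrier M. h x \<in> K}" "y \<in> {x \<in> carrier M. h x \<in> K}"
      then show "x \<oplus>\<^bsub>M\<^esub> y \<in> {x \<in> carrier M. h x \<in> K}"
        using K.m_closed[of "h x" "h y"] by simp
    next
      fix r x assume "r \<in> carrier R" "x \<in> {x \<in> carrier M. h x \<in> K}"
      then show "r \<odot>\<^bsub>M\<^esub> x \<in> {x \<in> carrier M. h x \<in> K}"
        using K.smult_closed[of r "h x"] by simp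
    qed auto
    moreover have "S \<subseteq> {x \<in> carrier M. h x \<in> K}" using K(2) S(2) by auto
    ultimately have "{x \<in> carrier M. h x \<in> K} = carrier M" by (rule S(3))
    then show ?thesis using KN by auto
  qed
  then have "fg_module R N"
    unfolding fg_module_def using RN S(1,2)
    by (intro conjI exI[of _ "h ` S"]) auto
  moreover have "restrict h (carrier M) \<in> miso R M N"
    using inj by (auto simp: miso_def mhom_def bij_betw_def)
  ultimately show ?thesis unfolding isomorphic_def by blast
qed

lemma fg_module_small:
  fixes R :: "('a, 'e) ring_scheme" and M :: "('a, 'm) module"
  assumes fg: "fg_module R M"
  shows "\<exists>N :: ('a, 'a small) module. fg_module R N \<and> isomorphic R M N"
proof -
  interpret right_module R M using fg by (simp add: fg_module_def)
  obtain S where S: "finite S" "S \<subseteq> carrier M"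
    "\<And>K. \<lbrakk>submodule K R M; S \<subseteq> K\<rbrakk> \<Longrightarrow> K = carrier M"
    using fg unfolding fg_module_def by blast
  obtain n :: nat and s where s: "S = s ` {i. i < n}"
    using S(1) finite_imp_nat_seg_image_inj_on by metis
  have sM [simp]: "s i \<in> carrier M" if "i < n" for i using S(2) s that by auto
  define C where "C = (UNIV :: nat set) \<rightarrow> carrier R"
  define v where "v c = (\<Oplus>\<^bsub>M\<^esub>i\<in>{..<n}. c i \<odot>\<^bsub>M\<^esub> s i)" for c
  have CR: "c i \<in> carrier R" if "c \<in> C" for c i using that by (auto simp: C_def)
  have vM: "v c \<in> carrier M" if "c \<in> C" for c
    unfolding v_def using CR[OF that] by (intro M.finsum_closed) auto
  have "submodule (v ` C) R M"
  proof (rule submoduleI)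
    show "v ` C \<subseteq> carrier M" using vM by auto
    have "v (\<lambda>_. \<zero>\<^bsub>R\<^esub>) = \<zero>\<^bsub>M\<^esub>"
      unfolding v_def by (intro M.add.finprod_one_eqI) auto
    then show "\<zero>\<^bsub>M\<^esub> \<in> v ` C" by (intro image_eqI[of _ _ "\<lambda>_. \<zero>\<^bsub>R\<^esub>"]) (auto simp: C_def)
  next
    fix x y assume "x \<in> v ` C" "y \<in> v ` C"
    then obtain c d where c: "c \<in> C" "x = v c" and d: "d \<in> C" "y = v d" by auto
    have "v (\<lambda>i. c i \<oplus>\<^bsub>R\<^esub> d i) = (\<Oplus>\<^bsub>M\<^esub>i\<in>{..<n}. c i \<odot>\<^bsub>M\<^esub> s i \<oplus>\<^bsub>M\<^esub> d i \<odot>\<^bsub>M\<^esub> s i)"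
      unfolding v_def using CR[OF c(1)] CR[OF d(1)]
      by (intro M.finsum_cong') (auto simp: smult_l_distr)
    also have "\<dots> = x \<oplus>\<^bsub>M\<^esub> y"
      unfolding c(2) d(2) v_def using CR[OF c(1)] CR[OF d(1)]
      by (intro M.finsum_addf) auto
    finally show "x \<oplus>\<^bsub>M\<^esub> y \<in> v ` C"
      using c d by (intro image_eqI[of _ _ "\<lambda>i. c i \<oplus>\<^bsub>R\<^esub> d i"]) (auto simp: C_def)
  next
    fix r x assume r: "r \<in> carrier R" and "x \<in> v ` C"
    then obtain c where c: "c \<in> C" "x = v c" by auto
    have "v (\<lambda>i. c i \<otimes>\<^bsub>R\<^esub> r) = (\<Oplus>\<^bsub>M\<^esub>i\<in>{..<n}. r \<odot>\<^bsub>M\<^esub> (c i \<odot>\<^bsub>M\<^esub> s i))"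
      unfolding v_def using CR[OF c(1)] r
      by (intro M.finsum_cong') (auto simp: smult_assoc)
    also have "\<dots> = r \<odot>\<^bsub>M\<^esub> x"
      unfolding c(2) v_def using CR[OF c(1)] r
      by (intro finsum_smult[symmetric]) auto
    finally show "r \<odot>\<^bsub>M\<^esub> x \<in> v ` C"
      using c r by (intro image_eqI[of _ _ "\<lambda>i. c i \<otimes>\<^bsub>R\<^esub> r"]) (auto simp: C_def)
  qed
  moreover have "S \<subseteq> v ` C"
  proof
    fix x assume "x \<in> S"
    then obtain k where k: "k < n" "x = s k" using s by auto
    define e where "e i = (if i = k then \<one>\<^bsub>R\<^esub> else \<zero>\<^bsub>R\<^esub>)" for i
    have "v e = (\<Oplus>\<^bsub>M\<^esub>i\<in>{..<n}. if k = i then s i else \<zero>\<^bsub>M\<^esub>)"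
      unfolding v_def using k by (intro M.finsum_cong') (auto simp: e_def)
    also have "\<dots> = s k"
      using k by (intro M.add.finprod_singleton) auto
    finally show "x \<in> v ` C"
      using k by (intro image_eqI[of _ _ e]) (auto simp: C_def e_def)
  qed
  ultimately have onto: "v ` C = carrier M" by (rule S(3))
  have "inj_on (\<lambda>x. {c \<in> C. v c = x}) (carrier M)"
  proof (rule inj_onI)
    fix x y assume x: "x \<in> carrier M" and eq: "{c \<in> C. v c = x} = {c \<in> C. v c = y}"
    obtain c where "c \<in> C" "v c = x" using onto x by (metis imageE)
    then show "x = y" using eq by blast
  qed
  then show ?thesis by (rule fg_module_transport[OF fg])
qed


section \<open>Projective and injective modules\<close>

text \<open>Both notions are those of the category of finitely generated modules.\<close>

definition projective :: "('a, 'e) ring_scheme \<Rightarrow> ('a, 'm) module \<Rightarrow> bool" where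
  "projective R P \<longleftrightarrow> fg_module R P \<and>
     (\<forall>(X :: ('a, 'a small) module) (Y :: ('a, 'a small) module).
        fg_module R X \<and> fg_module R Y \<longrightarrow>
        (\<forall>f\<in>mhom R X Y. \<forall>g\<in>mhom R P Y. f ` carrier X = carrier Y \<longrightarrow>
           (\<exists>h\<in>mhom R P X. compose (carrier P) f h = g)))"

definition injective :: "('a, 'e) ring_scheme \<Rightarrow> ('a, 'm) module \<Rightarrow> bool" where
  "injective R I \<longleftrightarrow> fg_module R I \<and>
     (\<forall>(X :: ('a, 'a small) module) (Y :: ('a, 'a small) module).
        fg_module R X \<and> fg_module R Y \<longrightarrow>
        (\<forall>f\<in>mhom R X Y. \<forall>g\<in>mhom R X I. inj_on f (carrier X) \<longrightarrow>
           (\<exists>h\<in>mhom R Y I. compose (carrier X) h f = g)))"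

definition injective_envelope ::
    "('a, 'e) ring_scheme \<Rightarrow> ('a, 'm) module \<Rightarrow> ('a, 'n) module \<Rightarrow> bool" where
  "injective_envelope R M I \<longleftrightarrow> injective R I \<and>
     (\<exists>f\<in>mhom R M I. inj_on f (carrier M) \<and>
        (\<forall>N. submodule N R I \<and> N \<inter> f ` carrier M = {\<zero>\<^bsub>I\<^esub>} \<longrightarrow> N = {\<zero>\<^bsub>I\<^esub>}))"


section \<open>Artin algebras, the duality and the Nakayama functor\<close>

definition artinian :: "('r, 'e) ring_scheme \<Rightarrow> bool" where
  "artinian R \<longleftrightarrow>
     (\<forall>I. (\<forall>n::nat. ideal (I n) R \<and> I (Suc n) \<subseteq> I n) \<longrightarrow> (\<exists>n. \<forall>m\<ge>n. I m = I n))"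

text \<open>\<open>\<phi>\<close> is the structure map of the \<open>R\<close>-algebra \<open>\<Lambda>\<close>.\<close>

definition artin_algebra ::
    "('r, 'e) ring_scheme \<Rightarrow> ('r \<Rightarrow> 'a) \<Rightarrow> ('a, 'f) ring_scheme \<Rightarrow> bool" where
  "artin_algebra R \<phi> \<Lambda> \<longleftrightarrow> cring R \<and> artinian R \<and> ring \<Lambda> \<and> \<phi> \<in> ring_hom R \<Lambda> \<and>
     (\<forall>r\<in>carrier R. \<forall>x\<in>carrier \<Lambda>. \<phi> r \<otimes>\<^bsub>\<Lambda>\<^esub> x = x \<otimes>\<^bsub>\<Lambda>\<^esub> \<phi> r) \<and>
     fg_module R (restrict_scalars \<phi> (regular_module \<Lambda>))"

text \<open>
  \<open>J\<close> is an injective envelope of \<open>R / rad R\<close>, the module used to define \<open>D = Hom\<^sub>R(-, J)\<close>; the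
  top of the regular module is \<open>R / rad R\<close>, since the radical of that module is the
  Jacobson radical of \<open>R\<close>. As \<open>R\<close> is commutative artinian, \<open>J\<close> is finitely generated, so
  the notion of injectivity above applies.
\<close>

definition dualizing_module :: "('r, 'e) ring_scheme \<Rightarrow> ('r, 'j) module \<Rightarrow> bool" where
  "dualizing_module R J \<longleftrightarrow> injective_envelope R (module_top R (regular_module R)) J"

text \<open>The left module \<open>Hom\<^sub>\<Lambda>(M, \<Lambda>)\<close>, with \<open>(a f)(x) = a f(x)\<close>.\<close>

definition hom_regular :: "('a, 'f) ring_scheme \<Rightarrow> ('a, 'm) module \<Rightarrow> ('a, 'm \<Rightarrow> 'a) module" where
  "hom_regular \<Lambda> M = \<lparr>carrier = mhom \<Lambda> M (regular_module \<Lambda>), mult = undefined, one = undefined,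
     zero = (\<lambda>x\<in>carrier M. \<zero>\<^bsub>\<Lambda>\<^esub>), add = (\<lambda>f g. \<lambda>x\<in>carrier M. f x \<oplus>\<^bsub>\<Lambda>\<^esub> g x),
     smult = (\<lambda>a f. \<lambda>x\<in>carrier M. a \<otimes>\<^bsub>\<Lambda>\<^esub> f x)\<rparr>"

text \<open>The right module \<open>D M = Hom\<^sub>R(M, J)\<close> of a left module \<open>M\<close>, with \<open>(u a)(x) = u(a x)\<close>.\<close>

definition dual_module ::
    "('r, 'e) ring_scheme \<Rightarrow> ('r \<Rightarrow> 'a) \<Rightarrow> ('r, 'j) module \<Rightarrow> ('a, 'm) module \<Rightarrow> ('a, 'm \<Rightarrow> 'j) module" where
  "dual_module R \<phi> J M = \<lparr>carrier = mhom R (restrict_scalars \<phi> M) J,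
     mult = undefined, one = undefined,
     zero = (\<lambda>x\<in>carrier M. \<zero>\<^bsub>J\<^esub>), add = (\<lambda>u v. \<lambda>x\<in>carrier M. u x \<oplus>\<^bsub>J\<^esub> v x),
     smult = (\<lambda>a u. \<lambda>x\<in>carrier M. u (a \<odot>\<^bsub>M\<^esub> x))\<rparr>"

definition nakayama ::
    "('r, 'e) ring_scheme \<Rightarrow> ('r \<Rightarrow> 'a) \<Rightarrow> ('a, 'f) ring_scheme \<Rightarrow> ('r, 'j) module
      \<Rightarrow> ('a, 'm) module \<Rightarrow> ('a, ('m \<Rightarrow> 'a) \<Rightarrow> 'j) module" where
  "nakayama R \<phi> \<Lambda> J M = dual_module R \<phi> J (hom_regular \<Lambda> M)"

text \<open>
  \<open>\<alpha>\<close> is a composite of the canonical epimorphism of \<open>Q\<close> onto its top, an isomorphism \<open>\<theta>\<close> from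
  the top of \<open>Q\<close> to the socle of \<open>N\<close>, and the inclusion of that socle; it is used with \<open>N = \<nu> Q\<close>.
\<close>

definition is_alpha ::
    "('a, 'f) ring_scheme \<Rightarrow> ('a, 'm) module \<Rightarrow> ('a, 'n) module \<Rightarrow> ('m \<Rightarrow> 'n) \<Rightarrow> bool" where
  "is_alpha \<Lambda> Q N \<alpha> \<longleftrightarrow>
     (\<exists>\<theta>\<in>miso \<Lambda> (module_top \<Lambda> Q) (module_soc \<Lambda> N).
        \<alpha> = (\<lambda>x\<in>carrier Q. \<theta> (module_rad \<Lambda> Q +>\<^bsub>Q\<^esub> x)))"


section \<open>The morphism category and almost split sequences\<close>

record ('a, 'm, 'n) morph =
  Dom :: "('a, 'm) module"
  Cod :: "('a, 'n) module"
  arr :: "'m \<Rightarrow> 'n"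

definition is_H :: "('a, 'f) ring_scheme \<Rightarrow> ('a, 'm, 'n) morph \<Rightarrow> bool" where
  "is_H \<Lambda> A \<longleftrightarrow> fg_module \<Lambda> (Dom A) \<and> fg_module \<Lambda> (Cod A) \<and> arr A \<in> mhom \<Lambda> (Dom A) (Cod A)"

definition is_P :: "('a, 'f) ring_scheme \<Rightarrow> ('a, 'm, 'n) morph \<Rightarrow> bool" where
  "is_P \<Lambda> A \<longleftrightarrow> is_H \<Lambda> A \<and> projective \<Lambda> (Dom A) \<and> projective \<Lambda> (Cod A)"

definition H_hom ::
    "('a, 'f) ring_scheme \<Rightarrow> ('a, 'm, 'n) morph \<Rightarrow> ('a, 'p, 'q) morph \<Rightarrow> (('m \<Rightarrow> 'p) \<times> ('n \<Rightarrow> 'q)) set" where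
  "H_hom \<Lambda> A B = {(s, t). s \<in> mhom \<Lambda> (Dom A) (Dom B) \<and> t \<in> mhom \<Lambda> (Cod A) (Cod B) \<and>
     compose (carrier (Dom A)) t (arr A) = compose (carrier (Dom A)) (arr B) s}"

definition H_id :: "('a, 'm, 'n) morph \<Rightarrow> ('m \<Rightarrow> 'm) \<times> ('n \<Rightarrow> 'n)" where
  "H_id A = ((\<lambda>x\<in>carrier (Dom A). x), (\<lambda>y\<in>carrier (Cod A). y))"

text \<open>\<open>H_comp A g f\<close> is \<open>g\<close> after \<open>f\<close>, where \<open>A\<close> is the source of \<open>f\<close>.\<close>

definition H_comp ::
    "('a, 'm, 'n) morph \<Rightarrow> ('p \<Rightarrow> 'u) \<times> ('q \<Rightarrow> 'v) \<Rightarrow> ('m \<Rightarrow> 'p) \<times> ('n \<Rightarrow> 'q) \<Rightarrow> ('m \<Rightarrow> 'u) \<times> ('n \<Rightarrow> 'v)" where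
  "H_comp A g f = (compose (carrier (Dom A)) (fst g) (fst f),
                   compose (carrier (Cod A)) (snd g) (snd f))"

definition H_section ::
    "('a, 'f) ring_scheme \<Rightarrow> ('a, 'm, 'n) morph \<Rightarrow> ('a, 'p, 'q) morph
      \<Rightarrow> ('m \<Rightarrow> 'p) \<times> ('n \<Rightarrow> 'q) \<Rightarrow> bool" where
  "H_section \<Lambda> A B f \<longleftrightarrow> (\<exists>r\<in>H_hom \<Lambda> B A. H_comp A r f = H_id A)"

definition H_retraction ::
    "('a, 'f) ring_scheme \<Rightarrow> ('a, 'm, 'n) morph \<Rightarrow> ('a, 'p, 'q) morph
      \<Rightarrow> ('m \<Rightarrow> 'p) \<times> ('n \<Rightarrow> 'q) \<Rightarrow> bool" where
  "H_retraction \<Lambda> A B f \<longleftrightarrow> (\<exists>s\<in>H_hom \<Lambda> B A. H_comp B f s = H_id B)"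

definition short_exact ::
    "('a, 'm) module \<Rightarrow> ('m \<Rightarrow> 'n) \<Rightarrow> ('a, 'n) module \<Rightarrow> ('n \<Rightarrow> 'p) \<Rightarrow> ('a, 'p) module \<Rightarrow> bool" where
  "short_exact X f Y g Z \<longleftrightarrow> inj_on f (carrier X) \<and>
     f ` carrier X = {y \<in> carrier Y. g y = \<zero>\<^bsub>Z\<^esub>} \<and> g ` carrier Y = carrier Z"

definition conflation_P ::
    "('a, 'f) ring_scheme \<Rightarrow> ('a, 'm, 'n) morph \<Rightarrow> ('m \<Rightarrow> 'p) \<times> ('n \<Rightarrow> 'q)
      \<Rightarrow> ('a, 'p, 'q) morph \<Rightarrow> ('p \<Rightarrow> 'u) \<times> ('q \<Rightarrow> 'v) \<Rightarrow> ('a, 'u, 'v) morph \<Rightarrow> bool" where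
  "conflation_P \<Lambda> A f B g C \<longleftrightarrow> is_P \<Lambda> A \<and> is_P \<Lambda> B \<and> is_P \<Lambda> C \<and>
     f \<in> H_hom \<Lambda> A B \<and> g \<in> H_hom \<Lambda> B C \<and>
     short_exact (Dom A) (fst f) (Dom B) (fst g) (Dom C) \<and>
     short_exact (Cod A) (snd f) (Cod B) (snd g) (Cod C)"

definition left_almost_split_P ::
    "('a, 'f) ring_scheme \<Rightarrow> ('a, 'm, 'n) morph \<Rightarrow> ('m \<Rightarrow> 'p) \<times> ('n \<Rightarrow> 'q)
      \<Rightarrow> ('a, 'p, 'q) morph \<Rightarrow> bool" where
  "left_almost_split_P \<Lambda> A f B \<longleftrightarrow> \<not> H_section \<Lambda> A B f \<and>
     (\<forall>Z :: ('a, 'a small, 'a small) morph. is_P \<Lambda> Z \<longrightarrow>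
        (\<forall>h\<in>H_hom \<Lambda> A Z. \<not> H_section \<Lambda> A Z h \<longrightarrow> (\<exists>k\<in>H_hom \<Lambda> B Z. H_comp A k f = h)))"

definition right_almost_split_P ::
    "('a, 'f) ring_scheme \<Rightarrow> ('a, 'm, 'n) morph \<Rightarrow> ('m \<Rightarrow> 'p) \<times> ('n \<Rightarrow> 'q)
      \<Rightarrow> ('a, 'p, 'q) morph \<Rightarrow> bool" where
  "right_almost_split_P \<Lambda> B g C \<longleftrightarrow> \<not> H_retraction \<Lambda> B C g \<and>
     (\<forall>Z :: ('a, 'a small, 'a small) morph. is_P \<Lambda> Z \<longrightarrow>
        (\<forall>h\<in>H_hom \<Lambda> Z C. \<not> H_retraction \<Lambda> Z C h \<longrightarrow> (\<exists>k\<in>H_hom \<Lambda> Z B. H_comp Z g k = h)))"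

definition almost_split_sequence_P ::
    "('a, 'f) ring_scheme \<Rightarrow> ('a, 'm, 'n) morph \<Rightarrow> ('m \<Rightarrow> 'p) \<times> ('n \<Rightarrow> 'q)
      \<Rightarrow> ('a, 'p, 'q) morph \<Rightarrow> ('p \<Rightarrow> 'u) \<times> ('q \<Rightarrow> 'v) \<Rightarrow> ('a, 'u, 'v) morph \<Rightarrow> bool" where
  "almost_split_sequence_P \<Lambda> A f B g C \<longleftrightarrow> conflation_P \<Lambda> A f B g C \<and>
     left_almost_split_P \<Lambda> A f B \<and> right_almost_split_P \<Lambda> B g C"

definition from_zero :: "('a, 'm) module \<Rightarrow> ('a, unit, 'm) morph" where
  "from_zero M = \<lparr>Dom = zero_module, Cod = M, arr = zero_map zero_module M\<rparr>"

definition to_zero :: "('a, 'm) module \<Rightarrow> ('a, 'm, unit) morph" where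
  "to_zero M = \<lparr>Dom = M, Cod = zero_module, arr = zero_map M zero_module\<rparr>"

end

theory Submission
  imports Defs
begin

text \<open>
  Finitely generated modules over the commutative artinian ring \<open>R\<close> satisfy the descending chain
  condition; mapping into the injective cogenerator \<open>J\<close> turns descending chains into ascending
  ones, and the canonical map \<open>M \<rightarrow> DDM\<close> is onto because \<open>Hom\<^sub>R(R/m, J)\<close> is simple for
  every maximal ideal \<open>m\<close>.

  By Fitting's lemma the indecomposable injective module \<open>P\<close> has a simple essential socle. A
  functional \<open>\<chi>\<close> on \<open>P\<close> that does not vanish there embeds \<open>P\<close> into \<open>D\<Lambda>\<close> by
  \<open>p \<mapsto> (x \<mapsto> \<chi>(px))\<close>; the embedding splits, and by double duality the idempotent
  endomorphism onto its image is induced by an idempotent \<open>e\<close> of \<open>\<Lambda>\<close>. Hence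
  \<open>P \<cong> D(\<Lambda>e) \<cong> \<nu>(e\<Lambda>)\<close>, and \<open>Q = e\<Lambda>\<close> is indecomposable because \<open>P\<close> is, hence local. A
  nonzero element \<open>s = se\<close> of the socle gives \<open>e\<Lambda> \<rightarrow> soc P\<close> with kernel the radical.

  The almost split property rests on the injectivity of \<open>P\<close> and the lifting property of
  \<open>e\<Lambda>\<close>. If \<open>t : P \<rightarrow> Y\<close> and \<open>w : X \<rightarrow> Y\<close> satisfy \<open>t(P) \<inter> w(X) = 0\<close> with \<open>t\<close> injective, then
  \<open>t\<close> splits modulo \<open>w(X)\<close>; otherwise \<open>t(soc P) \<subseteq> w(X)\<close> and \<open>Q \<rightarrow> soc P\<close> lifts along \<open>w\<close>.
  Dually, \<open>a : X \<rightarrow> Q\<close> either maps \<open>ker w\<close> onto \<open>Q\<close>, and then splits, or sends it into the radical, and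
  then the composite with \<open>\<alpha>\<close> extends along \<open>w\<close>.
\<close>

section \<open>Submodules and homomorphisms\<close>

text \<open>Injectivity is tested on finitely generated modules only, so a map extends from a
  submodule only once that submodule is known to be finitely generated. In general this takes the
  ascending chain condition, whereas \<open>artinian R\<close> is a descending one. \<open>J\<close>
  bridges the two: \<open>Hom(M, J)\<close> inherits the descending condition from \<open>J\<close>,
  and annihilators in it recover the submodules of \<open>M\<close>. Both conditions feed Fitting's
  lemma, applied once to \<open>P\<close> and once to \<open>Q\<close>. The idempotent exists
  because double duality for \<Lambda> over \<open>R\<close> makes each endomorphism of the right
  module D\<Lambda> come from a right multiplication of \<Lambda>; a direct summand of D\<Lambda> is
  therefore D(\<Lambda>e), the functionals unchanged by right multiplication of the argument with e.
  The statement speaks of every \<alpha>, so the argument touches \<alpha> only through its image,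
  the socle, and its kernel, the radical. In formulas the right action is written in front:
  \<open>e \<odot> z\<close> is z e, and z e = z is the condition under which some map on e\<Lambda>
  sends its generator to z.\<close>

lemma submodule_subset: "submodule N R M \<Longrightarrow> N \<subseteq> carrier M"
  using submodule.axioms(1)[THEN subgroup.subset] by fastforce

lemma submodule_mem: "\<lbrakk>submodule N R M; x \<in> N\<rbrakk> \<Longrightarrow> x \<in> carrier M"
  using submodule_subset by blast

lemma submodule_zero: "submodule N R M \<Longrightarrow> \<zero>\<^bsub>M\<^esub> \<in> N"
  using submodule.axioms(1)[THEN subgroup.one_closed] by fastforce

lemma submodule_add: "\<lbrakk>submodule N R M; x \<in> N; y \<in> N\<rbrakk> \<Longrightarrow> x \<oplus>\<^bsub>M\<^esub> y \<in> N"
  using submodule.axioms(1)[THEN subgroup.m_closed] by fastforce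

lemma submodule_minus: "\<lbrakk>submodule N R M; x \<in> N\<rbrakk> \<Longrightarrow> \<ominus>\<^bsub>M\<^esub> x \<in> N"
  using submodule.axioms(1)[THEN subgroup.m_inv_closed] by (fastforce simp: a_inv_def)

lemma submodule_diff: "\<lbrakk>submodule N R M; x \<in> N; y \<in> N\<rbrakk> \<Longrightarrow> x \<ominus>\<^bsub>M\<^esub> y \<in> N"
  by (simp add: a_minus_def submodule_add submodule_minus)

lemma submodule_smult:
  "\<lbrakk>submodule N R M; r \<in> carrier R; x \<in> N\<rbrakk> \<Longrightarrow> r \<odot>\<^bsub>M\<^esub> x \<in> N"
  by (rule submodule.smult_closed)

definition cyclic_submodule :: "('a, 'e) ring_scheme \<Rightarrow> ('a, 'm) module \<Rightarrow> 'm \<Rightarrow> 'm set" where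
  "cyclic_submodule R M x = (\<lambda>r. r \<odot>\<^bsub>M\<^esub> x) ` carrier R"

definition mker :: "('a, 'm) module \<Rightarrow> ('a, 'n) module \<Rightarrow> ('m \<Rightarrow> 'n) \<Rightarrow> 'm set" where
  "mker M N f = {x \<in> carrier M. f x = \<zero>\<^bsub>N\<^esub>}"

context right_module
begin

lemma diff_eq_zero_iff:
  "\<lbrakk>x \<in> carrier M; y \<in> carrier M\<rbrakk> \<Longrightarrow> x \<ominus>\<^bsub>M\<^esub> y = \<zero>\<^bsub>M\<^esub> \<longleftrightarrow> x = y"
  by (metis a_minus_def M.add.inv_closed M.add.inv_comm M.minus_minus M.minus_equality M.r_neg)

lemma diff_zero: "x \<in> carrier M \<Longrightarrow> x \<ominus>\<^bsub>M\<^esub> \<zero>\<^bsub>M\<^esub> = x"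
  using M.minus_equality[of "\<zero>\<^bsub>M\<^esub>" "\<zero>\<^bsub>M\<^esub>"] by (simp add: a_minus_def)

lemma diff_add_cancel:
  "\<lbrakk>x \<in> carrier M; y \<in> carrier M\<rbrakk> \<Longrightarrow> (x \<ominus>\<^bsub>M\<^esub> y) \<oplus>\<^bsub>M\<^esub> y = x"
  by (simp add: a_minus_def M.a_assoc M.l_neg)

lemma smult_minus:
  "\<lbrakk>r \<in> carrier R; x \<in> carrier M\<rbrakk> \<Longrightarrow> r \<odot>\<^bsub>M\<^esub> (\<ominus>\<^bsub>M\<^esub> x) = \<ominus>\<^bsub>M\<^esub> (r \<odot>\<^bsub>M\<^esub> x)"
  by (metis M.add.inv_closed M.minus_equality M.l_neg smult_closed smult_r_distr smult_r_null)

lemma smult_l_minus: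
  "\<lbrakk>r \<in> carrier R; x \<in> carrier M\<rbrakk> \<Longrightarrow> (\<ominus>\<^bsub>R\<^esub> r) \<odot>\<^bsub>M\<^esub> x = \<ominus>\<^bsub>M\<^esub> (r \<odot>\<^bsub>M\<^esub> x)"
  by (metis M.minus_equality R.a_inv_closed R.l_neg smult_closed smult_l_distr smult_l_null)

lemma smult_diff:
  "\<lbrakk>r \<in> carrier R; x \<in> carrier M; y \<in> carrier M\<rbrakk>
    \<Longrightarrow> r \<odot>\<^bsub>M\<^esub> (x \<ominus>\<^bsub>M\<^esub> y) = r \<odot>\<^bsub>M\<^esub> x \<ominus>\<^bsub>M\<^esub> r \<odot>\<^bsub>M\<^esub> y"
  by (simp add: a_minus_def smult_r_distr smult_minus)

lemma smult_l_diff: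
  "\<lbrakk>r \<in> carrier R; s \<in> carrier R; x \<in> carrier M\<rbrakk>
    \<Longrightarrow> (r \<ominus>\<^bsub>R\<^esub> s) \<odot>\<^bsub>M\<^esub> x = r \<odot>\<^bsub>M\<^esub> x \<ominus>\<^bsub>M\<^esub> s \<odot>\<^bsub>M\<^esub> x"
  by (simp add: a_minus_def smult_l_distr smult_l_minus)

lemma carrier_submodule: "submodule (carrier M) R M"
  by (rule submoduleI) auto

lemma zero_submodule: "submodule {\<zero>\<^bsub>M\<^esub>} R M"
  by (rule submoduleI) auto

lemma Int_submodule: "\<lbrakk>submodule N R M; submodule K R M\<rbrakk> \<Longrightarrow> submodule (N \<inter> K) R M"
  by (rule submoduleI) (auto intro: submodule_mem submodule_zero submodule_add submodule_smult)

lemma Inter_submodule: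
  assumes "F \<noteq> {}" "\<And>N. N \<in> F \<Longrightarrow> submodule N R M"
  shows "submodule (\<Inter>F) R M"
  using assms
  by (intro submoduleI) (auto intro: submodule_mem submodule_zero submodule_add submodule_smult)

lemma set_add_mem_iff: "x \<in> N <+>\<^bsub>M\<^esub> K \<longleftrightarrow> (\<exists>n\<in>N. \<exists>k\<in>K. x = n \<oplus>\<^bsub>M\<^esub> k)"
  by (auto simp: set_add_def')

lemma sum_submodule:
  assumes N: "submodule N R M" and K: "submodule K R M"
  shows "submodule (N <+>\<^bsub>M\<^esub> K) R M"
proof (rule submoduleI)
  note mem [simp] = submodule_mem[OF N] submodule_mem[OF K]
  show "N <+>\<^bsub>M\<^esub> K \<subseteq> carrier M" by (auto simp: set_add_mem_iff)
  show "\<zero>\<^bsub>M\<^esub> \<in> N <+>\<^bsub>M\<^esub> K"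
    unfolding set_add_mem_iff
    by (rule bexI[OF _ submodule_zero[OF N]], rule bexI[OF _ submodule_zero[OF K]]) simp
next
  note mem [simp] = submodule_mem[OF N] submodule_mem[OF K]
  fix x y assume "x \<in> N <+>\<^bsub>M\<^esub> K" "y \<in> N <+>\<^bsub>M\<^esub> K"
  then obtain n k n' k' where *: "n \<in> N" "k \<in> K" "n' \<in> N" "k' \<in> K"
    "x = n \<oplus>\<^bsub>M\<^esub> k" "y = n' \<oplus>\<^bsub>M\<^esub> k'"
    unfolding set_add_mem_iff by blast
  then have "x \<oplus>\<^bsub>M\<^esub> y = (n \<oplus>\<^bsub>M\<^esub> n') \<oplus>\<^bsub>M\<^esub> (k \<oplus>\<^bsub>M\<^esub> k')" by (simp add: M.a_ac)
  with * show "x \<oplus>\<^bsub>M\<^esub> y \<in> N <+>\<^bsub>M\<^esub> K"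
    unfolding set_add_mem_iff using submodule_add[OF N] submodule_add[OF K] by blast
next
  note mem [simp] = submodule_mem[OF N] submodule_mem[OF K]
  fix r x assume r: "r \<in> carrier R" and "x \<in> N <+>\<^bsub>M\<^esub> K"
  then obtain n k where *: "n \<in> N" "k \<in> K" "x = n \<oplus>\<^bsub>M\<^esub> k"
    unfolding set_add_mem_iff by blast
  then have "r \<odot>\<^bsub>M\<^esub> x = r \<odot>\<^bsub>M\<^esub> n \<oplus>\<^bsub>M\<^esub> r \<odot>\<^bsub>M\<^esub> k" using r by (simp add: smult_r_distr)
  with * r show "r \<odot>\<^bsub>M\<^esub> x \<in> N <+>\<^bsub>M\<^esub> K"
    unfolding set_add_mem_iff using submodule_smult[OF N] submodule_smult[OF K] by blast
qed

lemma sum_upper: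
  assumes N: "submodule N R M" and K: "submodule K R M"
  shows "N \<subseteq> N <+>\<^bsub>M\<^esub> K" "K \<subseteq> N <+>\<^bsub>M\<^esub> K"
proof -
  have "n = n \<oplus>\<^bsub>M\<^esub> \<zero>\<^bsub>M\<^esub>" if "n \<in> N" for n using submodule_mem[OF N that] by simp
  then show "N \<subseteq> N <+>\<^bsub>M\<^esub> K" using submodule_zero[OF K] set_add_mem_iff by blast
  have "k = \<zero>\<^bsub>M\<^esub> \<oplus>\<^bsub>M\<^esub> k" if "k \<in> K" for k using submodule_mem[OF K that] by simp
  then show "K \<subseteq> N <+>\<^bsub>M\<^esub> K" using submodule_zero[OF N] set_add_mem_iff by blast
qed

lemma sum_least:
  "\<lbrakk>submodule L R M; N \<subseteq> L; K \<subseteq> L\<rbrakk> \<Longrightarrow> N <+>\<^bsub>M\<^esub> K \<subseteq> L"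
  using submodule_add[of L R M] unfolding set_add_def' by blast

lemma cyclic_is_submodule:
  assumes x: "x \<in> carrier M" shows "submodule (cyclic_submodule R M x) R M"
proof (rule submoduleI)
  show "\<zero>\<^bsub>M\<^esub> \<in> cyclic_submodule R M x"
    unfolding cyclic_submodule_def using x by (intro image_eqI[of _ _ "\<zero>\<^bsub>R\<^esub>"]) auto
next
  fix y z assume "y \<in> cyclic_submodule R M x" "z \<in> cyclic_submodule R M x"
  then obtain r s where "r \<in> carrier R" "s \<in> carrier R" "y = r \<odot>\<^bsub>M\<^esub> x" "z = s \<odot>\<^bsub>M\<^esub> x"
    by (auto simp: cyclic_submodule_def)
  then show "y \<oplus>\<^bsub>M\<^esub> z \<in> cyclic_submodule R M x"
    unfolding cyclic_submodule_def using x
    by (intro image_eqI[of _ _ "r \<oplus>\<^bsub>R\<^esub> s"]) (auto simp: smult_l_distr)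
next
  fix a y assume "a \<in> carrier R" "y \<in> cyclic_submodule R M x"
  then obtain r where "r \<in> carrier R" "y = r \<odot>\<^bsub>M\<^esub> x" "a \<in> carrier R"
    by (auto simp: cyclic_submodule_def)
  then show "a \<odot>\<^bsub>M\<^esub> y \<in> cyclic_submodule R M x"
    unfolding cyclic_submodule_def using x
    by (intro image_eqI[of _ _ "r \<otimes>\<^bsub>R\<^esub> a"]) (auto simp: smult_assoc)
qed (use x in \<open>auto simp: cyclic_submodule_def\<close>)

lemma cyclic_self: "x \<in> carrier M \<Longrightarrow> x \<in> cyclic_submodule R M x"
  unfolding cyclic_submodule_def by (rule image_eqI[of _ _ "\<one>\<^bsub>R\<^esub>"]) auto

lemma cyclic_least: "\<lbrakk>submodule N R M; x \<in> N\<rbrakk> \<Longrightarrow> cyclic_submodule R M x \<subseteq> N"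
  by (auto simp: cyclic_submodule_def intro: submodule_smult)

lemma cyclicE:
  assumes "y \<in> cyclic_submodule R M x"
  obtains r where "r \<in> carrier R" "y = r \<odot>\<^bsub>M\<^esub> x"
  using assms by (auto simp: cyclic_submodule_def)

lemma submodule_is_right_module:
  assumes N: "submodule N R M" shows "right_module R (M\<lparr>carrier := N\<rparr>)"
proof -
  note mem [simp] = submodule_mem[OF N]
  note cl [simp] = submodule_zero[OF N] submodule_add[OF N] submodule_smult[OF N]
  have "abelian_group (M\<lparr>carrier := N\<rparr>)"
  proof (rule abelian_groupI)
    fix x assume "x \<in> carrier (M\<lparr>carrier := N\<rparr>)"
    then show "\<exists>y\<in>carrier (M\<lparr>carrier := N\<rparr>). y \<oplus>\<^bsub>M\<lparr>carrier := N\<rparr>\<^esub> x = \<zero>\<^bsub>M\<lparr>carrier := N\<rparr>\<^esub>"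
      using submodule_minus[OF N] by (intro bexI[of _ "\<ominus>\<^bsub>M\<^esub> x"]) (auto simp: M.l_neg)
  qed (auto simp: M.a_ac)
  then show ?thesis
    by (intro right_module.intro right_module_axioms.intro R.ring_axioms)
      (auto simp: smult_l_distr smult_r_distr smult_assoc)
qed

lemma submodule_of_submodule:
  assumes N: "submodule N R M"
  shows "submodule K R (M\<lparr>carrier := N\<rparr>) \<longleftrightarrow> submodule K R M \<and> K \<subseteq> N"
proof
  assume K: "submodule K R (M\<lparr>carrier := N\<rparr>)"
  have "K \<subseteq> N" using submodule_subset[OF K] by simp
  moreover have "submodule K R M"
    using \<open>K \<subseteq> N\<close> submodule_subset[OF N] submodule_zero[OF K] submodule_add[OF K] submodule_smult[OF K]
    by (intro submoduleI) auto
  ultimately show "submodule K R M \<and> K \<subseteq> N" by simp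
next
  assume K: "submodule K R M \<and> K \<subseteq> N"
  interpret N: right_module R "M\<lparr>carrier := N\<rparr>" by (rule submodule_is_right_module[OF N])
  show "submodule K R (M\<lparr>carrier := N\<rparr>)"
    using K submodule_zero[of K] submodule_add[of K] submodule_smult[of K]
    by (intro N.submoduleI) auto
qed

end

section \<open>Homomorphisms between modules\<close>

lemma mhom_closed: "\<lbrakk>f \<in> mhom R M N; x \<in> carrier M\<rbrakk> \<Longrightarrow> f x \<in> carrier N"
  by (auto simp: mhom_def)

lemma mhom_add:
  "\<lbrakk>f \<in> mhom R M N; x \<in> carrier M; y \<in> carrier M\<rbrakk> \<Longrightarrow> f (x \<oplus>\<^bsub>M\<^esub> y) = f x \<oplus>\<^bsub>N\<^esub> f y"
  by (auto simp: mhom_def)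

lemma mhom_smult:
  "\<lbrakk>f \<in> mhom R M N; r \<in> carrier R; x \<in> carrier M\<rbrakk> \<Longrightarrow> f (r \<odot>\<^bsub>M\<^esub> x) = r \<odot>\<^bsub>N\<^esub> f x"
  by (auto simp: mhom_def)

lemma mhom_extensional: "f \<in> mhom R M N \<Longrightarrow> f \<in> extensional (carrier M)"
  by (auto simp: mhom_def PiE_def)

lemma mhom_ext:
  assumes "f \<in> mhom R M N" "g \<in> mhom R M N'" "\<And>x. x \<in> carrier M \<Longrightarrow> f x = g x"
  shows "f = g"
  using assms mhom_extensional by (metis extensionalityI)

lemma mhom_restrictI:
  assumes "right_module R M"
    and "\<And>x. x \<in> carrier M \<Longrightarrow> f x \<in> carrier N"
    and "\<And>x y. \<lbrakk>x \<in> carrier M; y \<in> carrier M\<rbrakk> \<Longrightarrow> f (x \<oplus>\<^bsub>M\<^esub> y) = f x \<oplus>\<^bsub>N\<^esub> f y"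
    and "\<And>r x. \<lbrakk>r \<in> carrier R; x \<in> carrier M\<rbrakk> \<Longrightarrow> f (r \<odot>\<^bsub>M\<^esub> x) = r \<odot>\<^bsub>N\<^esub> f x"
  shows "restrict f (carrier M) \<in> mhom R M N"
proof -
  interpret right_module R M by fact
  show ?thesis using assms(2-) by (simp add: mhom_def)
qed

lemma mhom_compose:
  assumes "right_module R L" "f \<in> mhom R L M" "g \<in> mhom R M N"
  shows "compose (carrier L) g f \<in> mhom R L N"
  unfolding compose_def
  by (rule mhom_restrictI[OF assms(1)])
    (use assms(2,3) in \<open>simp_all add: mhom_closed mhom_add mhom_smult\<close>)

locale module_hom = M: right_module R M + N: right_module R N
  for R :: "('a, 'e) ring_scheme" and M :: "('a, 'm) module" and N :: "('a, 'n) module" +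
  fixes f :: "'m \<Rightarrow> 'n"
  assumes hom: "f \<in> mhom R M N"
begin

lemmas closed [simp] = mhom_closed[OF hom]
lemmas add [simp] = mhom_add[OF hom]
lemmas smult [simp] = mhom_smult[OF hom]

text \<open>Zero and negatives are multiples by the scalars 0 and -1, so linearity yields this rule
  and the next one.\<close>

lemma zero [simp]: "f \<zero>\<^bsub>M\<^esub> = \<zero>\<^bsub>N\<^esub>"
  by (metis M.M.zero_closed M.R.zero_closed M.smult_l_null N.smult_l_null smult closed)

lemma minus [simp]: "x \<in> carrier M \<Longrightarrow> f (\<ominus>\<^bsub>M\<^esub> x) = \<ominus>\<^bsub>N\<^esub> f x"
  by (metis M.smult_minus_one N.smult_minus_one smult closed M.R.add.inv_closed M.R.one_closed)

lemma diff [simp]: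
  "\<lbrakk>x \<in> carrier M; y \<in> carrier M\<rbrakk> \<Longrightarrow> f (x \<ominus>\<^bsub>M\<^esub> y) = f x \<ominus>\<^bsub>N\<^esub> f y"
  by (simp add: a_minus_def)

lemma image_submodule:
  assumes K: "submodule K R M" shows "submodule (f ` K) R N"
proof (rule N.submoduleI)
  note mem = submodule_mem[OF K]
  show "f ` K \<subseteq> carrier N" using mem by auto
  show "\<zero>\<^bsub>N\<^esub> \<in> f ` K" using submodule_zero[OF K] zero by (metis image_eqI)
  show "x \<oplus>\<^bsub>N\<^esub> y \<in> f ` K" if "x \<in> f ` K" "y \<in> f ` K" for x y
    using that mem submodule_add[OF K] by (auto simp flip: add)
  show "r \<odot>\<^bsub>N\<^esub> x \<in> f ` K" if "r \<in> carrier R" "x \<in> f ` K" for r x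
    using that mem submodule_smult[OF K] by (auto simp flip: smult)
qed

lemma vimage_submodule:
  assumes K: "submodule K R N" shows "submodule {x \<in> carrier M. f x \<in> K} R M"
  by (rule M.submoduleI)
    (auto intro: submodule_zero[OF K] submodule_add[OF K] submodule_smult[OF K])

lemma ker_submodule: "submodule (mker M N f) R M"
  using vimage_submodule[OF N.zero_submodule] by (simp add: mker_def)

lemma inj_iff_ker: "inj_on f (carrier M) \<longleftrightarrow> mker M N f \<subseteq> {\<zero>\<^bsub>M\<^esub>}"
proof
  assume "inj_on f (carrier M)"
  then show "mker M N f \<subseteq> {\<zero>\<^bsub>M\<^esub>}"
    unfolding mker_def using inj_onD[of f "carrier M" _ "\<zero>\<^bsub>M\<^esub>"] by auto
next
  assume k: "mker M N f \<subseteq> {\<zero>\<^bsub>M\<^esub>}"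
  show "inj_on f (carrier M)"
  proof (rule inj_onI)
    fix x y assume xy: "x \<in> carrier M" "y \<in> carrier M" "f x = f y"
    then have "x \<ominus>\<^bsub>M\<^esub> y \<in> mker M N f" using N.diff_eq_zero_iff by (simp add: mker_def)
    then show "x = y" using k xy M.diff_eq_zero_iff by auto
  qed
qed

end

lemma module_homI:
  "\<lbrakk>right_module R M; right_module R N; f \<in> mhom R M N\<rbrakk> \<Longrightarrow> module_hom R M N f"
  by (simp add: module_hom_def module_hom_axioms_def)

lemma mhom_corestrict:
  "\<lbrakk>f \<in> mhom R M N; f ` carrier M \<subseteq> K\<rbrakk> \<Longrightarrow> f \<in> mhom R M (N\<lparr>carrier := K\<rparr>)"
  by (auto simp: mhom_def PiE_def)

lemma mhom_coextend:
  assumes "f \<in> mhom R M (N\<lparr>carrier := K\<rparr>)" "K \<subseteq> carrier N"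
  shows "f \<in> mhom R M N"
  using assms by (auto simp: mhom_def PiE_def)

lemma miso_inverse:
  assumes M: "right_module R M" and N: "right_module R N" and f: "f \<in> miso R M N"
  obtains g where "g \<in> miso R N M" "\<forall>x\<in>carrier M. g (f x) = x"
    "\<forall>y\<in>carrier N. f (g y) = y"
proof -
  interpret M: right_module R M by fact
  interpret N: right_module R N by fact
  have hom: "f \<in> mhom R M N" and bij: "bij_betw f (carrier M) (carrier N)"
    using f by (auto simp: miso_def)
  \<comment> \<open>The inverse is cut off at the carrier, since members of \<open>mhom\<close> are
    extensional.\<close>
  define g where "g = restrict (inv_into (carrier M) f) (carrier N)"
  have gf: "g (f x) = x" if "x \<in> carrier M" for x
    using that bij mhom_closed[OF hom] by (simp add: g_def bij_betw_inv_into_left)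
  have fg: "f (g y) = y" if "y \<in> carrier N" for y
    using that bij by (simp add: g_def bij_betw_inv_into_right)
  have gM: "g y \<in> carrier M" if "y \<in> carrier N" for y
    using that bij by (simp add: g_def bij_betw_def inv_into_into)
  have "g \<in> mhom R N M"
  proof -
    have "g (x \<oplus>\<^bsub>N\<^esub> y) = g x \<oplus>\<^bsub>M\<^esub> g y" if "x \<in> carrier N" "y \<in> carrier N" for x y
      using that gf[of "g x \<oplus>\<^bsub>M\<^esub> g y"] gM fg mhom_add[OF hom, of "g x" "g y"] by simp
    moreover have "g (r \<odot>\<^bsub>N\<^esub> x) = r \<odot>\<^bsub>M\<^esub> g x" if "r \<in> carrier R" "x \<in> carrier N" for x r
      using that gf[of "r \<odot>\<^bsub>M\<^esub> g x"] gM fg mhom_smult[OF hom, of r "g x"] by simp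
    ultimately have "restrict g (carrier N) \<in> mhom R N M"
      using gM by (intro mhom_restrictI[OF N]) auto
    then show ?thesis by (simp add: g_def)
  qed
  moreover have "bij_betw g (carrier N) (carrier M)"
    by (rule bij_betw_byWitness[of _ f]) (use gf fg gM mhom_closed[OF hom] in auto)
  ultimately show thesis using gf fg by (intro that[of g]) (simp_all add: miso_def)
qed

section \<open>Finite generation\<close>

lemma fg_right_module: "fg_module R M \<Longrightarrow> right_module R M"
  by (simp add: fg_module_def)

lemma fg_moduleE:
  assumes "fg_module R M"
  obtains S where "finite S" "S \<subseteq> carrier M"
    "\<forall>K. submodule K R M \<longrightarrow> S \<subseteq> K \<longrightarrow> K = carrier M"
proof -
  from assms obtain S where "finite S" "S \<subseteq> carrier M"
      "\<forall>K. submodule K R M \<and> S \<subseteq> K \<longrightarrow> K = carrier M"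
    unfolding fg_module_def by (elim conjE exE)
  then show thesis by (intro that[of S]) simp_all
qed

lemma fg_moduleI:
  assumes "right_module R M" "finite S" "S \<subseteq> carrier M"
    "\<And>K. \<lbrakk>submodule K R M; S \<subseteq> K\<rbrakk> \<Longrightarrow> K = carrier M"
  shows "fg_module R M"
  unfolding fg_module_def using assms by (intro conjI exI[of _ S] allI impI) simp_all

text \<open>Generation is phrased through the submodules containing the generators, and these are
  pulled back along f.\<close>

lemma fg_surjective_image:
  assumes M: "fg_module R M" and N: "right_module R N" and f: "f \<in> mhom R M N"
    and onto: "f ` carrier M = carrier N"
  shows "fg_module R N"
proof -
  interpret module_hom R M N f
    by (rule module_homI[OF fg_right_module[OF M] N f])
  obtain S where S: "finite S" "S \<subseteq> carrier M"
    "\<forall>K. submodule K R M \<longrightarrow> S \<subseteq> K \<longrightarrow> K = carrier M"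
    by (rule fg_moduleE[OF M])
  have "K = carrier N" if K: "submodule K R N" "f ` S \<subseteq> K" for K
  proof -
    have "{x \<in> carrier M. f x \<in> K} = carrier M"
      using S(2) K(2) by (intro S(3)[rule_format] vimage_submodule K(1)) auto
    then have "f ` carrier M \<subseteq> K" by blast
    then show ?thesis using onto submodule_subset[OF K(1)] by simp
  qed
  then show ?thesis using N S(1,2) by (intro fg_moduleI[of R N "f ` S"]) auto
qed

lemma (in right_module) fg_cyclic:
  assumes x: "x \<in> carrier M" shows "fg_module R (M\<lparr>carrier := cyclic_submodule R M x\<rparr>)"
proof (rule fg_moduleI[of R _ "{x}"])
  fix K assume "submodule K R (M\<lparr>carrier := cyclic_submodule R M x\<rparr>)" "{x} \<subseteq> K"
  then show "K = carrier (M\<lparr>carrier := cyclic_submodule R M x\<rparr>)"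
    using cyclic_least[of K x] by (simp add: submodule_of_submodule[OF cyclic_is_submodule[OF x]])
qed (use submodule_is_right_module[OF cyclic_is_submodule[OF x]] cyclic_self[OF x] in auto)

lemma fg_submodule_image:
  assumes M: "fg_module R M" and N: "right_module R N" and f: "f \<in> mhom R M N"
  shows "fg_module R (N\<lparr>carrier := f ` carrier M\<rparr>)"
proof -
  interpret module_hom R M N f
    by (rule module_homI[OF fg_right_module[OF M] N f])
  show ?thesis
    using N.submodule_is_right_module[OF image_submodule[OF M.carrier_submodule]]
    by (intro fg_surjective_image[OF M _ mhom_corestrict[OF f]]) auto
qed

section \<open>Quotient modules\<close>

context right_module
begin

lemma submodule_abelian_subgroup: "submodule N R M \<Longrightarrow> abelian_subgroup N M"
  by (intro abelian_subgroupI3 additive_subgroup.intro M.abelian_group_axioms submodule.axioms(1))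

lemma coset_eq_iff:
  assumes N: "submodule N R M" and xy: "x \<in> carrier M" "y \<in> carrier M"
  shows "N +>\<^bsub>M\<^esub> x = N +>\<^bsub>M\<^esub> y \<longleftrightarrow> x \<ominus>\<^bsub>M\<^esub> y \<in> N"
proof -
  interpret N: abelian_subgroup N M by (rule submodule_abelian_subgroup[OF N])
  show ?thesis
    using N.a_rcos_module[of y x] N.a_rcos_self[of x] N.a_repr_independence'[of x y] xy
    by (auto simp: a_minus_def)
qed

lemma quotient_carrier: "carrier (quotient_module M N) = (\<lambda>x. N +>\<^bsub>M\<^esub> x) ` carrier M"
  by (auto simp: quotient_module_def A_RCOSETS_def')

lemma quotient_zero: "\<zero>\<^bsub>quotient_module M N\<^esub> = N"
  by (simp add: quotient_module_def)

lemma quotient_add: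
  assumes "submodule N R M" "x \<in> carrier M" "y \<in> carrier M"
  shows "(N +>\<^bsub>M\<^esub> x) \<oplus>\<^bsub>quotient_module M N\<^esub> (N +>\<^bsub>M\<^esub> y) = N +>\<^bsub>M\<^esub> (x \<oplus>\<^bsub>M\<^esub> y)"
  using abelian_subgroup.a_rcos_sum[OF submodule_abelian_subgroup[OF assms(1)] assms(2,3)]
  by (simp add: quotient_module_def)

text \<open>Multiplying a coset by r may give less than a full coset; the summand N in the
  definition of the action fills it up.\<close>

lemma quotient_smult:
  assumes N: "submodule N R M" and r: "r \<in> carrier R" and x: "x \<in> carrier M"
  shows "r \<odot>\<^bsub>quotient_module M N\<^esub> (N +>\<^bsub>M\<^esub> x) = N +>\<^bsub>M\<^esub> (r \<odot>\<^bsub>M\<^esub> x)"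
proof -
  note mem = submodule_mem[OF N]
  have "N <+>\<^bsub>M\<^esub> (\<lambda>x. r \<odot>\<^bsub>M\<^esub> x) ` (N +>\<^bsub>M\<^esub> x) = N +>\<^bsub>M\<^esub> (r \<odot>\<^bsub>M\<^esub> x)"
  proof (intro equalityI subsetI)
    fix y assume "y \<in> N <+>\<^bsub>M\<^esub> (\<lambda>x. r \<odot>\<^bsub>M\<^esub> x) ` (N +>\<^bsub>M\<^esub> x)"
    then obtain n k where nk: "n \<in> N" "k \<in> N" "y = n \<oplus>\<^bsub>M\<^esub> r \<odot>\<^bsub>M\<^esub> (k \<oplus>\<^bsub>M\<^esub> x)"
      by (auto simp: set_add_def' a_r_coset_def')
    then have "y = (n \<oplus>\<^bsub>M\<^esub> r \<odot>\<^bsub>M\<^esub> k) \<oplus>\<^bsub>M\<^esub> r \<odot>\<^bsub>M\<^esub> x"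
      using mem r x by (simp add: smult_r_distr M.a_assoc)
    moreover have "n \<oplus>\<^bsub>M\<^esub> r \<odot>\<^bsub>M\<^esub> k \<in> N"
      using nk r submodule_add[OF N] submodule_smult[OF N] by blast
    ultimately show "y \<in> N +>\<^bsub>M\<^esub> (r \<odot>\<^bsub>M\<^esub> x)" by (auto simp: a_r_coset_def')
  next
    fix y assume "y \<in> N +>\<^bsub>M\<^esub> (r \<odot>\<^bsub>M\<^esub> x)"
    then obtain n where n: "n \<in> N" "y = n \<oplus>\<^bsub>M\<^esub> r \<odot>\<^bsub>M\<^esub> x" by (auto simp: a_r_coset_def')
    moreover have "x \<in> N +>\<^bsub>M\<^esub> x"
      using abelian_subgroup.a_rcos_self[OF submodule_abelian_subgroup[OF N] x] .
    ultimately show "y \<in> N <+>\<^bsub>M\<^esub> (\<lambda>x. r \<odot>\<^bsub>M\<^esub> x) ` (N +>\<^bsub>M\<^esub> x)"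
      by (auto simp: set_add_mem_iff)
  qed
  then show ?thesis by (simp add: quotient_module_def)
qed

lemma quotient_right_module:
  assumes N: "submodule N R M" shows "right_module R (quotient_module M N)"
proof -
  note [simp] = quotient_carrier quotient_add[OF N] quotient_smult[OF N]
  \<comment> \<open>With zero written as a coset, every axiom becomes an identity between
    representatives.\<close>
  have zero: "\<zero>\<^bsub>quotient_module M N\<^esub> = N +>\<^bsub>M\<^esub> \<zero>\<^bsub>M\<^esub>"
    using submodule_subset[OF N] by (simp add: quotient_zero)
  have "abelian_group (quotient_module M N)"
  proof (rule abelian_groupI)
    fix X assume "X \<in> carrier (quotient_module M N)"
    then obtain x where x: "x \<in> carrier M" "X = N +>\<^bsub>M\<^esub> x" by auto
    then show "\<exists>Y\<in>carrier (quotient_module M N).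
        Y \<oplus>\<^bsub>quotient_module M N\<^esub> X = \<zero>\<^bsub>quotient_module M N\<^esub>"
      by (intro bexI[of _ "N +>\<^bsub>M\<^esub> (\<ominus>\<^bsub>M\<^esub> x)"]) (auto simp: zero M.l_neg)
  qed (auto simp: zero M.a_ac)
  then show ?thesis
    by (intro right_module.intro right_module_axioms.intro R.ring_axioms)
      (auto simp: smult_l_distr smult_r_distr smult_assoc)
qed

lemma quotient_proj_hom:
  assumes N: "submodule N R M"
  shows "(\<lambda>x\<in>carrier M. N +>\<^bsub>M\<^esub> x) \<in> mhom R M (quotient_module M N)"
  by (rule mhom_restrictI[OF right_module_axioms])
    (simp_all add: quotient_carrier quotient_add[OF N] quotient_smult[OF N])

lemma coset_eq_zero_iff:
  assumes N: "submodule N R M" and x: "x \<in> carrier M"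
  shows "N +>\<^bsub>M\<^esub> x = N \<longleftrightarrow> x \<in> N"
  using coset_eq_iff[OF N x M.zero_closed] submodule_subset[OF N] x diff_zero by simp

end

lemma fg_quotient:
  assumes M: "fg_module R M" and N: "submodule N R M"
  shows "fg_module R (quotient_module M N)"
proof -
  interpret right_module R M by (rule fg_right_module[OF M])
  show ?thesis
    by (rule fg_surjective_image[OF M quotient_right_module[OF N] quotient_proj_hom[OF N]])
      (simp add: quotient_carrier image_def)
qed

text \<open>Moves a module to the element type over which \<open>projective\<close> and
  \<open>injective\<close> quantify.\<close>

lemma fg_isomorphic_small:
  assumes M: "fg_module R (M :: ('a, 'm) module)"
  obtains N :: "('a, 'a small) module" and f g where "fg_module R N" "f \<in> mhom R M N"
    "g \<in> mhom R N M" "\<forall>x\<in>carrier M. g (f x) = x" "\<forall>y\<in>carrier N. f (g y) = y"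
proof -
  obtain N :: "('a, 'a small) module" and f where N: "fg_module R N" and f: "f \<in> miso R M N"
    using fg_module_small[OF M] unfolding isomorphic_def by blast
  obtain g where g: "g \<in> miso R N M" "\<forall>x\<in>carrier M. g (f x) = x" "\<forall>y\<in>carrier N. f (g y) = y"
    by (rule miso_inverse[OF fg_right_module[OF M] fg_right_module[OF N] f])
  show thesis using N f g by (intro that[of N f g]) (simp_all add: miso_def)
qed

text \<open>The test modules in \<open>injective\<close> have elements of type
  \<open>'a small\<close>; conjugating f and g with isomorphisms onto small copies makes the
  property available at all types.\<close>

lemma injective_extend:
  fixes X :: "('a, 'x) module" and Y :: "('a, 'y) module" and I :: "('a, 'i) module"
  assumes I: "injective R I" and X: "fg_module R X" and Y: "fg_module R Y"
    and f: "f \<in> mhom R X Y" "inj_on f (carrier X)" and g: "g \<in> mhom R X I"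
  obtains h where "h \<in> mhom R Y I" "\<forall>x\<in>carrier X. h (f x) = g x"
proof -
  obtain X' :: "('a, 'a small) module" and a a' where X': "fg_module R X'" "a \<in> mhom R X X'"
    "a' \<in> mhom R X' X" "\<forall>x\<in>carrier X. a' (a x) = x" "\<forall>y\<in>carrier X'. a (a' y) = y"
    by (rule fg_isomorphic_small[OF X])
  obtain Y' :: "('a, 'a small) module" and b b' where Y': "fg_module R Y'" "b \<in> mhom R Y Y'"
    "b' \<in> mhom R Y' Y" "\<forall>x\<in>carrier Y. b' (b x) = x" "\<forall>y\<in>carrier Y'. b (b' y) = y"
    by (rule fg_isomorphic_small[OF Y])
  note rm = fg_right_module[OF X] fg_right_module[OF Y] fg_right_module[OF X'(1)]
    fg_right_module[OF Y'(1)]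
  define f' where "f' = compose (carrier X') (compose (carrier X) b f) a'"
  define g' where "g' = compose (carrier X') g a'"
  have f': "f' \<in> mhom R X' Y'" unfolding f'_def
    by (intro mhom_compose[OF rm(3) X'(3)] mhom_compose[OF rm(1) f(1)] Y'(2))
  have g': "g' \<in> mhom R X' I" unfolding g'_def by (intro mhom_compose[OF rm(3) X'(3)] g)
  have fx: "f' x = b (f (a' x))" if "x \<in> carrier X'" for x
    using that by (simp add: f'_def compose_eq mhom_closed[OF X'(3)])
  have "inj_on f' (carrier X')"
  proof (rule inj_onI)
    fix x y assume xy: "x \<in> carrier X'" "y \<in> carrier X'" "f' x = f' y"
    have "b' (b (f (a' x))) = b' (b (f (a' y)))" using xy fx by simp
    then have "f (a' x) = f (a' y)"
      using xy Y'(4) by (simp add: mhom_closed[OF f(1)] mhom_closed[OF X'(3)])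
    then have "a' x = a' y"
      using f(2) xy by (auto dest: inj_onD simp: mhom_closed[OF X'(3)])
    then show "x = y" using X'(5) xy by metis
  qed
  then obtain h where h: "h \<in> mhom R Y' I" "compose (carrier X') h f' = g'"
    using I[unfolded injective_def, THEN conjunct2, rule_format, OF conjI[OF X'(1) Y'(1)] f' g']
    by blast
  show thesis
  proof (rule that)
    show "compose (carrier Y) h b \<in> mhom R Y I" by (intro mhom_compose[OF rm(2) Y'(2)] h(1))
    show "\<forall>x\<in>carrier X. compose (carrier Y) h b (f x) = g x"
    proof
      fix x assume x: "x \<in> carrier X"
      have ax: "a x \<in> carrier X'" using x by (simp add: mhom_closed[OF X'(2)])
      have "compose (carrier X') h f' (a x) = g' (a x)" using h(2) by simp
      then show "compose (carrier Y) h b (f x) = g x"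
        using x ax X'(4) fx by (simp add: compose_eq g'_def mhom_closed[OF f(1)])
    qed
  qed
qed

text \<open>The premise \<open>fgN\<close> is met in three ways later: N is cyclic, N is the image
  of a finitely generated module, or the ascending chain condition holds.\<close>

lemma injective_extend_submodule:
  assumes I: "injective R I" and Y: "fg_module R Y" and N: "submodule N R Y"
    and fgN: "fg_module R (Y\<lparr>carrier := N\<rparr>)" and g: "g \<in> mhom R (Y\<lparr>carrier := N\<rparr>) I"
  obtains h where "h \<in> mhom R Y I" "\<forall>x\<in>N. h x = g x"
proof -
  have "restrict (\<lambda>x. x) N \<in> mhom R (Y\<lparr>carrier := N\<rparr>) Y"
    using mhom_restrictI[OF fg_right_module[OF fgN], of "\<lambda>x. x" Y] submodule_mem[OF N] by simp
  moreover have "inj_on (restrict (\<lambda>x. x) N) (carrier (Y\<lparr>carrier := N\<rparr>))"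
    by (simp add: inj_on_def)
  ultimately obtain h where "h \<in> mhom R Y I"
      "\<forall>x\<in>carrier (Y\<lparr>carrier := N\<rparr>). h (restrict (\<lambda>x. x) N x) = g x"
    by (rule injective_extend[OF I fgN Y _ _ g])
  then show thesis by (intro that[of h]) simp_all
qed

section \<open>Chain conditions\<close>

text \<open>The flag is true for the ascending and false for the descending chain condition.\<close>

definition chain_cond :: "bool \<Rightarrow> ('a, 'e) ring_scheme \<Rightarrow> ('a, 'm) module \<Rightarrow> bool" where
  "chain_cond asc R M \<longleftrightarrow>
     (\<forall>V. (\<forall>n::nat. submodule (V n) R M \<and> (if asc then V n \<subseteq> V (Suc n) else V (Suc n) \<subseteq> V n))
        \<longrightarrow> (\<exists>n. \<forall>m\<ge>n. V m = V n))"

lemma chain_condI: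
  assumes "\<And>V :: nat \<Rightarrow> 'm set. \<lbrakk>\<And>n. submodule (V n) R M;
      \<And>n. if asc then V n \<subseteq> V (Suc n) else V (Suc n) \<subseteq> V n\<rbrakk> \<Longrightarrow> \<exists>n. \<forall>m\<ge>n. V m = V n"
  shows "chain_cond asc R (M :: ('a, 'm) module)"
  using assms unfolding chain_cond_def by blast

lemma chain_condD:
  assumes "chain_cond asc R M" "\<And>n. submodule (V n) R M"
    "\<And>n. if asc then V n \<subseteq> V (Suc n) else V (Suc n) \<subseteq> V n"
  shows "\<exists>n. \<forall>m\<ge>n. V m = V n"
  using assms(1)[unfolded chain_cond_def, rule_format, of V] assms(2,3) by blast

text \<open>Without a minimal member, repeated choice of a smaller one produces a chain that never
  stabilises.\<close>

lemma minimal_submodule_exists: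
  assumes cc: "chain_cond False R M" and F: "F \<noteq> {}" "\<And>N. N \<in> F \<Longrightarrow> submodule N R M"
  obtains N where "N \<in> F" "\<forall>K\<in>F. K \<subseteq> N \<longrightarrow> K = N"
proof (rule ccontr)
  note obtain_N = that
  assume "\<not> thesis"
  then have "\<forall>N\<in>F. \<exists>K. K \<in> F \<and> K \<subset> N" using obtain_N by blast
  then obtain g where g: "\<forall>N\<in>F. g N \<in> F \<and> g N \<subset> N" by (rule bchoice[THEN exE])
  obtain N0 where N0: "N0 \<in> F" using F(1) by blast
  define f where "f = rec_nat N0 (\<lambda>_. g)"
  have fF: "f n \<in> F" for n using N0 g by (induction n) (simp_all add: f_def)
  have step: "f (Suc n) \<subset> f n" for n using bspec[OF g fF[of n]] by (simp add: f_def)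
  have "\<exists>n. \<forall>m\<ge>n. f m = f n"
    by (rule chain_condD[where V = f, OF cc])
      (simp_all only: F(2)[OF fF] psubset_imp_subset[OF step] if_True if_False)
  then obtain n where "\<forall>m\<ge>n. f m = f n" ..
  then have "f (Suc n) = f n" using le_SucI by blast
  then show False using step[of n] by simp
qed

lemma maximal_submodule_exists:
  assumes cc: "chain_cond True R M" and F: "F \<noteq> {}" "\<And>N. N \<in> F \<Longrightarrow> submodule N R M"
  obtains N where "N \<in> F" "\<forall>K\<in>F. N \<subseteq> K \<longrightarrow> K = N"
proof (rule ccontr)
  note obtain_N = that
  assume "\<not> thesis"
  then have "\<forall>N\<in>F. \<exists>K. K \<in> F \<and> N \<subset> K" using obtain_N by blast
  then obtain g where g: "\<forall>N\<in>F. g N \<in> F \<and> N \<subset> g N" by (rule bchoice[THEN exE])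
  obtain N0 where N0: "N0 \<in> F" using F(1) by blast
  define f where "f = rec_nat N0 (\<lambda>_. g)"
  have fF: "f n \<in> F" for n using N0 g by (induction n) (simp_all add: f_def)
  have step: "f n \<subset> f (Suc n)" for n using bspec[OF g fF[of n]] by (simp add: f_def)
  have "\<exists>n. \<forall>m\<ge>n. f m = f n"
    by (rule chain_condD[where V = f, OF cc])
      (simp_all only: F(2)[OF fF] psubset_imp_subset[OF step] if_True if_False)
  then obtain n where "\<forall>m\<ge>n. f m = f n" ..
  then have "f (Suc n) = f n" using le_SucI by blast
  then show False using step[of n] by simp
qed

section \<open>Spans, Zorn's lemma and chains in cyclic extensions\<close>

definition mspan :: "('a, 'e) ring_scheme \<Rightarrow> ('a, 'm) module \<Rightarrow> 'm set \<Rightarrow> 'm set" where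
  "mspan R M S = \<Inter>{N. submodule N R M \<and> S \<subseteq> N}"

context right_module
begin

lemma span_submodule: "S \<subseteq> carrier M \<Longrightarrow> submodule (mspan R M S) R M"
  unfolding mspan_def using carrier_submodule by (intro Inter_submodule) auto

lemma span_superset: "S \<subseteq> mspan R M S"
  by (auto simp: mspan_def)

lemma span_least: "\<lbrakk>submodule N R M; S \<subseteq> N\<rbrakk> \<Longrightarrow> mspan R M S \<subseteq> N"
  by (auto simp: mspan_def)

text \<open>A maximal member among the spans of finite subsets of N absorbs every further element of
  N.\<close>

lemma fg_submodule:
  assumes cc: "chain_cond True R M" and N: "submodule N R M"
  shows "fg_module R (M\<lparr>carrier := N\<rparr>)"
proof -
  have sub: "S \<subseteq> carrier M" if "S \<subseteq> N" for S using that submodule_subset[OF N] by simp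
  define F where "F = mspan R M ` {S. finite S \<and> S \<subseteq> N}"
  have "F \<noteq> {}" by (auto simp: F_def)
  moreover have "submodule K R M" if "K \<in> F" for K
    using that span_submodule sub by (auto simp: F_def)
  ultimately obtain K where K: "K \<in> F" "\<forall>L\<in>F. K \<subseteq> L \<longrightarrow> L = K"
    by (rule maximal_submodule_exists[OF cc])
  then obtain S where S: "finite S" "S \<subseteq> N" "K = mspan R M S" by (auto simp: F_def)
  have "N \<subseteq> K"
  proof
    fix x assume x: "x \<in> N"
    have "K \<subseteq> mspan R M (insert x S)"
      unfolding S(3) using x S(2) sub[of "insert x S"] span_superset[of "insert x S"]
      by (intro span_least span_submodule) simp_all
    moreover have "mspan R M (insert x S) \<in> F" using x S(1,2) by (simp add: F_def)
    ultimately have "mspan R M (insert x S) = K" using K(2) by blast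
    then show "x \<in> K" using span_superset[of "insert x S"] by auto
  qed
  show ?thesis
  proof (rule fg_moduleI[of R _ S])
    fix L assume "submodule L R (M\<lparr>carrier := N\<rparr>)" "S \<subseteq> L"
    then show "L = carrier (M\<lparr>carrier := N\<rparr>)"
      using \<open>N \<subseteq> K\<close> S span_least[of L S] by (auto simp: submodule_of_submodule[OF N])
  qed (use S submodule_is_right_module[OF N] in auto)
qed

text \<open>Zorn's lemma. If x generates M, then K is a maximal submodule; the lemma is applied to
  the unit of \<open>R\<close> and to the generator q of e\<Lambda>.\<close>

lemma maximal_avoiding:
  assumes N: "submodule N R M" and x: "x \<in> carrier M" "x \<notin> N"
  obtains K where "submodule K R M" "N \<subseteq> K" "x \<notin> K"
    "\<forall>L. submodule L R M \<longrightarrow> K \<subseteq> L \<longrightarrow> x \<notin> L \<longrightarrow> L = K"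
proof -
  define F where "F = {K. submodule K R M \<and> N \<subseteq> K \<and> x \<notin> K}"
  have "\<exists>K\<in>F. \<forall>L\<in>F. K \<subseteq> L \<longrightarrow> L = K"
  proof (rule subset_Zorn_nonempty)
    show "F \<noteq> {}" using N x by (auto simp: F_def)
    fix C assume C: "C \<noteq> {}" "subset.chain F C"
    then have "C \<subseteq> F" and tot: "\<forall>K\<in>C. \<forall>L\<in>C. K \<subseteq> L \<or> L \<subseteq> K"
      by (simp_all add: subset_chain_def)
    then have CF: "submodule K R M" "N \<subseteq> K" "x \<notin> K" if "K \<in> C" for K
      using that by (auto simp: F_def)
    obtain K0 where K0: "K0 \<in> C" using C(1) by auto
    have "submodule (\<Union>C) R M"
    proof (rule submoduleI)
      fix a b assume "a \<in> \<Union>C" "b \<in> \<Union>C"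
      then obtain K L where KL: "K \<in> C" "L \<in> C" "a \<in> K" "b \<in> L" by auto
      then obtain T where T: "T \<in> C" "a \<in> T" "b \<in> T" using tot[rule_format, of K L] by auto
      then show "a \<oplus>\<^bsub>M\<^esub> b \<in> \<Union>C" using submodule_add[OF CF(1)[OF T(1)] T(2,3)] by auto
    next
      show "\<zero>\<^bsub>M\<^esub> \<in> \<Union>C" using submodule_zero[OF CF(1)[OF K0]] K0 by auto
      show "\<Union>C \<subseteq> carrier M" using submodule_subset[OF CF(1)] by auto
    next
      fix r a assume r: "r \<in> carrier R" and "a \<in> \<Union>C"
      then obtain K where K: "K \<in> C" "a \<in> K" by auto
      then show "r \<odot>\<^bsub>M\<^esub> a \<in> \<Union>C" using submodule_smult[OF CF(1)[OF K(1)] r K(2)] by auto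
    qed
    then show "\<Union>C \<in> F" using CF(2,3) K0 by (auto simp: F_def)
  qed
  then obtain K where K: "K \<in> F" "\<forall>L\<in>F. K \<subseteq> L \<longrightarrow> L = K" by blast
  show thesis
  proof (rule that[of K])
    show "\<forall>L. submodule L R M \<longrightarrow> K \<subseteq> L \<longrightarrow> x \<notin> L \<longrightarrow> L = K"
      using K unfolding F_def by blast
  qed (use K(1) in \<open>simp_all add: F_def\<close>)
qed

text \<open>In a chain of submodules of a cyclic extension of \<open>N\<close>, two members agree as soon as they
  agree inside \<open>N\<close> and have the same ideal of coefficients at the additional generator.\<close>

lemma chain_cond_cyclic_extension:
  assumes N: "submodule N R M" and x: "x \<in> carrier M" and com: "cring R"
    and art: "artinian R"
    and IH: "\<And>V. \<lbrakk>\<And>n::nat. submodule (V n) R M; \<And>n. V n \<subseteq> N; \<And>n. V (Suc n) \<subseteq> V n\<rbrakk>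
      \<Longrightarrow> \<exists>n. \<forall>m\<ge>n. V m = V n"
    and V: "\<And>n::nat. submodule (V n) R M" "\<And>n. V n \<subseteq> cyclic_submodule R M x <+>\<^bsub>M\<^esub> N"
      "\<And>n. V (Suc n) \<subseteq> V n"
  shows "\<exists>n. \<forall>m\<ge>n. V m = V n"
proof -
  interpret cring R by (rule com)
  note mem [simp] = submodule_mem[OF N]
  \<comment> \<open>The coefficients at x of the elements of \<open>V n\<close>, read modulo N. They
    form a descending chain of ideals, to which the artinian condition applies.\<close>
  define I where "I n = {r \<in> carrier R. \<exists>y\<in>N. r \<odot>\<^bsub>M\<^esub> x \<oplus>\<^bsub>M\<^esub> y \<in> V n}" for n
  have dec: "V m \<subseteq> V n" if "n \<le> m" for n m using that V(3) by (rule lift_Suc_antimono_le[rotated])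
  have "ideal (I n) R" for n
  proof (rule idealI[OF R.ring_axioms])
    show "subgroup (I n) (add_monoid R)"
    proof (rule R.add.subgroupI)
      have "\<zero>\<^bsub>M\<^esub> \<in> N" "\<zero>\<^bsub>M\<^esub> \<in> V n" using submodule_zero N V(1) by blast+
      then have "\<zero>\<^bsub>R\<^esub> \<in> I n" using x by (auto simp: I_def intro!: bexI[of _ "\<zero>\<^bsub>M\<^esub>"])
      then show "I n \<noteq> {}" by blast
    next
      fix a assume "a \<in> I n"
      then obtain y where y: "a \<in> carrier R" "y \<in> N" "a \<odot>\<^bsub>M\<^esub> x \<oplus>\<^bsub>M\<^esub> y \<in> V n" by (auto simp: I_def)
      then have "\<ominus>\<^bsub>M\<^esub> (a \<odot>\<^bsub>M\<^esub> x \<oplus>\<^bsub>M\<^esub> y) \<in> V n" using submodule_minus[OF V(1)] by simp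
      then have "(\<ominus>\<^bsub>R\<^esub> a) \<odot>\<^bsub>M\<^esub> x \<oplus>\<^bsub>M\<^esub> (\<ominus>\<^bsub>M\<^esub> y) \<in> V n"
        using y x by (simp add: smult_l_minus M.minus_add)
      then show "\<ominus>\<^bsub>R\<^esub> a \<in> I n" using y submodule_minus[OF N] by (auto simp: I_def)
    next
      fix a b assume "a \<in> I n" "b \<in> I n"
      then obtain y z where y: "a \<in> carrier R" "y \<in> N" "a \<odot>\<^bsub>M\<^esub> x \<oplus>\<^bsub>M\<^esub> y \<in> V n"
        and z: "b \<in> carrier R" "z \<in> N" "b \<odot>\<^bsub>M\<^esub> x \<oplus>\<^bsub>M\<^esub> z \<in> V n" by (auto simp: I_def)
      have "(a \<odot>\<^bsub>M\<^esub> x \<oplus>\<^bsub>M\<^esub> y) \<oplus>\<^bsub>M\<^esub> (b \<odot>\<^bsub>M\<^esub> x \<oplus>\<^bsub>M\<^esub> z) \<in> V n"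
        using submodule_add[OF V(1) y(3) z(3)] .
      moreover have "(a \<odot>\<^bsub>M\<^esub> x \<oplus>\<^bsub>M\<^esub> y) \<oplus>\<^bsub>M\<^esub> (b \<odot>\<^bsub>M\<^esub> x \<oplus>\<^bsub>M\<^esub> z)
          = (a \<oplus>\<^bsub>R\<^esub> b) \<odot>\<^bsub>M\<^esub> x \<oplus>\<^bsub>M\<^esub> (y \<oplus>\<^bsub>M\<^esub> z)"
        using y(1,2) z(1,2) x by (simp add: smult_l_distr M.a_ac)
      ultimately show "a \<oplus>\<^bsub>R\<^esub> b \<in> I n"
        using y z submodule_add[OF N y(2) z(2)] by (auto simp: I_def)
    qed (auto simp: I_def)
    fix a r assume "a \<in> I n" and r: "r \<in> carrier R"
    then obtain y where y: "a \<in> carrier R" "y \<in> N" "a \<odot>\<^bsub>M\<^esub> x \<oplus>\<^bsub>M\<^esub> y \<in> V n" by (auto simp: I_def)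
    have "r \<odot>\<^bsub>M\<^esub> (a \<odot>\<^bsub>M\<^esub> x \<oplus>\<^bsub>M\<^esub> y) \<in> V n" using submodule_smult[OF V(1) r y(3)] .
    moreover have "r \<odot>\<^bsub>M\<^esub> (a \<odot>\<^bsub>M\<^esub> x \<oplus>\<^bsub>M\<^esub> y) = (a \<otimes>\<^bsub>R\<^esub> r) \<odot>\<^bsub>M\<^esub> x \<oplus>\<^bsub>M\<^esub> r \<odot>\<^bsub>M\<^esub> y"
      using y(1,2) r x by (simp add: smult_r_distr smult_assoc)
    ultimately show "a \<otimes>\<^bsub>R\<^esub> r \<in> I n"
      using y r submodule_smult[OF N r y(2)] by (auto simp: I_def)
    then show "r \<otimes>\<^bsub>R\<^esub> a \<in> I n" using y r by (simp add: m_comm)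
  qed
  moreover have "I (Suc n) \<subseteq> I n" for n using V(3) by (auto simp: I_def)
  ultimately obtain n1 where n1: "\<forall>m\<ge>n1. I m = I n1" using art unfolding artinian_def by blast
  obtain n2 where n2: "\<forall>m\<ge>n2. V m \<inter> N = V n2 \<inter> N"
    using IH[of "\<lambda>n. V n \<inter> N"] V N Int_submodule by blast
  define n where "n = max n1 n2"
  have "V m = V n" if m: "m \<ge> n" for m
  proof
    show "V m \<subseteq> V n" using dec[OF m] .
    show "V n \<subseteq> V m"
    proof
      fix v assume v: "v \<in> V n"
      then have "v \<in> cyclic_submodule R M x <+>\<^bsub>M\<^esub> N" using V(2) by blast
      then obtain r y where ry: "r \<in> carrier R" "y \<in> N" "v = r \<odot>\<^bsub>M\<^esub> x \<oplus>\<^bsub>M\<^esub> y"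
        unfolding set_add_mem_iff cyclic_submodule_def by blast
      then have "r \<in> I n" using v by (auto simp: I_def)
      moreover have "I n = I m" using n1 m unfolding n_def by (metis max.bounded_iff order_refl)
      ultimately obtain y' where y': "y' \<in> N" "r \<odot>\<^bsub>M\<^esub> x \<oplus>\<^bsub>M\<^esub> y' \<in> V m" by (auto simp: I_def)
      \<comment> \<open>v and w have the same coefficient at x, so their difference lies in
        \<open>V n \<inter> N\<close>, which equals \<open>V m \<inter> N\<close>.\<close>
      define w where "w = r \<odot>\<^bsub>M\<^esub> x \<oplus>\<^bsub>M\<^esub> y'"
      have w: "w \<in> V m" using y' by (simp add: w_def)
      have cl: "v \<in> carrier M" "w \<in> carrier M" using ry y' x by (simp_all add: w_def)
      have "v \<ominus>\<^bsub>M\<^esub> w = y \<ominus>\<^bsub>M\<^esub> y'"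
      proof -
        have "v = (y \<ominus>\<^bsub>M\<^esub> y') \<oplus>\<^bsub>M\<^esub> w"
        proof -
          have "y = (y \<ominus>\<^bsub>M\<^esub> y') \<oplus>\<^bsub>M\<^esub> y'" using diff_add_cancel ry y' by simp
          then have "v = r \<odot>\<^bsub>M\<^esub> x \<oplus>\<^bsub>M\<^esub> ((y \<ominus>\<^bsub>M\<^esub> y') \<oplus>\<^bsub>M\<^esub> y')" using ry(3) by simp
          then show ?thesis using ry(1,2) y'(1) x by (simp add: w_def M.a_ac)
        qed
        then show ?thesis
          using diff_add_cancel[OF cl] cl ry(2) y'(1) M.add.right_cancel by (metis M.minus_closed mem)
      qed
      moreover have "v \<ominus>\<^bsub>M\<^esub> w \<in> V n" using submodule_diff[OF V(1) v] w dec[OF m] by blast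
      moreover have "y \<ominus>\<^bsub>M\<^esub> y' \<in> N" using submodule_diff[OF N ry(2) y'(1)] .
      ultimately have "v \<ominus>\<^bsub>M\<^esub> w \<in> V n \<inter> N" by simp
      also have "V n \<inter> N = V m \<inter> N" using n2 m unfolding n_def by (metis max.bounded_iff order_refl)
      finally have "(v \<ominus>\<^bsub>M\<^esub> w) \<oplus>\<^bsub>M\<^esub> w \<in> V m" using w submodule_add[OF V(1)] by blast
      then show "v \<in> V m" using diff_add_cancel[OF cl] by simp
    qed
  qed
  then show ?thesis by blast
qed

end

text \<open>Induction on a finite generating set, for chains inside its span; each generator costs
  one use of the chain condition on ideals.\<close>

lemma fg_chain_cond_desc:
  assumes com: "cring R" and art: "artinian R" and M: "fg_module R M"
  shows "chain_cond False R M"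
proof -
  interpret right_module R M by (rule fg_right_module[OF M])
  have *: "\<exists>n. \<forall>m\<ge>n. V m = V n"
    if "finite S" "S \<subseteq> carrier M" "\<And>n::nat. submodule (V n) R M" "\<And>n. V n \<subseteq> mspan R M S"
      "\<And>n. V (Suc n) \<subseteq> V n" for S V
    using that
  proof (induction S arbitrary: V rule: finite_induct)
    case empty
    have "V n = {\<zero>\<^bsub>M\<^esub>}" for n
      using empty(3)[of n] span_least[OF zero_submodule, of "{}"] submodule_zero[OF empty(2)[of n]]
      by auto
    then show ?case by auto
  next
    case (insert x S)
    have S: "submodule (mspan R M S) R M" using insert.prems by (intro span_submodule) auto
    have x: "x \<in> carrier M" using insert.prems by auto
    note cyc = cyclic_is_submodule[OF x]
    have "mspan R M (insert x S) \<subseteq> cyclic_submodule R M x <+>\<^bsub>M\<^esub> mspan R M S"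
      using sum_upper[OF cyc S] cyclic_self[OF x] span_superset[of S]
      by (intro span_least sum_submodule cyc S) auto
    then show ?case
      using insert.prems insert.IH
      by (intro chain_cond_cyclic_extension[OF S x com art, of V]) auto
  qed
  obtain S where S: "finite S" "S \<subseteq> carrier M"
    "\<forall>K. submodule K R M \<longrightarrow> S \<subseteq> K \<longrightarrow> K = carrier M"
    by (rule fg_moduleE[OF M])
  then have "mspan R M S = carrier M" using span_submodule span_superset by auto
  show ?thesis
  proof (rule chain_condI)
    fix V :: "nat \<Rightarrow> _ set"
    assume V: "\<And>n. submodule (V n) R M"
      "\<And>n. if False then V n \<subseteq> V (Suc n) else V (Suc n) \<subseteq> V n"
    show "\<exists>n. \<forall>m\<ge>n. V m = V n"
      by (rule *[where V = V, OF S(1,2)])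
        (use V submodule_subset[OF V(1)] \<open>mspan R M S = carrier M\<close> in simp_all)
  qed
qed

section \<open>Homomorphisms into the dualizing module\<close>

lemma regular_simps [simp]:
  "carrier (regular_module R) = carrier R" "\<zero>\<^bsub>regular_module R\<^esub> = \<zero>\<^bsub>R\<^esub>"
  "x \<oplus>\<^bsub>regular_module R\<^esub> y = x \<oplus>\<^bsub>R\<^esub> y" "r \<odot>\<^bsub>regular_module R\<^esub> x = x \<otimes>\<^bsub>R\<^esub> r"
  by (simp_all add: regular_module_def)

lemma (in ring) regular_right_module: "right_module R (regular_module R)"
proof -
  have "abelian_group (regular_module R)"
  proof (rule abelian_groupI)
    fix x assume "x \<in> carrier (regular_module R)"
    then show "\<exists>y\<in>carrier (regular_module R).
        y \<oplus>\<^bsub>regular_module R\<^esub> x = \<zero>\<^bsub>regular_module R\<^esub>"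
      by (intro bexI[of _ "\<ominus>\<^bsub>R\<^esub> x"]) (simp_all add: l_neg)
  qed (simp_all add: a_ac)
  then show ?thesis
    by (intro right_module.intro right_module_axioms.intro ring_axioms)
      (simp_all add: l_distr r_distr m_assoc)
qed

lemma (in ring) regular_fg: "fg_module R (regular_module R)"
proof (rule fg_moduleI[OF regular_right_module, of "{\<one>}"])
  fix K assume K: "submodule K R (regular_module R)" "{\<one>} \<subseteq> K"
  have "r \<in> K" if "r \<in> carrier R" for r
    using submodule_smult[OF K(1) that, of \<one>] K(2) that by simp
  then show "K = carrier (regular_module R)" using submodule_subset[OF K(1)] by auto
qed simp_all

text \<open>The coefficient of an element at x is chosen arbitrarily; since whatever kills x also
  kills z, the value does not depend on the choice.\<close>

lemma cyclic_hom:
  assumes M: "right_module R M" and N: "right_module R N"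
    and x: "x \<in> carrier M" and z: "z \<in> carrier N"
    and ann: "\<And>r. \<lbrakk>r \<in> carrier R; r \<odot>\<^bsub>M\<^esub> x = \<zero>\<^bsub>M\<^esub>\<rbrakk> \<Longrightarrow> r \<odot>\<^bsub>N\<^esub> z = \<zero>\<^bsub>N\<^esub>"
  obtains g where "g \<in> mhom R (M\<lparr>carrier := cyclic_submodule R M x\<rparr>) N"
    "\<forall>r\<in>carrier R. g (r \<odot>\<^bsub>M\<^esub> x) = r \<odot>\<^bsub>N\<^esub> z"
proof -
  interpret M: right_module R M by fact
  interpret N: right_module R N by fact
  define c where "c y = (SOME r. r \<in> carrier R \<and> y = r \<odot>\<^bsub>M\<^esub> x)" for y
  have c: "c y \<in> carrier R \<and> y = c y \<odot>\<^bsub>M\<^esub> x" if "y \<in> cyclic_submodule R M x" for y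
    unfolding c_def by (rule someI_ex) (use that in \<open>auto simp: cyclic_submodule_def\<close>)
  define g where "g y = c y \<odot>\<^bsub>N\<^esub> z" for y
  have gx: "g (r \<odot>\<^bsub>M\<^esub> x) = r \<odot>\<^bsub>N\<^esub> z" if r: "r \<in> carrier R" for r
  proof -
    have "r \<odot>\<^bsub>M\<^esub> x \<in> cyclic_submodule R M x" using r by (auto simp: cyclic_submodule_def)
    then have s: "c (r \<odot>\<^bsub>M\<^esub> x) \<in> carrier R" "r \<odot>\<^bsub>M\<^esub> x = c (r \<odot>\<^bsub>M\<^esub> x) \<odot>\<^bsub>M\<^esub> x" using c by blast+
    then have "(c (r \<odot>\<^bsub>M\<^esub> x) \<ominus>\<^bsub>R\<^esub> r) \<odot>\<^bsub>M\<^esub> x = \<zero>\<^bsub>M\<^esub>"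
      using r x by (metis M.diff_eq_zero_iff M.smult_closed M.smult_l_diff)
    then have "(c (r \<odot>\<^bsub>M\<^esub> x) \<ominus>\<^bsub>R\<^esub> r) \<odot>\<^bsub>N\<^esub> z = \<zero>\<^bsub>N\<^esub>" using ann s(1) r by simp
    then show ?thesis
      using s(1) r z by (simp add: g_def N.smult_l_diff N.diff_eq_zero_iff)
  qed
  have "restrict g (carrier (M\<lparr>carrier := cyclic_submodule R M x\<rparr>))
      \<in> mhom R (M\<lparr>carrier := cyclic_submodule R M x\<rparr>) N"
  proof (rule mhom_restrictI[OF M.submodule_is_right_module[OF M.cyclic_is_submodule[OF x]]])
    fix y assume "y \<in> carrier (M\<lparr>carrier := cyclic_submodule R M x\<rparr>)"
    then show "g y \<in> carrier N" using c z by (simp add: g_def)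
  next
    fix y w assume "y \<in> carrier (M\<lparr>carrier := cyclic_submodule R M x\<rparr>)"
      "w \<in> carrier (M\<lparr>carrier := cyclic_submodule R M x\<rparr>)"
    then obtain r s where "r \<in> carrier R" "s \<in> carrier R" "y = r \<odot>\<^bsub>M\<^esub> x" "w = s \<odot>\<^bsub>M\<^esub> x"
      by (auto simp: cyclic_submodule_def)
    then show "g (y \<oplus>\<^bsub>M\<lparr>carrier := cyclic_submodule R M x\<rparr>\<^esub> w) = g y \<oplus>\<^bsub>N\<^esub> g w"
      using gx[of "r \<oplus>\<^bsub>R\<^esub> s"] gx[of r] gx[of s] x z by (simp add: M.smult_l_distr N.smult_l_distr)
  next
    fix r y assume "r \<in> carrier R" "y \<in> carrier (M\<lparr>carrier := cyclic_submodule R M x\<rparr>)"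
    moreover then obtain s where "s \<in> carrier R" "y = s \<odot>\<^bsub>M\<^esub> x"
      by (auto simp: cyclic_submodule_def)
    ultimately show "g (r \<odot>\<^bsub>M\<lparr>carrier := cyclic_submodule R M x\<rparr>\<^esub> y) = r \<odot>\<^bsub>N\<^esub> g y"
      using gx[of "s \<otimes>\<^bsub>R\<^esub> r"] gx[of s] x z by (simp add: M.smult_assoc N.smult_assoc)
  qed
  moreover have "\<forall>r\<in>carrier R. restrict g (carrier (M\<lparr>carrier := cyclic_submodule R M x\<rparr>)) (r \<odot>\<^bsub>M\<^esub> x)
      = r \<odot>\<^bsub>N\<^esub> z"
    using gx by (auto simp: cyclic_submodule_def)
  ultimately show thesis by (rule that)
qed

section \<open>Homomorphisms over a commutative ring as a module\<close>

definition hom_module :: "('a, 'e) ring_scheme \<Rightarrow> ('a, 'm) module \<Rightarrow> ('a, 'n) module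
    \<Rightarrow> ('a, 'm \<Rightarrow> 'n) module" where
  "hom_module R M N = \<lparr>carrier = mhom R M N, mult = undefined, one = undefined,
     zero = (\<lambda>x\<in>carrier M. \<zero>\<^bsub>N\<^esub>), add = (\<lambda>f g. \<lambda>x\<in>carrier M. f x \<oplus>\<^bsub>N\<^esub> g x),
     smult = (\<lambda>r f. \<lambda>x\<in>carrier M. r \<odot>\<^bsub>N\<^esub> f x)\<rparr>"

lemma hom_module_simps [simp]:
  "carrier (hom_module R M N) = mhom R M N"
  "\<zero>\<^bsub>hom_module R M N\<^esub> = (\<lambda>x\<in>carrier M. \<zero>\<^bsub>N\<^esub>)"
  "f \<oplus>\<^bsub>hom_module R M N\<^esub> g = (\<lambda>x\<in>carrier M. f x \<oplus>\<^bsub>N\<^esub> g x)"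
  "r \<odot>\<^bsub>hom_module R M N\<^esub> f = (\<lambda>x\<in>carrier M. r \<odot>\<^bsub>N\<^esub> f x)"
  by (simp_all add: hom_module_def)

lemma zero_in_mhom:
  assumes "right_module R M" "right_module R N"
  shows "(\<lambda>x\<in>carrier M. \<zero>\<^bsub>N\<^esub>) \<in> mhom R M N"
proof -
  interpret N: right_module R N by fact
  show ?thesis by (rule mhom_restrictI[OF assms(1)]) simp_all
qed

lemma add_in_mhom:
  assumes "right_module R M" "right_module R N" "f \<in> mhom R M N" "g \<in> mhom R M N"
  shows "(\<lambda>x\<in>carrier M. f x \<oplus>\<^bsub>N\<^esub> g x) \<in> mhom R M N"
proof -
  interpret N: right_module R N by fact
  note hom = assms(3,4)
  show ?thesis
    by (rule mhom_restrictI[OF assms(1)])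
      (simp_all add: hom[THEN mhom_closed] hom[THEN mhom_add] hom[THEN mhom_smult]
        N.M.a_ac N.smult_r_distr)
qed

lemma minus_in_mhom:
  assumes "right_module R M" "right_module R N" "f \<in> mhom R M N"
  shows "(\<lambda>x\<in>carrier M. \<ominus>\<^bsub>N\<^esub> f x) \<in> mhom R M N"
proof -
  interpret N: right_module R N by fact
  note hom = assms(3)
  show ?thesis
    by (rule mhom_restrictI[OF assms(1)])
      (simp_all add: hom[THEN mhom_closed] hom[THEN mhom_add] hom[THEN mhom_smult]
        N.M.minus_add N.smult_minus)
qed

text \<open>Commutativity lets r move past the scalars acting on f x.\<close>

lemma smult_in_mhom:
  assumes "right_module R M" "right_module R N" "f \<in> mhom R M N" "cring R" "r \<in> carrier R"
  shows "(\<lambda>x\<in>carrier M. r \<odot>\<^bsub>N\<^esub> f x) \<in> mhom R M N"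
proof -
  interpret N: right_module R N by fact
  interpret cring R by fact
  note hom = assms(3)
  show ?thesis
    by (rule mhom_restrictI[OF assms(1)])
      (simp_all add: hom[THEN mhom_closed] hom[THEN mhom_add] hom[THEN mhom_smult]
        N.smult_r_distr m_comm assms(5) flip: N.smult_assoc)
qed

text \<open>Only the additive fields are prescribed, so that the lemma serves
  \<open>hom_module\<close>, \<open>hom_regular\<close> and \<open>dual_module\<close>, each with
  its own scalar action.\<close>

lemma pointwise_abelian_group:
  assumes M: "right_module R M" and N: "right_module R N"
    and H: "carrier H = mhom R M N" "\<zero>\<^bsub>H\<^esub> = (\<lambda>x\<in>carrier M. \<zero>\<^bsub>N\<^esub>)"
      "\<And>f g. f \<oplus>\<^bsub>H\<^esub> g = (\<lambda>x\<in>carrier M. f x \<oplus>\<^bsub>N\<^esub> g x)"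
  shows "abelian_group H"
proof -
  interpret N: right_module R N by fact
  have ext: "f = g" if "f \<in> extensional (carrier M)" "g \<in> extensional (carrier M)"
    "\<And>x. x \<in> carrier M \<Longrightarrow> f x = g x" for f g :: "_ \<Rightarrow> _"
    using that by (rule extensionalityI)
  show ?thesis
  proof (rule abelian_groupI)
    fix f g assume fg: "f \<in> carrier H" "g \<in> carrier H"
    then show "f \<oplus>\<^bsub>H\<^esub> g \<in> carrier H" using add_in_mhom[OF M N] by (simp add: H)
    show "f \<oplus>\<^bsub>H\<^esub> g = g \<oplus>\<^bsub>H\<^esub> f"
      using fg by (auto simp: H N.M.a_comm mhom_closed cong: restrict_cong)
  next
    fix f g h assume "f \<in> carrier H" "g \<in> carrier H" "h \<in> carrier H"
    then show "f \<oplus>\<^bsub>H\<^esub> g \<oplus>\<^bsub>H\<^esub> h = f \<oplus>\<^bsub>H\<^esub> (g \<oplus>\<^bsub>H\<^esub> h)"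
      by (auto simp: H N.M.a_assoc mhom_closed cong: restrict_cong)
  next
    show "\<zero>\<^bsub>H\<^esub> \<in> carrier H" using zero_in_mhom[OF M N] by (simp add: H)
  next
    fix f assume f: "f \<in> carrier H"
    then have fe: "f \<in> extensional (carrier M)" using mhom_extensional by (simp add: H)
    show "\<zero>\<^bsub>H\<^esub> \<oplus>\<^bsub>H\<^esub> f = f"
      using f fe by (intro ext) (simp_all add: H mhom_closed)
    have "(\<lambda>x\<in>carrier M. \<ominus>\<^bsub>N\<^esub> f x) \<oplus>\<^bsub>H\<^esub> f = \<zero>\<^bsub>H\<^esub>"
      using f by (intro ext) (simp_all add: H mhom_closed N.M.l_neg)
    then show "\<exists>g\<in>carrier H. g \<oplus>\<^bsub>H\<^esub> f = \<zero>\<^bsub>H\<^esub>"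
      using minus_in_mhom[OF M N, of f] f by (intro bexI) (simp_all add: H)
  qed
qed

lemma hom_module_right_module:
  assumes M: "right_module R M" and N: "right_module R N" and "cring R"
  shows "right_module R (hom_module R M N)"
proof -
  interpret M: right_module R M by fact
  interpret N: right_module R N by fact
  have "abelian_group (hom_module R M N)"
    by (rule pointwise_abelian_group[OF M N]) simp_all
  then show ?thesis
  proof (intro right_module.intro right_module_axioms.intro M.R.ring_axioms)
    show "r \<odot>\<^bsub>hom_module R M N\<^esub> f \<in> carrier (hom_module R M N)"
      if "r \<in> carrier R" "f \<in> carrier (hom_module R M N)" for r f
      using smult_in_mhom[OF M N _ \<open>cring R\<close>] that by simp
    show "\<one>\<^bsub>R\<^esub> \<odot>\<^bsub>hom_module R M N\<^esub> f = f" if "f \<in> carrier (hom_module R M N)" for f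
      using that mhom_extensional[of f R M N]
      by (intro extensionalityI[of _ "carrier M"]) (simp_all add: mhom_closed)
  qed (auto simp: N.smult_l_distr N.smult_r_distr N.smult_assoc mhom_closed cong: restrict_cong)
qed

locale dualizing_ring = cring R for R (structure) +
  fixes J :: "('a, 'j) module"
  assumes art: "artinian R" and dual: "dualizing_module R J"
begin

abbreviation "Reg \<equiv> regular_module R"

sublocale Reg: right_module R Reg by (rule regular_right_module)

lemma J_injective: "injective R J"
  using dual by (simp add: dualizing_module_def injective_envelope_def)

lemma J_fg: "fg_module R J"
  using J_injective unfolding injective_def by (rule conjunct1)

sublocale J: right_module R J by (rule fg_right_module[OF J_fg])

lemma fg_descending: "fg_module R M \<Longrightarrow> chain_cond False R M"
  by (rule fg_chain_cond_desc[OF is_cring art])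

section \<open>Maximal ideals of \<open>R\<close>, taken as maximal submodules of
  \<open>Reg\<close>, and the radical\<close>

lemma max_ideal_submodule: "maximal_submodule R Reg m \<Longrightarrow> submodule m R Reg"
  by (simp add: maximal_submodule_def)

lemma max_ideal_mem: "\<lbrakk>maximal_submodule R Reg m; x \<in> m\<rbrakk> \<Longrightarrow> x \<in> carrier R"
  using submodule_mem[OF max_ideal_submodule] by simp

lemma max_ideal_mult:
  assumes m: "maximal_submodule R Reg m" and "x \<in> m" "r \<in> carrier R"
  shows "x \<otimes> r \<in> m" "r \<otimes> x \<in> m"
proof -
  show "x \<otimes> r \<in> m" using submodule_smult[OF max_ideal_submodule[OF m] assms(3,2)] by simp
  then show "r \<otimes> x \<in> m" using assms max_ideal_mem[OF m] by (simp add: m_comm)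
qed

lemma max_ideal_comaximal:
  assumes m: "maximal_submodule R Reg m" and a: "a \<in> carrier R" "a \<notin> m"
  shows "\<exists>r\<in>carrier R. \<exists>y\<in>m. \<one> = a \<otimes> r \<oplus> y"
proof -
  note sub = max_ideal_submodule[OF m]
  have aR: "a \<in> carrier Reg" using a by simp
  note cyc = Reg.cyclic_is_submodule[OF aR]
  have "submodule (cyclic_submodule R Reg a <+>\<^bsub>Reg\<^esub> m) R Reg"
    by (rule Reg.sum_submodule[OF cyc sub])
  moreover have "m \<subseteq> cyclic_submodule R Reg a <+>\<^bsub>Reg\<^esub> m"
      "a \<in> cyclic_submodule R Reg a <+>\<^bsub>Reg\<^esub> m"
    using Reg.sum_upper[OF cyc sub] Reg.cyclic_self[OF aR] by auto
  ultimately have "cyclic_submodule R Reg a <+>\<^bsub>Reg\<^esub> m = carrier Reg"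
    using m a(2) unfolding maximal_submodule_def by blast
  then have "\<one> \<in> cyclic_submodule R Reg a <+>\<^bsub>Reg\<^esub> m" by simp
  then show ?thesis unfolding Reg.set_add_mem_iff by (auto simp: cyclic_submodule_def)
qed

lemma one_notin_max_ideal:
  assumes m: "maximal_submodule R Reg m" shows "\<one> \<notin> m"
proof
  assume "\<one> \<in> m"
  then have "r \<in> m" if "r \<in> carrier R" for r using max_ideal_mult(1)[OF m \<open>\<one> \<in> m\<close> that] that by simp
  then have "m = carrier Reg" using max_ideal_mem[OF m] by auto
  then show False using m by (simp add: maximal_submodule_def)
qed

text \<open>Multiplying 1 = a r + y by b expresses b through a b and y, both of which lie in
  m.\<close>

lemma max_ideal_prime:
  assumes m: "maximal_submodule R Reg m" and ab: "a \<in> carrier R" "b \<in> carrier R" "a \<otimes> b \<in> m" "a \<notin> m"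
  shows "b \<in> m"
proof -
  obtain r y where ry: "r \<in> carrier R" "y \<in> m" "\<one> = a \<otimes> r \<oplus> y"
    using max_ideal_comaximal[OF m ab(1,4)] by blast
  have yR: "y \<in> carrier R" using ry max_ideal_mem[OF m] by simp
  have "b = (a \<otimes> r \<oplus> y) \<otimes> b" using ry(3) l_one[OF ab(2)] by simp
  also have "\<dots> = (a \<otimes> b) \<otimes> r \<oplus> y \<otimes> b"
  proof -
    have "(a \<otimes> r) \<otimes> b = (a \<otimes> b) \<otimes> r" using ry(1) ab(1,2) by (simp add: m_ac)
    then show ?thesis using ry(1) yR ab(1,2) by (simp add: l_distr)
  qed
  also have "\<dots> \<in> m"
    using submodule_add[OF max_ideal_submodule[OF m]] max_ideal_mult(1)[OF m ab(3) ry(1)]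
      max_ideal_mult(1)[OF m ry(2) ab(2)] by simp
  finally show ?thesis .
qed

lemma max_ideals_incomparable:
  assumes "maximal_submodule R Reg m" "maximal_submodule R Reg m'" "m \<noteq> m'"
  obtains y where "y \<in> m" "y \<notin> m'"
  using assms unfolding maximal_submodule_def by blast

definition rad :: "'a set" where "rad = module_rad R Reg"

lemma rad_iff: "r \<in> rad \<longleftrightarrow> r \<in> carrier R \<and> (\<forall>m. maximal_submodule R Reg m \<longrightarrow> r \<in> m)"
  by (auto simp: rad_def module_rad_def)

lemma rad_submodule: "submodule rad R Reg"
proof -
  \<comment> \<open>Inserting the whole ring keeps the intersected family nonempty.\<close>
  have "rad = \<Inter>(insert (carrier R) {m. maximal_submodule R Reg m})"
    by (simp add: rad_def module_rad_def)
  moreover have "submodule (\<Inter>(insert (carrier R) {m. maximal_submodule R Reg m})) R Reg"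
    using Reg.carrier_submodule by (intro Reg.Inter_submodule) (auto simp: maximal_submodule_def)
  ultimately show ?thesis by (simp only:)
qed

text \<open>The generator \<open>c\<close> is the image of the unit of \<open>R / rad R\<close>.\<close>

lemma essential_generator:
  obtains c where "c \<in> carrier J" "\<forall>r\<in>carrier R. r \<odot>\<^bsub>J\<^esub> c = \<zero>\<^bsub>J\<^esub> \<longleftrightarrow> r \<in> rad"
    "\<forall>N. submodule N R J \<longrightarrow> (\<forall>r\<in>carrier R. r \<odot>\<^bsub>J\<^esub> c \<in> N \<longrightarrow> r \<odot>\<^bsub>J\<^esub> c = \<zero>\<^bsub>J\<^esub>) \<longrightarrow> N = {\<zero>\<^bsub>J\<^esub>}"
proof -
  let ?T = "quotient_module Reg rad"
  have "module_top R Reg = ?T" by (simp add: module_top_def rad_def)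
  then obtain f where f: "f \<in> mhom R ?T J" "inj_on f (carrier ?T)"
    and ess: "\<forall>N. submodule N R J \<and> N \<inter> f ` carrier ?T = {\<zero>\<^bsub>J\<^esub>} \<longrightarrow> N = {\<zero>\<^bsub>J\<^esub>}"
    using dual unfolding dualizing_module_def injective_envelope_def by auto
  interpret T: right_module R ?T by (rule Reg.quotient_right_module[OF rad_submodule])
  interpret f: module_hom R ?T J f
    by (rule module_homI[OF T.right_module_axioms J.right_module_axioms f(1)])
  define c where "c = f (rad +>\<^bsub>Reg\<^esub> \<one>)"
  have cT: "rad +>\<^bsub>Reg\<^esub> r \<in> carrier ?T" if "r \<in> carrier R" for r
    using that by (simp add: Reg.quotient_carrier)
  have cJ: "c \<in> carrier J" using cT by (simp add: c_def)
  have rc: "r \<odot>\<^bsub>J\<^esub> c = f (rad +>\<^bsub>Reg\<^esub> r)" if "r \<in> carrier R" for r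
    using f.smult[OF that cT[OF one_closed]] that
    by (simp add: c_def Reg.quotient_smult[OF rad_submodule])
  have zero: "f (rad +>\<^bsub>Reg\<^esub> r) = \<zero>\<^bsub>J\<^esub> \<longleftrightarrow> r \<in> rad" if r: "r \<in> carrier R" for r
  proof -
    have "f (rad +>\<^bsub>Reg\<^esub> r) = \<zero>\<^bsub>J\<^esub> \<longleftrightarrow> rad +>\<^bsub>Reg\<^esub> r = \<zero>\<^bsub>?T\<^esub>"
      using inj_on_eq_iff[OF f(2) cT[OF r] T.M.zero_closed] by simp
    also have "\<dots> \<longleftrightarrow> r \<in> rad"
      using Reg.coset_eq_zero_iff[OF rad_submodule, of r] r by (simp add: Reg.quotient_zero)
    finally show ?thesis .
  qed
  \<comment> \<open>The image of R / rad R in \<open>J\<close> is R c, so essentiality of the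
    envelope says that a submodule meeting R c trivially vanishes.\<close>
  have "\<forall>N. submodule N R J \<longrightarrow> (\<forall>r\<in>carrier R. r \<odot>\<^bsub>J\<^esub> c \<in> N \<longrightarrow> r \<odot>\<^bsub>J\<^esub> c = \<zero>\<^bsub>J\<^esub>) \<longrightarrow> N = {\<zero>\<^bsub>J\<^esub>}"
  proof (intro allI impI)
    fix N assume N: "submodule N R J" "\<forall>r\<in>carrier R. r \<odot>\<^bsub>J\<^esub> c \<in> N \<longrightarrow> r \<odot>\<^bsub>J\<^esub> c = \<zero>\<^bsub>J\<^esub>"
    have "\<zero>\<^bsub>J\<^esub> \<in> f ` carrier ?T" using f.zero T.M.zero_closed by (metis image_eqI)
    moreover have "N \<inter> f ` carrier ?T \<subseteq> {\<zero>\<^bsub>J\<^esub>}"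
      using N(2) rc by (auto simp: Reg.quotient_carrier)
    ultimately have "N \<inter> f ` carrier ?T = {\<zero>\<^bsub>J\<^esub>}" using submodule_zero[OF N(1)] by auto
    then show "N = {\<zero>\<^bsub>J\<^esub>}" using ess N(1) by blast
  qed
  then show thesis using cJ rc zero by (intro that[of c]) simp_all
qed

text \<open>The residue of such an a generates a copy of R / m in R / rad R. The element must lie in
  every maximal ideal except m, and an ideal minimal among those not inside m is contained in all
  the others.\<close>

lemma max_ideal_annihilator:
  assumes m: "maximal_submodule R Reg m"
  obtains a where "a \<in> carrier R" "a \<notin> rad" "\<forall>y\<in>m. a \<otimes> y \<in> rad"
proof -
  define F where "F = {I. submodule I R Reg \<and> \<not> I \<subseteq> m}"
  have "carrier R \<in> F"
    using Reg.carrier_submodule one_notin_max_ideal[OF m] by (auto simp: F_def)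
  then have "F \<noteq> {}" by auto
  moreover have "submodule I R Reg" if "I \<in> F" for I using that by (simp add: F_def)
  ultimately obtain I where I: "I \<in> F" "\<forall>K\<in>F. K \<subseteq> I \<longrightarrow> K = I"
    by (rule minimal_submodule_exists[OF fg_descending[OF regular_fg]])
  have Isub: "submodule I R Reg" using I(1) by (simp add: F_def)
  obtain a where a: "a \<in> I" "a \<notin> m" using I(1) by (auto simp: F_def)
  have aR: "a \<in> carrier R" using submodule_mem[OF Isub a(1)] by simp
  have other: "a \<in> m'" if m': "maximal_submodule R Reg m'" "m' \<noteq> m" for m'
  proof -
    obtain b where b: "b \<in> m'" "b \<notin> m" by (rule max_ideals_incomparable[OF m'(1) m m'(2)])
    have bR: "b \<in> carrier R" using max_ideal_mem[OF m'(1) b(1)] .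
    \<comment> \<open>As m is prime, a b stays outside m; hence I cut down to m' is still a
      candidate, and minimality makes it equal to I.\<close>
    have "a \<otimes> b \<in> I \<inter> m'"
      using submodule_smult[OF Isub bR a(1)] max_ideal_mult(2)[OF m'(1) b(1) aR] by simp
    moreover have "a \<otimes> b \<notin> m" using max_ideal_prime[OF m aR bR _ a(2)] b(2) by blast
    ultimately have "I \<inter> m' \<in> F"
      using Reg.Int_submodule[OF Isub max_ideal_submodule[OF m'(1)]] unfolding F_def by blast
    then have "I \<inter> m' = I" using I(2) by blast
    then show ?thesis using a(1) by blast
  qed
  have "\<forall>y\<in>m. a \<otimes> y \<in> rad"
  proof
    fix y assume y: "y \<in> m"
    have yR: "y \<in> carrier R" using max_ideal_mem[OF m y] .
    have "a \<otimes> y \<in> m'" if m': "maximal_submodule R Reg m'" for m'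
      using max_ideal_mult(2)[OF m y aR] max_ideal_mult(1)[OF m' other[OF m'] yR]
      by (cases "m' = m") simp_all
    then show "a \<otimes> y \<in> rad" using aR yR by (simp add: rad_iff)
  qed
  moreover have "a \<notin> rad" using a(2) m by (auto simp: rad_iff)
  ultimately show thesis using aR by (intro that[of a]) simp_all
qed

text \<open>For the generator c of the copy of R / rad R in \<open>J\<close>, the element a c is
  nonzero because a is outside the radical, and m kills it because a m is inside.\<close>

lemma max_ideal_torsion_nonzero:
  assumes m: "maximal_submodule R Reg m"
  obtains j where "j \<in> carrier J" "j \<noteq> \<zero>\<^bsub>J\<^esub>" "\<forall>y\<in>m. y \<odot>\<^bsub>J\<^esub> j = \<zero>\<^bsub>J\<^esub>"
proof -
  obtain c where c: "c \<in> carrier J" "\<forall>r\<in>carrier R. r \<odot>\<^bsub>J\<^esub> c = \<zero>\<^bsub>J\<^esub> \<longleftrightarrow> r \<in> rad"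
    by (rule essential_generator)
  obtain a where a: "a \<in> carrier R" "a \<notin> rad" "\<forall>y\<in>m. a \<otimes> y \<in> rad"
    by (rule max_ideal_annihilator[OF m])
  have "y \<odot>\<^bsub>J\<^esub> (a \<odot>\<^bsub>J\<^esub> c) = \<zero>\<^bsub>J\<^esub>" if "y \<in> m" for y
  proof -
    have y: "y \<in> carrier R" "a \<otimes> y \<in> rad" using that a(3) max_ideal_mem[OF m] by simp_all
    then have "(a \<otimes> y) \<odot>\<^bsub>J\<^esub> c = \<zero>\<^bsub>J\<^esub>" using a(1) c(2) by simp
    then show ?thesis using J.smult_assoc[OF a(1) y(1) c(1)] by simp
  qed
  then show thesis using a c by (intro that[of "a \<odot>\<^bsub>J\<^esub> c"]) simp_all
qed

text \<open>The elements of \<open>J\<close> killed by m form a one-dimensional space over R / m: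
  essentiality puts them inside R c, and there any nonzero one generates the rest.\<close>

lemma max_ideal_torsion_simple:
  assumes m: "maximal_submodule R Reg m"
    and j: "j \<in> carrier J" "j \<noteq> \<zero>\<^bsub>J\<^esub>" "\<forall>y\<in>m. y \<odot>\<^bsub>J\<^esub> j = \<zero>\<^bsub>J\<^esub>"
    and j': "j' \<in> carrier J" "\<forall>y\<in>m. y \<odot>\<^bsub>J\<^esub> j' = \<zero>\<^bsub>J\<^esub>"
  shows "\<exists>r\<in>carrier R. j' = r \<odot>\<^bsub>J\<^esub> j"
proof -
  obtain c where c: "c \<in> carrier J" "\<forall>r\<in>carrier R. r \<odot>\<^bsub>J\<^esub> c = \<zero>\<^bsub>J\<^esub> \<longleftrightarrow> r \<in> rad"
    and ess: "\<forall>N. submodule N R J \<longrightarrow> (\<forall>r\<in>carrier R. r \<odot>\<^bsub>J\<^esub> c \<in> N \<longrightarrow> r \<odot>\<^bsub>J\<^esub> c = \<zero>\<^bsub>J\<^esub>) \<longrightarrow> N = {\<zero>\<^bsub>J\<^esub>}"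
    by (rule essential_generator)
  \<comment> \<open>Essentiality gives a nonzero multiple of k by some s that lies in R c. This s is
    outside m, hence invertible modulo m, and so k itself lies in R c.\<close>
  have *: "\<exists>t\<in>carrier R. k = t \<odot>\<^bsub>J\<^esub> c \<and> (\<forall>y\<in>m. t \<otimes> y \<in> rad)"
    if k: "k \<in> carrier J" "\<forall>y\<in>m. y \<odot>\<^bsub>J\<^esub> k = \<zero>\<^bsub>J\<^esub>" for k
  proof -
    have "\<exists>t\<in>carrier R. k = t \<odot>\<^bsub>J\<^esub> c"
    proof (cases "k = \<zero>\<^bsub>J\<^esub>")
      case True
      then show ?thesis using c by (intro bexI[of _ "\<zero>"]) simp_all
    next
      case False
      then have "cyclic_submodule R J k \<noteq> {\<zero>\<^bsub>J\<^esub>}" using J.cyclic_self[OF k(1)] by auto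
      then obtain r where "r \<in> carrier R" "r \<odot>\<^bsub>J\<^esub> c \<in> cyclic_submodule R J k" "r \<odot>\<^bsub>J\<^esub> c \<noteq> \<zero>\<^bsub>J\<^esub>"
        using ess J.cyclic_is_submodule[OF k(1)] by blast
      then obtain s where rs: "r \<in> carrier R" "s \<in> carrier R" "r \<odot>\<^bsub>J\<^esub> c = s \<odot>\<^bsub>J\<^esub> k" "s \<odot>\<^bsub>J\<^esub> k \<noteq> \<zero>\<^bsub>J\<^esub>"
        by (auto simp: cyclic_submodule_def)
      then have "s \<notin> m" using k(2) by blast
      then obtain u y where uy: "u \<in> carrier R" "y \<in> m" "\<one> = s \<otimes> u \<oplus> y"
        using max_ideal_comaximal[OF m rs(2)] by blast
      have yR: "y \<in> carrier R" using max_ideal_mem[OF m uy(2)] .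
      have "k = (s \<otimes> u \<oplus> y) \<odot>\<^bsub>J\<^esub> k" using uy(3) k(1) J.smult_one by metis
      also have "\<dots> = u \<odot>\<^bsub>J\<^esub> (s \<odot>\<^bsub>J\<^esub> k)"
        using rs(2) uy(1,2) yR k by (simp add: J.smult_l_distr J.smult_assoc)
      also have "\<dots> = (r \<otimes> u) \<odot>\<^bsub>J\<^esub> c"
        using rs(1) uy(1) c(1) by (simp add: rs(3)[symmetric] J.smult_assoc)
      finally show ?thesis using rs(1) uy(1) by blast
    qed
    then obtain t where t: "t \<in> carrier R" "k = t \<odot>\<^bsub>J\<^esub> c" by blast
    have "t \<otimes> y \<in> rad" if y: "y \<in> m" for y
    proof -
      have yR: "y \<in> carrier R" using max_ideal_mem[OF m y] .
      have "(t \<otimes> y) \<odot>\<^bsub>J\<^esub> c = y \<odot>\<^bsub>J\<^esub> k" using t yR c(1) by (simp add: J.smult_assoc)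
      then show ?thesis using k(2) y c(2) t(1) yR by simp
    qed
    then show ?thesis using t by blast
  qed
  obtain t where t: "t \<in> carrier R" "j = t \<odot>\<^bsub>J\<^esub> c" "\<forall>y\<in>m. t \<otimes> y \<in> rad" using *[OF j(1,3)] by blast
  obtain t' where t': "t' \<in> carrier R" "j' = t' \<odot>\<^bsub>J\<^esub> c" "\<forall>y\<in>m. t' \<otimes> y \<in> rad" using *[OF j'] by blast
  \<comment> \<open>Suppose t is in m. Some maximal ideal m' misses t; for y in m outside m', the
    product t y is in the radical and hence in m', against primality.\<close>
  have "t \<notin> m"
  proof
    assume tm: "t \<in> m"
    have "t \<notin> rad" using j(2) t(1,2) c(2) by blast
    then obtain m' where m': "maximal_submodule R Reg m'" "t \<notin> m'" using t(1) by (auto simp: rad_iff)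
    then have "m \<noteq> m'" using tm by blast
    then obtain y where y: "y \<in> m" "y \<notin> m'" by (rule max_ideals_incomparable[OF m m'(1)])
    have "t \<otimes> y \<in> m'" using t(3) y(1) m'(1) by (auto simp: rad_iff)
    then show False using max_ideal_prime[OF m'(1) t(1) max_ideal_mem[OF m y(1)] _ m'(2)] y(2) by blast
  qed
  then obtain u y where uy: "u \<in> carrier R" "y \<in> m" "\<one> = t \<otimes> u \<oplus> y"
    using max_ideal_comaximal[OF m t(1)] by blast
  have yR: "y \<in> carrier R" using max_ideal_mem[OF m uy(2)] .
  \<comment> \<open>The inverse u of t modulo m gives t' = t (t' u) + t' y, where t' y lies in the
    radical and so kills c.\<close>
  have "t' = t' \<otimes> (t \<otimes> u \<oplus> y)" using uy(3) r_one[OF t'(1)] by simp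
  also have "\<dots> = t \<otimes> (t' \<otimes> u) \<oplus> t' \<otimes> y" using uy(1) yR t(1) t'(1) by (simp add: r_distr m_ac)
  finally have "j' = (t \<otimes> (t' \<otimes> u) \<oplus> t' \<otimes> y) \<odot>\<^bsub>J\<^esub> c" using t'(2) by simp
  also have "\<dots> = (t' \<otimes> u) \<odot>\<^bsub>J\<^esub> j \<oplus>\<^bsub>J\<^esub> (t' \<otimes> y) \<odot>\<^bsub>J\<^esub> c"
    using uy(1) yR t(1,2) t'(1) c(1) by (simp add: J.smult_l_distr J.smult_assoc)
  also have "\<dots> = (t' \<otimes> u) \<odot>\<^bsub>J\<^esub> j"
    using uy(1,2) yR t'(1,3) c j(1) by simp
  finally show ?thesis using t'(1) uy(1) by blast
qed


text \<open>\<open>J\<close> is a cogenerator: a maximal ideal m above the annihilator of x allows x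
  to be sent to a nonzero element killed by m, and injectivity extends this map from the cyclic
  submodule.\<close>

lemma nonvanishing_hom:
  assumes M: "fg_module R M" and x: "x \<in> carrier M" "x \<noteq> \<zero>\<^bsub>M\<^esub>"
  obtains u where "u \<in> mhom R M J" "u x \<noteq> \<zero>\<^bsub>J\<^esub>"
proof -
  interpret M: right_module R M by (rule fg_right_module[OF M])
  define A where "A = {r \<in> carrier R. r \<odot>\<^bsub>M\<^esub> x = \<zero>\<^bsub>M\<^esub>}"
  have A: "submodule A R Reg"
  proof (rule Reg.submoduleI)
    show "r \<odot>\<^bsub>Reg\<^esub> a \<in> A" if "r \<in> carrier R" "a \<in> A" for r a
      using that x(1) by (simp add: A_def M.smult_assoc)
  qed (use x(1) in \<open>auto simp: A_def M.smult_l_distr\<close>)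
  have "\<one> \<notin> A" using x by (simp add: A_def)
  then obtain m where m: "submodule m R Reg" "A \<subseteq> m" "\<one> \<notin> m"
    "\<forall>L. submodule L R Reg \<longrightarrow> m \<subseteq> L \<longrightarrow> \<one> \<notin> L \<longrightarrow> L = m"
    by (rule Reg.maximal_avoiding[OF A, of \<one>, simplified])
  have "maximal_submodule R Reg m"
    unfolding maximal_submodule_def
  proof (intro conjI allI impI)
    show "m \<noteq> carrier Reg" using m(3) by auto
    fix K assume K: "submodule K R Reg \<and> m \<subseteq> K"
    show "K = m \<or> K = carrier Reg"
    proof (cases "\<one> \<in> K")
      case True
      have "r \<in> K" if "r \<in> carrier R" for r
        using submodule_smult[OF conjunct1[OF K] that True] that by simp
      then show ?thesis using submodule_subset[OF conjunct1[OF K]] by auto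
    next
      case False
      then show ?thesis using m(4) K by blast
    qed
  qed (rule m(1))
  then obtain j where j: "j \<in> carrier J" "j \<noteq> \<zero>\<^bsub>J\<^esub>" "\<forall>y\<in>m. y \<odot>\<^bsub>J\<^esub> j = \<zero>\<^bsub>J\<^esub>"
    by (rule max_ideal_torsion_nonzero)
  have ann: "r \<odot>\<^bsub>J\<^esub> j = \<zero>\<^bsub>J\<^esub>" if "r \<in> carrier R" "r \<odot>\<^bsub>M\<^esub> x = \<zero>\<^bsub>M\<^esub>" for r
    using that m(2) j(3) by (auto simp: A_def)
  obtain g where g: "g \<in> mhom R (M\<lparr>carrier := cyclic_submodule R M x\<rparr>) J"
    "\<forall>r\<in>carrier R. g (r \<odot>\<^bsub>M\<^esub> x) = r \<odot>\<^bsub>J\<^esub> j"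
    by (rule cyclic_hom[OF M.right_module_axioms J.right_module_axioms x(1) j(1) ann])
  obtain u where u: "u \<in> mhom R M J" "\<forall>y\<in>cyclic_submodule R M x. u y = g y"
    by (rule injective_extend_submodule[OF J_injective M M.cyclic_is_submodule[OF x(1)]
      M.fg_cyclic[OF x(1)] g(1)])
  have "u x = \<one> \<odot>\<^bsub>J\<^esub> j"
    using u(2) M.cyclic_self[OF x(1)] g(2) M.smult_one[OF x(1)] one_closed by metis
  then show thesis using that[OF u(1)] j(1,2) by simp
qed

text \<open>The cogenerator property applied to the residue of x in M / N.\<close>

lemma separating_hom:
  assumes M: "fg_module R M" and N: "submodule N R M" and x: "x \<in> carrier M" "x \<notin> N"
  obtains u where "u \<in> mhom R M J" "\<forall>y\<in>N. u y = \<zero>\<^bsub>J\<^esub>" "u x \<noteq> \<zero>\<^bsub>J\<^esub>"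
proof -
  interpret M: right_module R M by (rule fg_right_module[OF M])
  let ?Q = "quotient_module M N" and ?p = "\<lambda>x\<in>carrier M. N +>\<^bsub>M\<^esub> x"
  note p = M.quotient_proj_hom[OF N]
  interpret p: module_hom R M ?Q ?p
    by (rule module_homI[OF M.right_module_axioms M.quotient_right_module[OF N] p])
  have pz: "?p y = \<zero>\<^bsub>?Q\<^esub> \<longleftrightarrow> y \<in> N" if "y \<in> carrier M" for y
    using that M.coset_eq_zero_iff[OF N that] by (simp add: M.quotient_zero)
  obtain v where v: "v \<in> mhom R ?Q J" "v (?p x) \<noteq> \<zero>\<^bsub>J\<^esub>"
    by (rule nonvanishing_hom[OF fg_quotient[OF M N] p.closed[OF x(1)]]) (use pz x in auto)
  interpret v: module_hom R ?Q J v
    by (rule module_homI[OF M.quotient_right_module[OF N] J.right_module_axioms v(1)])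
  show thesis
  proof (rule that)
    show "compose (carrier M) v ?p \<in> mhom R M J"
      by (rule mhom_compose[OF M.right_module_axioms p v(1)])
    show "\<forall>y\<in>N. compose (carrier M) v ?p y = \<zero>\<^bsub>J\<^esub>"
      using pz submodule_mem[OF N] v.zero by (metis compose_eq)
    show "compose (carrier M) v ?p x \<noteq> \<zero>\<^bsub>J\<^esub>" using v(2) x(1) by (simp only: compose_eq not_False_eq_True)
  qed
qed

text \<open>Evaluation at n generators embeds \<open>Hom(M, J)\<close> into the n-th power of
  \<open>J\<close>. The power is never formed: the induction splits a submodule V into its values at
  one generator, a submodule of \<open>J\<close>, and the elements of V vanishing there.\<close>

lemma hom_chain_cond:
  assumes M: "fg_module R M" and cc: "chain_cond asc R J"
  shows "chain_cond asc R (hom_module R M J)"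
proof -
  interpret M: right_module R M by (rule fg_right_module[OF M])
  interpret H: right_module R "hom_module R M J"
    by (rule hom_module_right_module[OF M.right_module_axioms J.right_module_axioms is_cring])
  have vanish: "submodule {u \<in> V. u x = \<zero>\<^bsub>J\<^esub>} R (hom_module R M J)"
    if V: "submodule V R (hom_module R M J)" and x: "x \<in> carrier M" for V x
    using submodule_mem[OF V] submodule_zero[OF V] submodule_add[OF V] submodule_smult[OF V] x
    by (intro H.submoduleI) auto
  have eval_sub: "submodule ((\<lambda>u. u x) ` V) R J"
    if V: "submodule V R (hom_module R M J)" and x: "x \<in> carrier M" for V x
  proof (rule J.submoduleI)
    show "(\<lambda>u. u x) ` V \<subseteq> carrier J"
      using submodule_mem[OF V] mhom_closed[where R = R and M = M and N = J] x by auto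
    show "\<zero>\<^bsub>J\<^esub> \<in> (\<lambda>u. u x) ` V"
      using submodule_zero[OF V] x by (intro image_eqI[of _ _ "\<zero>\<^bsub>hom_module R M J\<^esub>"]) auto
    fix a b assume "a \<in> (\<lambda>u. u x) ` V" "b \<in> (\<lambda>u. u x) ` V"
    then obtain u v where "u \<in> V" "v \<in> V" "a = u x" "b = v x" by auto
    then show "a \<oplus>\<^bsub>J\<^esub> b \<in> (\<lambda>u. u x) ` V"
      using submodule_add[OF V] x by (intro image_eqI[of _ _ "u \<oplus>\<^bsub>hom_module R M J\<^esub> v"]) auto
  next
    fix r a assume "r \<in> carrier R" "a \<in> (\<lambda>u. u x) ` V"
    moreover then obtain u where "u \<in> V" "a = u x" by auto
    ultimately show "r \<odot>\<^bsub>J\<^esub> a \<in> (\<lambda>u. u x) ` V"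
      using submodule_smult[OF V] x by (intro image_eqI[of _ _ "r \<odot>\<^bsub>hom_module R M J\<^esub> u"]) auto
  qed
  \<comment> \<open>Given u in the larger submodule, some v in the smaller one has the same value at
    x, and u - v vanishes at x.\<close>
  have cmp: "V m = V n"
    if V: "submodule (V m) R (hom_module R M J)" "submodule (V n) R (hom_module R M J)"
      and le: "V m \<subseteq> V n" and x: "x \<in> carrier M"
      and ker: "{u \<in> V m. u x = \<zero>\<^bsub>J\<^esub>} = {u \<in> V n. u x = \<zero>\<^bsub>J\<^esub>}"
      and val: "(\<lambda>u. u x) ` V m = (\<lambda>u. u x) ` V n" for V :: "nat \<Rightarrow> _" and m n x
  proof
    show "V n \<subseteq> V m"
    proof
      fix u assume u: "u \<in> V n"
      then have "u x \<in> (\<lambda>u. u x) ` V m" unfolding val by (rule imageI)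
      then obtain v where v: "v \<in> V m" "v x = u x" by auto
      have uv: "u \<in> carrier (hom_module R M J)" "v \<in> carrier (hom_module R M J)"
        using submodule_mem[OF V(2) u] submodule_mem[OF V(1) v(1)] by blast+
      define w where "w = u \<ominus>\<^bsub>hom_module R M J\<^esub> v"
      have w: "w \<in> V n" unfolding w_def by (rule submodule_diff[OF V(2) u subsetD[OF le v(1)]])
      have wv: "w \<oplus>\<^bsub>hom_module R M J\<^esub> v = u" unfolding w_def by (rule H.diff_add_cancel[OF uv])
      have "(w \<oplus>\<^bsub>hom_module R M J\<^esub> v) x = u x" using wv by simp
      then have "w x \<oplus>\<^bsub>J\<^esub> v x = u x" using x by simp
      then have "w x = \<zero>\<^bsub>J\<^esub>"
        using v(2) mhom_closed[of v R M J x] mhom_closed[of w R M J x] x uv submodule_mem[OF V(2) w]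
        by (simp add: J.M.add.r_cancel_one)
      then have "w \<in> V m" using ker w by blast
      then show "u \<in> V m" using submodule_add[OF V(1) _ v(1)] wv by metis
    qed
  qed (rule le)
  \<comment> \<open>The last premise says that the members are determined by their values on S.
    Dropping x from S keeps it true for the members that vanish at x.\<close>
  have *: "\<exists>n. \<forall>m\<ge>n. V m = V n"
    if "finite S" "S \<subseteq> carrier M" "\<And>n::nat. submodule (V n) R (hom_module R M J)"
      "\<And>n. if asc then V n \<subseteq> V (Suc n) else V (Suc n) \<subseteq> V n"
      "\<And>n u. \<lbrakk>u \<in> V n; \<forall>x\<in>S. u x = \<zero>\<^bsub>J\<^esub>\<rbrakk> \<Longrightarrow> u = \<zero>\<^bsub>hom_module R M J\<^esub>" for S V
    using that
  proof (induction S arbitrary: V rule: finite_induct)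
    case empty
    have "V n = {\<zero>\<^bsub>hom_module R M J\<^esub>}" for n
      using empty(4)[of _ n] submodule_zero[OF empty(2)[of n]] by blast
    then show ?case by blast
  next
    case (insert x S)
    have x: "x \<in> carrier M" and S: "S \<subseteq> carrier M" using insert.prems(1) by auto
    note V = insert.prems(2)
    have "\<exists>n. \<forall>m\<ge>n. {u \<in> V m. u x = \<zero>\<^bsub>J\<^esub>} = {u \<in> V n. u x = \<zero>\<^bsub>J\<^esub>}"
    proof (rule insert.IH[OF S])
      show "submodule {u \<in> V n. u x = \<zero>\<^bsub>J\<^esub>} R (hom_module R M J)" for n
        by (rule vanish[OF V x])
      show "if asc then {u \<in> V n. u x = \<zero>\<^bsub>J\<^esub>} \<subseteq> {u \<in> V (Suc n). u x = \<zero>\<^bsub>J\<^esub>}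
          else {u \<in> V (Suc n). u x = \<zero>\<^bsub>J\<^esub>} \<subseteq> {u \<in> V n. u x = \<zero>\<^bsub>J\<^esub>}" for n
        using insert.prems(3)[of n] by (auto split: if_splits)
      show "u = \<zero>\<^bsub>hom_module R M J\<^esub>" if "u \<in> {u \<in> V n. u x = \<zero>\<^bsub>J\<^esub>}" "\<forall>x\<in>S. u x = \<zero>\<^bsub>J\<^esub>" for n u
        using that by (intro insert.prems(4)[of u n]) auto
    qed
    then obtain n1 where n1: "\<forall>m\<ge>n1. {u \<in> V m. u x = \<zero>\<^bsub>J\<^esub>} = {u \<in> V n1. u x = \<zero>\<^bsub>J\<^esub>}" ..
    have "\<exists>n. \<forall>m\<ge>n. (\<lambda>u. u x) ` V m = (\<lambda>u. u x) ` V n"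
      by (rule chain_condD[where V = "\<lambda>n. (\<lambda>u. u x) ` V n", OF cc eval_sub[OF V x]])
        (use insert.prems(3) in \<open>simp add: image_mono split: if_splits\<close>)
    then obtain n2 where n2: "\<forall>m\<ge>n2. (\<lambda>u. u x) ` V m = (\<lambda>u. u x) ` V n2" ..
    define n where "n = max n1 n2"
    have le: "if asc then V n \<subseteq> V m else V m \<subseteq> V n" if "n \<le> m" for m
      using that
    proof (induction m rule: dec_induct)
      case (step k)
      then show ?case using insert.prems(3)[of k] by (cases asc) auto
    qed simp
    have "V m = V n" if m: "n \<le> m" for m
    proof -
      have nm: "n1 \<le> m" "n1 \<le> n" "n2 \<le> m" "n2 \<le> n" using m by (simp_all add: n_def)
      have eq: "{u \<in> V m. u x = \<zero>\<^bsub>J\<^esub>} = {u \<in> V n. u x = \<zero>\<^bsub>J\<^esub>}"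
          "(\<lambda>u. u x) ` V m = (\<lambda>u. u x) ` V n"
        using n1[rule_format, OF nm(1)] n1[rule_format, OF nm(2)]
          n2[rule_format, OF nm(3)] n2[rule_format, OF nm(4)] by (simp_all only:)
      show ?thesis
      proof (cases asc)
        case True
        then have "V n \<subseteq> V m" using le[OF m] by simp
        then show ?thesis using cmp[where V = V, OF V V _ x, of n m] eq by (simp only:)
      next
        case False
        then have "V m \<subseteq> V n" using le[OF m] by simp
        then show ?thesis using cmp[where V = V, OF V V _ x, of m n] eq by (simp only:)
      qed
    qed
    then show ?case by blast
  qed
  obtain S where S: "finite S" "S \<subseteq> carrier M"
    "\<forall>K. submodule K R M \<longrightarrow> S \<subseteq> K \<longrightarrow> K = carrier M"
    by (rule fg_moduleE[OF M])
  show ?thesis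
  proof (rule chain_condI)
    fix V :: "nat \<Rightarrow> _ set"
    assume V: "\<And>n. submodule (V n) R (hom_module R M J)"
      "\<And>n. if asc then V n \<subseteq> V (Suc n) else V (Suc n) \<subseteq> V n"
    show "\<exists>n. \<forall>m\<ge>n. V m = V n"
    proof (rule *[where V = V, OF S(1,2) V])
      fix n u assume u: "u \<in> V n" "\<forall>x\<in>S. u x = \<zero>\<^bsub>J\<^esub>"
      have uH: "u \<in> mhom R M J" using submodule_mem[OF V(1) u(1)] by simp
      interpret u: module_hom R M J u
        by (rule module_homI[OF M.right_module_axioms J.right_module_axioms uH])
      have "mker M J u = carrier M"
        using S(3) u.ker_submodule S(2) u(2) by (auto simp: mker_def)
      then show "u = \<zero>\<^bsub>hom_module R M J\<^esub>"
        using mhom_extensional[OF uH]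
        by (intro extensionalityI[of _ "carrier M"]) (auto simp: mker_def)
    qed
  qed
qed

text \<open>The annihilators of the members of the chain in \<open>Hom(M, J)\<close> descend and
  hence stabilise; functionals that separate a submodule from an outside element recover each member
  from its annihilator.\<close>

lemma fg_ascending:
  assumes M: "fg_module R M" shows "chain_cond True R M"
proof (rule chain_condI)
  interpret M: right_module R M by (rule fg_right_module[OF M])
  interpret H: right_module R "hom_module R M J"
    by (rule hom_module_right_module[OF M.right_module_axioms J.right_module_axioms is_cring])
  fix V :: "nat \<Rightarrow> _ set"
  assume V: "\<And>n. submodule (V n) R M" "\<And>n. if True then V n \<subseteq> V (Suc n) else V (Suc n) \<subseteq> V n"
  define W where "W n = {u \<in> mhom R M J. \<forall>x\<in>V n. u x = \<zero>\<^bsub>J\<^esub>}" for n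
  have W: "submodule (W n) R (hom_module R M J)" for n
    using submodule_mem[OF V(1)] H.M.a_closed H.smult_closed H.M.zero_closed
    by (intro H.submoduleI) (auto simp: W_def)
  have le: "if False then W n \<subseteq> W (Suc n) else W (Suc n) \<subseteq> W n" for n
    using V(2)[of n] by (auto simp: W_def)
  have "\<exists>n. \<forall>m\<ge>n. W m = W n"
    by (rule chain_condD[where V = W, OF hom_chain_cond[OF M fg_descending[OF J_fg]] W le])
  then obtain n where n: "\<forall>m\<ge>n. W m = W n" ..
  have "V m = V n" if m: "n \<le> m" for m
  proof
    have "V k \<subseteq> V (Suc k)" for k using V(2)[of k] by simp
    then show "V n \<subseteq> V m" using m by (rule lift_Suc_mono_le)
    show "V m \<subseteq> V n"
    proof (rule ccontr)
      assume "\<not> V m \<subseteq> V n"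
      then obtain x where x: "x \<in> V m" "x \<notin> V n" by blast
      obtain u where u: "u \<in> mhom R M J" "\<forall>y\<in>V n. u y = \<zero>\<^bsub>J\<^esub>" "u x \<noteq> \<zero>\<^bsub>J\<^esub>"
        by (rule separating_hom[OF M V(1) submodule_mem[OF V(1) x(1)] x(2)])
      then have "u \<in> W n" by (simp add: W_def)
      then have "u \<in> W m" using n m by blast
      then show False using x(1) u(3) by (simp add: W_def)
    qed
  qed
  then show "\<exists>n. \<forall>m\<ge>n. V m = V n" by blast
qed

text \<open>Double duality, by passing from a submodule on whose annihilator \<open>\<omega>\<close> is already an
  evaluation to a maximal submodule of it.\<close>

lemma evaluation:
  assumes M: "fg_module R M" and \<omega>: "\<omega> \<in> mhom R (hom_module R M J) J"
  obtains x where "x \<in> carrier M" "\<forall>u\<in>mhom R M J. \<omega> u = u x"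
proof -
  let ?H = "hom_module R M J"
  interpret M: right_module R M by (rule fg_right_module[OF M])
  interpret H: right_module R ?H
    by (rule hom_module_right_module[OF M.right_module_axioms J.right_module_axioms is_cring])
  interpret \<omega>: module_hom R ?H J \<omega>
    by (rule module_homI[OF H.right_module_axioms J.right_module_axioms \<omega>])
  define perp where "perp N = {u \<in> mhom R M J. \<forall>y\<in>N. u y = \<zero>\<^bsub>J\<^esub>}" for N
  \<comment> \<open>The whole module belongs to F with x zero, and if the zero submodule belongs to
    F, then \<omega> is an evaluation; a minimal member is shown to be zero.\<close>
  define F where "F = {N. submodule N R M \<and> (\<exists>x\<in>carrier M. \<forall>u\<in>perp N. \<omega> u = u x)}"
  have "\<omega> u = u \<zero>\<^bsub>M\<^esub>" if "u \<in> perp (carrier M)" for u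
  proof -
    have "u = \<zero>\<^bsub>?H\<^esub>"
      using that mhom_extensional[of u R M J]
      by (intro extensionalityI[of _ "carrier M"]) (auto simp: perp_def)
    then show ?thesis using \<omega>.zero by simp
  qed
  then have "carrier M \<in> F" using M.carrier_submodule by (auto simp: F_def)
  then have "F \<noteq> {}" by auto
  moreover have "submodule N R M" if "N \<in> F" for N using that by (simp add: F_def)
  ultimately obtain N where N: "N \<in> F" "\<forall>K\<in>F. K \<subseteq> N \<longrightarrow> K = N"
    by (rule minimal_submodule_exists[OF fg_descending[OF M]])
  then obtain x where Ns: "submodule N R M" and x: "x \<in> carrier M" "\<forall>u\<in>perp N. \<omega> u = u x"
    by (auto simp: F_def)
  have "N = {\<zero>\<^bsub>M\<^esub>}"
  proof (rule ccontr)
    assume N0: "N \<noteq> {\<zero>\<^bsub>M\<^esub>}"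
    define G where "G = {K. submodule K R M \<and> K \<subset> N}"
    have "{\<zero>\<^bsub>M\<^esub>} \<in> G" using N0 submodule_zero[OF Ns] M.zero_submodule by (auto simp: G_def)
    then have "G \<noteq> {}" by auto
    moreover have "submodule K R M" if "K \<in> G" for K using that by (simp add: G_def)
    ultimately obtain K where K: "K \<in> G" "\<forall>L\<in>G. K \<subseteq> L \<longrightarrow> L = K"
      by (rule maximal_submodule_exists[OF fg_ascending[OF M]])
    have Ks: "submodule K R M" and KN: "K \<subseteq> N" using K(1) by (auto simp: G_def)
    obtain n where n: "n \<in> N" "n \<notin> K" using K(1) by (auto simp: G_def)
    have nM: "n \<in> carrier M" using submodule_mem[OF Ns n(1)] .
    have gen: "L = N" if L: "submodule L R M" "K \<subseteq> L" "L \<subseteq> N" "l \<in> L" "l \<notin> K" for L l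
    proof (rule ccontr)
      assume "L \<noteq> N"
      then have "L \<in> G" using L by (auto simp: G_def)
      then show False using K(2) L by blast
    qed
    \<comment> \<open>N / K is simple and generated by the residue of n, so the annihilator of that
      residue is a maximal ideal.\<close>
    define m where "m = {r \<in> carrier R. r \<odot>\<^bsub>M\<^esub> n \<in> K}"
    have ms: "submodule m R Reg"
    proof (rule Reg.submoduleI)
      show "\<zero>\<^bsub>Reg\<^esub> \<in> m" using nM submodule_zero[OF Ks] by (simp add: m_def)
      show "a \<oplus>\<^bsub>Reg\<^esub> b \<in> m" if "a \<in> m" "b \<in> m" for a b
        using that nM submodule_add[OF Ks] by (simp add: m_def M.smult_l_distr)
      show "r \<odot>\<^bsub>Reg\<^esub> a \<in> m" if "r \<in> carrier R" "a \<in> m" for r a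
        using that nM submodule_smult[OF Ks] by (simp add: m_def M.smult_assoc)
    qed (auto simp: m_def)
    have m: "maximal_submodule R Reg m"
      unfolding maximal_submodule_def
    proof (intro conjI allI impI ms)
      have "\<one> \<notin> m" using n(2) nM by (simp add: m_def)
      then show "m \<noteq> carrier Reg" by auto
      fix I assume I: "submodule I R Reg \<and> m \<subseteq> I"
      show "I = m \<or> I = carrier Reg"
      proof (cases "I = m")
        case False
        then obtain k where k: "k \<in> I" "k \<notin> m" using I by blast
        have kR: "k \<in> carrier R" using submodule_mem[OF conjunct1[OF I] k(1)] by simp
        have knM: "k \<odot>\<^bsub>M\<^esub> n \<in> carrier M" using kR nM by simp
        have knK: "k \<odot>\<^bsub>M\<^esub> n \<notin> K" using k(2) kR by (simp add: m_def)
        note cyc = M.cyclic_is_submodule[OF knM]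
        have "cyclic_submodule R M (k \<odot>\<^bsub>M\<^esub> n) <+>\<^bsub>M\<^esub> K = N"
        proof (rule gen[of _ "k \<odot>\<^bsub>M\<^esub> n"])
          show "cyclic_submodule R M (k \<odot>\<^bsub>M\<^esub> n) <+>\<^bsub>M\<^esub> K \<subseteq> N"
            using M.cyclic_least[OF Ns submodule_smult[OF Ns kR n(1)]] KN
            by (rule M.sum_least[OF Ns])
          show "k \<odot>\<^bsub>M\<^esub> n \<in> cyclic_submodule R M (k \<odot>\<^bsub>M\<^esub> n) <+>\<^bsub>M\<^esub> K"
            using M.sum_upper(1)[OF cyc Ks] M.cyclic_self[OF knM] by blast
        qed (use M.sum_submodule[OF cyc Ks] M.sum_upper[OF cyc Ks] knK in auto)
        then have "n \<in> cyclic_submodule R M (k \<odot>\<^bsub>M\<^esub> n) <+>\<^bsub>M\<^esub> K" using n(1) by simp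
        then obtain z l where zl: "z \<in> cyclic_submodule R M (k \<odot>\<^bsub>M\<^esub> n)" "l \<in> K" "n = z \<oplus>\<^bsub>M\<^esub> l"
          unfolding M.set_add_mem_iff by blast
        obtain r where "r \<in> carrier R" "z = r \<odot>\<^bsub>M\<^esub> (k \<odot>\<^bsub>M\<^esub> n)" by (rule M.cyclicE[OF zl(1)])
        then have rl: "r \<in> carrier R" "l \<in> K" "n = r \<odot>\<^bsub>M\<^esub> (k \<odot>\<^bsub>M\<^esub> n) \<oplus>\<^bsub>M\<^esub> l"
          using zl(2,3) by blast+
        have lM: "l \<in> carrier M" using submodule_mem[OF Ks rl(2)] .
        define a where "a = (k \<otimes> r) \<odot>\<^bsub>M\<^esub> n"
        have aM: "a \<in> carrier M" using kR rl(1) nM by (simp add: a_def)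
        have "r \<odot>\<^bsub>M\<^esub> (k \<odot>\<^bsub>M\<^esub> n) = a" using rl(1) kR nM by (simp add: a_def M.smult_assoc)
        then have "n = l \<oplus>\<^bsub>M\<^esub> a" using rl(3) M.M.a_comm[OF aM lM] by metis
        then have "n \<ominus>\<^bsub>M\<^esub> a = l"
          using M.diff_add_cancel[OF nM aM] M.M.add.right_cancel[of a "n \<ominus>\<^bsub>M\<^esub> a" l] aM lM nM by simp
        then have "(\<one> \<ominus> k \<otimes> r) \<odot>\<^bsub>M\<^esub> n = l"
          using rl(1) kR nM by (simp add: M.smult_l_diff a_def)
        then have "\<one> \<ominus> k \<otimes> r \<in> I" using I rl(1,2) kR by (auto simp: m_def)
        moreover have "k \<otimes> r \<in> I" using submodule_smult[OF conjunct1[OF I] rl(1) k(1)] by simp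
        ultimately have "(\<one> \<ominus> k \<otimes> r) \<oplus> k \<otimes> r \<in> I"
          using submodule_add[OF conjunct1[OF I]] by (simp only: regular_simps)
        then have "\<one> \<in> I" using Reg.diff_add_cancel[of \<one> "k \<otimes> r"] kR rl(1)
          by (simp add: a_minus_def a_assoc l_neg)
        then have "r \<in> I" if "r \<in> carrier R" for r
          using submodule_smult[OF conjunct1[OF I] that, of \<one>] that by simp
        then show ?thesis using submodule_subset[OF conjunct1[OF I]] by auto
      qed simp
    qed
    obtain u0 where u0: "u0 \<in> mhom R M J" "\<forall>y\<in>K. u0 y = \<zero>\<^bsub>J\<^esub>" "u0 n \<noteq> \<zero>\<^bsub>J\<^esub>"
      by (rule separating_hom[OF M Ks nM n(2)])
    have tors: "y \<odot>\<^bsub>J\<^esub> u n = \<zero>\<^bsub>J\<^esub>" if "u \<in> perp K" "y \<in> m" for u y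
      using that mhom_smult[of u R M J y n] nM by (auto simp: perp_def m_def)
    \<comment> \<open>The error of evaluation at x. It vanishes on \<open>perp N\<close>, so on
      \<open>perp K\<close> it depends on the value at n only, and that value lies in the simple
      m-torsion of \<open>J\<close>.\<close>
    define \<eta> where "\<eta> u = \<omega> u \<ominus>\<^bsub>J\<^esub> u x" for u
    have \<eta>J: "\<eta> u \<in> carrier J" if "u \<in> mhom R M J" for u
      using that x(1) by (simp add: \<eta>_def mhom_closed)
    have \<eta>_smult: "\<eta> (r \<odot>\<^bsub>?H\<^esub> u) = r \<odot>\<^bsub>J\<^esub> \<eta> u" if "u \<in> mhom R M J" "r \<in> carrier R" for r u
      using that x(1) \<omega>.smult[of r u]
      by (simp add: \<eta>_def mhom_closed J.smult_diff)
    have \<eta>_add: "\<eta> (u \<oplus>\<^bsub>?H\<^esub> v) = \<eta> u \<oplus>\<^bsub>J\<^esub> \<eta> v" if "u \<in> mhom R M J" "v \<in> mhom R M J" for u v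
      using that x(1) \<omega>.add[of u v]
      by (simp add: \<eta>_def mhom_closed a_minus_def J.M.minus_add J.M.a_ac)
    have \<eta>0: "\<eta> u = \<zero>\<^bsub>J\<^esub>" if "u \<in> perp N" for u
      using that x mhom_closed[of u R M J x] by (auto simp: \<eta>_def perp_def J.diff_eq_zero_iff)
    have perpN: "u \<in> perp N" if u: "u \<in> perp K" "u n = \<zero>\<^bsub>J\<^esub>" for u
    proof -
      have uH: "u \<in> mhom R M J" using u(1) by (simp add: perp_def)
      interpret u: module_hom R M J u
        by (rule module_homI[OF M.right_module_axioms J.right_module_axioms uH])
      have "mker M J u \<inter> N = N"
      proof (rule gen[of _ n])
        show "submodule (mker M J u \<inter> N) R M" by (rule M.Int_submodule[OF u.ker_submodule Ns])
        show "K \<subseteq> mker M J u \<inter> N"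
          using KN u(1) submodule_mem[OF Ks] by (auto simp: mker_def perp_def)
      qed (use n nM u(2) in \<open>auto simp: mker_def\<close>)
      then show ?thesis using uH by (auto simp: perp_def mker_def)
    qed
    have u0K: "u0 \<in> perp K" using u0 by (simp add: perp_def)
    have "y \<odot>\<^bsub>J\<^esub> \<eta> u0 = \<zero>\<^bsub>J\<^esub>" if y: "y \<in> m" for y
    proof -
      have yR: "y \<in> carrier R" using max_ideal_mem[OF m y] .
      have "y \<odot>\<^bsub>?H\<^esub> u0 \<in> perp N"
      proof (rule perpN)
        show "y \<odot>\<^bsub>?H\<^esub> u0 \<in> perp K"
          using u0 H.smult_closed[OF yR, of u0] submodule_mem[OF Ks] yR by (auto simp: perp_def)
        show "(y \<odot>\<^bsub>?H\<^esub> u0) n = \<zero>\<^bsub>J\<^esub>" using tors[OF u0K y] nM by simp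
      qed
      then show ?thesis using \<eta>0 \<eta>_smult[OF u0(1) yR] by simp
    qed
    then obtain r where r: "r \<in> carrier R" "\<eta> u0 = r \<odot>\<^bsub>J\<^esub> u0 n"
      using max_ideal_torsion_simple[OF m mhom_closed[OF u0(1) nM] u0(3) _ \<eta>J[OF u0(1)]]
        tors[OF u0K] by blast
    have \<eta>_eq: "\<eta> u = r \<odot>\<^bsub>J\<^esub> u n" if u: "u \<in> perp K" for u
    proof -
      have uH: "u \<in> mhom R M J" using u by (simp add: perp_def)
      obtain s where s: "s \<in> carrier R" "u n = s \<odot>\<^bsub>J\<^esub> u0 n"
        using max_ideal_torsion_simple[OF m mhom_closed[OF u0(1) nM] u0(3) _ mhom_closed[OF uH nM]]
          tors[OF u0K] tors[OF u] by blast
      \<comment> \<open>Subtracting s times u0 makes v vanish at n as well as on K, hence on N,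
        where the error is zero.\<close>
      define v where "v = u \<oplus>\<^bsub>?H\<^esub> ((\<ominus> s) \<odot>\<^bsub>?H\<^esub> u0)"
      have su: "(\<ominus> s) \<odot>\<^bsub>?H\<^esub> u0 \<in> mhom R M J" using H.smult_closed[of "\<ominus> s" u0] s(1) u0(1) by simp
      have u0n: "u0 n \<in> carrier J" and \<eta>u0: "\<eta> u0 \<in> carrier J" and \<eta>u: "\<eta> u \<in> carrier J"
        using mhom_closed[OF u0(1) nM] \<eta>J u0(1) uH by simp_all
      have "v \<in> perp N"
      proof (rule perpN)
        show "v \<in> perp K"
          using H.M.a_closed[of u "(\<ominus> s) \<odot>\<^bsub>?H\<^esub> u0"] u u0(2) su uH s(1) submodule_mem[OF Ks]
          by (auto simp: perp_def v_def)
        show "v n = \<zero>\<^bsub>J\<^esub>"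
          using nM s u0n by (simp add: v_def J.smult_l_minus J.M.r_neg)
      qed
      then have "\<zero>\<^bsub>J\<^esub> = \<eta> u \<oplus>\<^bsub>J\<^esub> \<eta> ((\<ominus> s) \<odot>\<^bsub>?H\<^esub> u0)"
        using \<eta>0[of v] \<eta>_add[OF uH su] by (simp only: v_def)
      also have "\<eta> ((\<ominus> s) \<odot>\<^bsub>?H\<^esub> u0) = \<ominus>\<^bsub>J\<^esub> (s \<odot>\<^bsub>J\<^esub> \<eta> u0)"
        using \<eta>_smult[OF u0(1), of "\<ominus> s"] s(1) \<eta>u0 by (simp only: a_inv_closed J.smult_l_minus)
      finally have "\<eta> u = s \<odot>\<^bsub>J\<^esub> \<eta> u0"
        using \<eta>u \<eta>u0 s(1) J.diff_eq_zero_iff[of "\<eta> u" "s \<odot>\<^bsub>J\<^esub> \<eta> u0"]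
        by (simp add: a_minus_def)
      also have "\<dots> = r \<odot>\<^bsub>J\<^esub> u n"
        using r s u0n by (simp add: m_comm flip: J.smult_assoc)
      finally show ?thesis .
    qed
    \<comment> \<open>The error on \<open>perp K\<close> is evaluation at r n, so adding r n to x
      corrects it and puts K into F, against the minimality of N.\<close>
    define x' where "x' = x \<oplus>\<^bsub>M\<^esub> r \<odot>\<^bsub>M\<^esub> n"
    have "\<omega> u = u x'" if u: "u \<in> perp K" for u
    proof -
      have uH: "u \<in> mhom R M J" using u by (simp add: perp_def)
      have "\<omega> u = \<eta> u \<oplus>\<^bsub>J\<^esub> u x"
        unfolding \<eta>_def using \<omega>.closed[of u] mhom_closed[OF uH x(1)] uH
        by (subst J.diff_add_cancel) simp_all
      also have "\<dots> = u x'"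
        using \<eta>_eq[OF u] r(1) nM x(1) uH
        by (simp add: x'_def mhom_add[OF uH] mhom_smult[OF uH] mhom_closed J.M.a_comm)
      finally show ?thesis .
    qed
    then have "K \<in> F" using Ks x(1) r(1) nM by (auto simp: F_def x'_def)
    then show False using N(2) KN K(1) by (auto simp: G_def)
  qed
  then have "perp N = mhom R M J"
  proof -
    have "u \<zero>\<^bsub>M\<^esub> = \<zero>\<^bsub>J\<^esub>" if "u \<in> mhom R M J" for u
      by (rule module_hom.zero[OF module_homI[OF M.right_module_axioms J.right_module_axioms that]])
    then show ?thesis using \<open>N = {\<zero>\<^bsub>M\<^esub>}\<close> by (auto simp: perp_def)
  qed
  then show thesis using x by (intro that[of x]) simp_all
qed

end

section \<open>Indecomposable modules of finite length\<close>

context right_module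
begin

lemma decomposition_trivial:
  assumes ind: "indecomposable R M" and "submodule N R M" "submodule K R M"
    "\<And>x. \<lbrakk>x \<in> N; x \<in> K\<rbrakk> \<Longrightarrow> x = \<zero>\<^bsub>M\<^esub>"
    "\<And>x. x \<in> carrier M \<Longrightarrow> \<exists>n\<in>N. \<exists>k\<in>K. x = n \<oplus>\<^bsub>M\<^esub> k"
  shows "N = {\<zero>\<^bsub>M\<^esub>} \<or> K = {\<zero>\<^bsub>M\<^esub>}"
proof -
  have "N \<inter> K = {\<zero>\<^bsub>M\<^esub>}" using assms(4) submodule_zero assms(2,3) by fast
  moreover have "N <+>\<^bsub>M\<^esub> K = carrier M"
  proof
    show "N <+>\<^bsub>M\<^esub> K \<subseteq> carrier M" using submodule_subset[OF sum_submodule[OF assms(2,3)]] .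
    show "carrier M \<subseteq> N <+>\<^bsub>M\<^esub> K" using assms(5) set_add_mem_iff by blast
  qed
  ultimately show ?thesis using ind assms(2,3) unfolding indecomposable_def by blast
qed

text \<open>Once the kernels and the images of the powers of h are stable, M is the direct sum of
  the kernel and the image of \<open>h ^^ n\<close>, and indecomposability removes one of the
  two.\<close>

lemma fitting:
  assumes ind: "indecomposable R M" and asc: "chain_cond True R M" and desc: "chain_cond False R M"
    and h: "h \<in> mhom R M M"
  shows "bij_betw h (carrier M) (carrier M) \<or> (\<exists>n. \<forall>x\<in>carrier M. (h ^^ n) x = \<zero>\<^bsub>M\<^esub>)"
proof -
  interpret h: module_hom R M M h by (rule module_homI[OF right_module_axioms right_module_axioms h])
  have cl: "(h ^^ n) x \<in> carrier M" if "x \<in> carrier M" for n x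
    using that by (induction n) auto
  have p: "restrict (h ^^ n) (carrier M) \<in> mhom R M M" for n
  proof (rule mhom_restrictI[OF right_module_axioms cl])
    show "(h ^^ n) (x \<oplus>\<^bsub>M\<^esub> y) = (h ^^ n) x \<oplus>\<^bsub>M\<^esub> (h ^^ n) y"
      if "x \<in> carrier M" "y \<in> carrier M" for x y
      using that by (induction n) (simp_all add: cl)
    show "(h ^^ n) (r \<odot>\<^bsub>M\<^esub> x) = r \<odot>\<^bsub>M\<^esub> (h ^^ n) x" if "r \<in> carrier R" "x \<in> carrier M" for r x
      using that by (induction n) (simp_all add: cl)
  qed
  define K where "K n = {x \<in> carrier M. (h ^^ n) x = \<zero>\<^bsub>M\<^esub>}" for n
  define I where "I n = (h ^^ n) ` carrier M" for n
  have K: "submodule (K n) R M" for n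
    using module_hom.ker_submodule[OF module_homI[OF right_module_axioms right_module_axioms p[of n]]]
    by (simp add: K_def mker_def cong: conj_cong)
  have I: "submodule (I n) R M" for n
    using module_hom.image_submodule[OF module_homI[OF right_module_axioms right_module_axioms p[of n]]
        carrier_submodule]
    by (simp add: I_def)
  have Kinc: "K n \<subseteq> K (Suc n)" for n by (auto simp: K_def)
  have Idec: "I (Suc n) \<subseteq> I n" for n by (auto simp: I_def funpow_swap1)
  have Kst: "\<exists>n. \<forall>m\<ge>n. K m = K n"
    by (rule chain_condD[where V = K, OF asc K]) (simp add: Kinc)
  have Ist: "\<exists>n. \<forall>m\<ge>n. I m = I n"
    by (rule chain_condD[where V = I, OF desc I]) (simp add: Idec)
  obtain n1 where n1: "\<forall>m\<ge>n1. K m = K n1" using Kst ..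
  obtain n2 where n2: "\<forall>m\<ge>n2. I m = I n2" using Ist ..
  \<comment> \<open>The successor makes n positive, so that a statement about \<open>h ^^ n\<close>
    gives injectivity and surjectivity of h itself.\<close>
  define n where "n = Suc (max n1 n2)"
  have nm: "n1 \<le> n" "n1 \<le> n + n" "n2 \<le> n" "n2 \<le> n + n" by (simp_all add: n_def)
  have Kn: "K (n + n) = K n" and In: "I (n + n) = I n"
    using n1[rule_format, OF nm(1)] n1[rule_format, OF nm(2)]
      n2[rule_format, OF nm(3)] n2[rule_format, OF nm(4)] by (simp_all only:)
  have "I n = {\<zero>\<^bsub>M\<^esub>} \<or> K n = {\<zero>\<^bsub>M\<^esub>}"
  proof (rule decomposition_trivial[OF ind I K])
    fix x assume "x \<in> I n" "x \<in> K n"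
    then obtain y where y: "y \<in> carrier M" "x = (h ^^ n) y" "(h ^^ n) x = \<zero>\<^bsub>M\<^esub>"
      by (auto simp: I_def K_def)
    then have "y \<in> K (n + n)" by (simp add: K_def funpow_add)
    then have "y \<in> K n" unfolding Kn .
    then show "x = \<zero>\<^bsub>M\<^esub>" using y(2) by (simp add: K_def)
  next
    fix x assume x: "x \<in> carrier M"
    then have "(h ^^ n) x \<in> I (n + n)" using In by (auto simp: I_def)
    then obtain y where y: "y \<in> carrier M" "(h ^^ n) x = (h ^^ (n + n)) y" by (auto simp: I_def)
    \<comment> \<open>By stability of the images, \<open>(h ^^ n) x\<close> is also
      \<open>(h ^^ n) z\<close> with z in the image; x - z is the kernel part of x.\<close>
    define z where "z = (h ^^ n) y"
    have z: "z \<in> I n" "z \<in> carrier M" using y cl by (auto simp: z_def I_def)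
    have "(h ^^ n) (x \<ominus>\<^bsub>M\<^esub> z) = (h ^^ n) x \<ominus>\<^bsub>M\<^esub> (h ^^ n) z"
      using module_hom.diff[OF module_homI[OF right_module_axioms right_module_axioms p[of n]] x z(2)]
        x z(2) by simp
    also have "\<dots> = \<zero>\<^bsub>M\<^esub>"
      using y(2) diff_eq_zero_iff[OF cl cl, OF x z(2), of n n] by (simp add: z_def funpow_add)
    finally have "x \<ominus>\<^bsub>M\<^esub> z \<in> K n" using x z(2) by (simp add: K_def)
    moreover have "x = z \<oplus>\<^bsub>M\<^esub> (x \<ominus>\<^bsub>M\<^esub> z)"
      using diff_add_cancel[OF x z(2)] x z(2) by (simp add: M.a_comm)
    ultimately show "\<exists>a\<in>I n. \<exists>b\<in>K n. x = a \<oplus>\<^bsub>M\<^esub> b" using z(1) by blast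
  qed
  then show ?thesis
  proof
    assume "I n = {\<zero>\<^bsub>M\<^esub>}"
    then have "\<forall>x\<in>carrier M. (h ^^ n) x = \<zero>\<^bsub>M\<^esub>" by (auto simp: I_def)
    then show ?thesis by blast
  next
    assume K0: "K n = {\<zero>\<^bsub>M\<^esub>}"
    have "h x = \<zero>\<^bsub>M\<^esub> \<Longrightarrow> x \<in> carrier M \<Longrightarrow> x \<in> K n" for x
    proof -
      have z: "(h ^^ k) \<zero>\<^bsub>M\<^esub> = \<zero>\<^bsub>M\<^esub>" for k by (induction k) simp_all
      show "h x = \<zero>\<^bsub>M\<^esub> \<Longrightarrow> x \<in> carrier M \<Longrightarrow> x \<in> K n"
        using z by (simp add: K_def n_def funpow_swap1)
    qed
    then have "inj_on h (carrier M)" using K0 unfolding h.inj_iff_ker mker_def by blast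
    moreover have "carrier M \<subseteq> h ` carrier M"
    proof
      fix x assume x: "x \<in> carrier M"
      then have "(h ^^ n) x \<in> I (n + n)" using In by (auto simp: I_def)
      then obtain y where y: "y \<in> carrier M" "(h ^^ n) x = (h ^^ (n + n)) y" by (auto simp: I_def)
      define z where "z = (h ^^ n) y"
      have z: "z \<in> carrier M" using y cl by (auto simp: z_def)
      have "(h ^^ n) (x \<ominus>\<^bsub>M\<^esub> z) = (h ^^ n) x \<ominus>\<^bsub>M\<^esub> (h ^^ n) z"
        using module_hom.diff[OF module_homI[OF right_module_axioms right_module_axioms p[of n]] x z]
          x z by simp
      also have "\<dots> = \<zero>\<^bsub>M\<^esub>"
        using y(2) diff_eq_zero_iff[OF cl cl, OF x z, of n n] by (simp add: z_def funpow_add)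
      finally have "x \<ominus>\<^bsub>M\<^esub> z \<in> K n" using x z by (simp add: K_def)
      then have "x = z" using K0 diff_eq_zero_iff[OF x z] by simp
      then have "x = h ((h ^^ max n1 n2) y)" by (simp add: z_def n_def)
      then show "x \<in> h ` carrier M" using cl[OF y(1)] by blast
    qed
    ultimately have "bij_betw h (carrier M) (carrier M)" by (auto simp: bij_betw_def)
    then show ?thesis by blast
  qed
qed

text \<open>Extends f by zero on B. With f the inclusion of A it is the projection in
  \<open>injective_uniform\<close>; with f the inverse of an embedding it yields the retraction in
  \<open>almost_split\<close>.\<close>

lemma sum_projection:
  assumes A: "submodule A R M" and B: "submodule B R M" and disj: "A \<inter> B \<subseteq> {\<zero>\<^bsub>M\<^esub>}"
    and N: "right_module R N" and f: "f \<in> mhom R (M\<lparr>carrier := A\<rparr>) N"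
  obtains g where "g \<in> mhom R (M\<lparr>carrier := A <+>\<^bsub>M\<^esub> B\<rparr>) N" "\<forall>a\<in>A. \<forall>b\<in>B. g (a \<oplus>\<^bsub>M\<^esub> b) = f a"
proof -
  note memA = submodule_mem[OF A] and memB = submodule_mem[OF B]
  have uniq: "a = a'" if "a \<in> A" "a' \<in> A" "b \<in> B" "b' \<in> B" "a \<oplus>\<^bsub>M\<^esub> b = a' \<oplus>\<^bsub>M\<^esub> b'" for a a' b b'
  proof -
    have c: "a \<in> carrier M" "a' \<in> carrier M" "b \<in> carrier M" "b' \<in> carrier M"
      using that memA memB by auto
    have "(a \<ominus>\<^bsub>M\<^esub> a') \<oplus>\<^bsub>M\<^esub> (a' \<oplus>\<^bsub>M\<^esub> b) = (b' \<ominus>\<^bsub>M\<^esub> b) \<oplus>\<^bsub>M\<^esub> (a' \<oplus>\<^bsub>M\<^esub> b)"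
    proof -
      have "(a \<ominus>\<^bsub>M\<^esub> a') \<oplus>\<^bsub>M\<^esub> (a' \<oplus>\<^bsub>M\<^esub> b) = a \<oplus>\<^bsub>M\<^esub> b"
        using c diff_add_cancel[of a a'] by (simp add: M.a_assoc[symmetric])
      moreover have "(b' \<ominus>\<^bsub>M\<^esub> b) \<oplus>\<^bsub>M\<^esub> (a' \<oplus>\<^bsub>M\<^esub> b) = a' \<oplus>\<^bsub>M\<^esub> b'"
        using c diff_add_cancel[of b' b] by (simp add: M.a_lcomm)
      ultimately show ?thesis using that(5) by simp
    qed
    then have "a \<ominus>\<^bsub>M\<^esub> a' = b' \<ominus>\<^bsub>M\<^esub> b" using c by (simp add: M.add.right_cancel)
    then have "a \<ominus>\<^bsub>M\<^esub> a' \<in> A \<inter> B"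
      using submodule_diff[OF A that(1,2)] submodule_diff[OF B that(4,3)] by (metis IntI)
    then show ?thesis using disj diff_eq_zero_iff[OF c(1,2)] by blast
  qed
  define c where "c x = (SOME a. a \<in> A \<and> (\<exists>b\<in>B. x = a \<oplus>\<^bsub>M\<^esub> b))" for x
  have c: "c (a \<oplus>\<^bsub>M\<^esub> b) = a" if "a \<in> A" "b \<in> B" for a b
  proof -
    have "c (a \<oplus>\<^bsub>M\<^esub> b) \<in> A \<and> (\<exists>b'\<in>B. a \<oplus>\<^bsub>M\<^esub> b = c (a \<oplus>\<^bsub>M\<^esub> b) \<oplus>\<^bsub>M\<^esub> b')"
      unfolding c_def by (rule someI[where x = a]) (use that in blast)
    then show ?thesis using uniq[OF that(1) _ that(2)] by metis
  qed
  note S = sum_submodule[OF A B]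
  have ex: "\<exists>a\<in>A. \<exists>b\<in>B. x = a \<oplus>\<^bsub>M\<^esub> b" if "x \<in> A <+>\<^bsub>M\<^esub> B" for x
    using that set_add_mem_iff by blast
  have "restrict (\<lambda>x. f (c x)) (carrier (M\<lparr>carrier := A <+>\<^bsub>M\<^esub> B\<rparr>)) \<in> mhom R (M\<lparr>carrier := A <+>\<^bsub>M\<^esub> B\<rparr>) N"
  proof (rule mhom_restrictI[OF submodule_is_right_module[OF S]])
    show "f (c x) \<in> carrier N" if "x \<in> carrier (M\<lparr>carrier := A <+>\<^bsub>M\<^esub> B\<rparr>)" for x
      using ex[of x] that c mhom_closed[OF f] by auto
  next
    fix x y assume "x \<in> carrier (M\<lparr>carrier := A <+>\<^bsub>M\<^esub> B\<rparr>)" "y \<in> carrier (M\<lparr>carrier := A <+>\<^bsub>M\<^esub> B\<rparr>)"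
    then obtain a b a' b' where ab: "a \<in> A" "b \<in> B" "x = a \<oplus>\<^bsub>M\<^esub> b" "a' \<in> A" "b' \<in> B" "y = a' \<oplus>\<^bsub>M\<^esub> b'"
      using ex[of x] ex[of y] by auto
    then have "x \<oplus>\<^bsub>M\<^esub> y = (a \<oplus>\<^bsub>M\<^esub> a') \<oplus>\<^bsub>M\<^esub> (b \<oplus>\<^bsub>M\<^esub> b')" using memA memB by (simp add: M.a_ac)
    then have "c (x \<oplus>\<^bsub>M\<^esub> y) = a \<oplus>\<^bsub>M\<^esub> a'" using c submodule_add[OF A] submodule_add[OF B] ab by simp
    then show "f (c (x \<oplus>\<^bsub>M\<lparr>carrier := A <+>\<^bsub>M\<^esub> B\<rparr>\<^esub> y)) = f (c x) \<oplus>\<^bsub>N\<^esub> f (c y)"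
      using ab c mhom_add[OF f, of a a'] by simp
  next
    fix r x assume r: "r \<in> carrier R" and "x \<in> carrier (M\<lparr>carrier := A <+>\<^bsub>M\<^esub> B\<rparr>)"
    then obtain a b where ab: "a \<in> A" "b \<in> B" "x = a \<oplus>\<^bsub>M\<^esub> b" using ex[of x] by auto
    then have "r \<odot>\<^bsub>M\<^esub> x = r \<odot>\<^bsub>M\<^esub> a \<oplus>\<^bsub>M\<^esub> r \<odot>\<^bsub>M\<^esub> b" using memA memB r by (simp add: smult_r_distr)
    then have "c (r \<odot>\<^bsub>M\<^esub> x) = r \<odot>\<^bsub>M\<^esub> a" using c submodule_smult[OF A r] submodule_smult[OF B r] ab by simp
    then show "f (c (r \<odot>\<^bsub>M\<lparr>carrier := A <+>\<^bsub>M\<^esub> B\<rparr>\<^esub> x)) = r \<odot>\<^bsub>N\<^esub> f (c x)"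
      using ab c mhom_smult[OF f r, of a] by simp
  qed
  moreover have "\<forall>a\<in>A. \<forall>b\<in>B. restrict (\<lambda>x. f (c x)) (carrier (M\<lparr>carrier := A <+>\<^bsub>M\<^esub> B\<rparr>)) (a \<oplus>\<^bsub>M\<^esub> b) = f a"
  proof (intro ballI)
    fix a b assume "a \<in> A" "b \<in> B"
    moreover from this have "a \<oplus>\<^bsub>M\<^esub> b \<in> A <+>\<^bsub>M\<^esub> B" unfolding set_add_mem_iff by blast
    ultimately show "restrict (\<lambda>x. f (c x)) (carrier (M\<lparr>carrier := A <+>\<^bsub>M\<^esub> B\<rparr>)) (a \<oplus>\<^bsub>M\<^esub> b) = f a"
      using c by simp
  qed
  ultimately show thesis by (rule that)
qed

text \<open>Extending the projection of \<open>A \<oplus> B\<close> onto \<open>A\<close> to an endomorphism gives a map that is neither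
  bijective nor nilpotent unless \<open>A\<close> or \<open>B\<close> vanishes.\<close>

lemma injective_uniform:
  assumes inj: "injective R M" and ind: "indecomposable R M"
    and asc: "chain_cond True R M" and desc: "chain_cond False R M"
    and A: "submodule A R M" and B: "submodule B R M" and disj: "A \<inter> B \<subseteq> {\<zero>\<^bsub>M\<^esub>}"
  shows "A = {\<zero>\<^bsub>M\<^esub>} \<or> B = {\<zero>\<^bsub>M\<^esub>}"
proof -
  have fg: "fg_module R M" using inj by (simp add: injective_def)
  have "restrict (\<lambda>x. x) (carrier (M\<lparr>carrier := A\<rparr>)) \<in> mhom R (M\<lparr>carrier := A\<rparr>) M"
    using submodule_mem[OF A] by (intro mhom_restrictI[OF submodule_is_right_module[OF A]]) simp_all
  then obtain g where g: "g \<in> mhom R (M\<lparr>carrier := A <+>\<^bsub>M\<^esub> B\<rparr>) M"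
    "\<forall>a\<in>A. \<forall>b\<in>B. g (a \<oplus>\<^bsub>M\<^esub> b) = restrict (\<lambda>x. x) (carrier (M\<lparr>carrier := A\<rparr>)) a"
    by (rule sum_projection[OF A B disj right_module_axioms])
  note S = sum_submodule[OF A B]
  obtain h where h: "h \<in> mhom R M M" "\<forall>x\<in>A <+>\<^bsub>M\<^esub> B. h x = g x"
    by (rule injective_extend_submodule[OF inj fg S fg_submodule[OF asc S] g(1)])
  have hA: "h a = a" if a: "a \<in> A" for a
  proof -
    have "g (a \<oplus>\<^bsub>M\<^esub> \<zero>\<^bsub>M\<^esub>) = a" using g(2) a submodule_zero[OF B] by auto
    then show ?thesis using h(2) sum_upper(1)[OF A B] a submodule_mem[OF A a] by auto
  qed
  have hB: "h b = \<zero>\<^bsub>M\<^esub>" if b: "b \<in> B" for b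
  proof -
    have "g (\<zero>\<^bsub>M\<^esub> \<oplus>\<^bsub>M\<^esub> b) = \<zero>\<^bsub>M\<^esub>" using g(2) b submodule_zero[OF A] by auto
    then show ?thesis using h(2) sum_upper(2)[OF A B] b submodule_mem[OF B b] by auto
  qed
  from fitting[OF ind asc desc h(1)] show ?thesis
  proof
    assume bij: "bij_betw h (carrier M) (carrier M)"
    have "h \<zero>\<^bsub>M\<^esub> = \<zero>\<^bsub>M\<^esub>" using hB submodule_zero[OF B] by blast
    then have "b = \<zero>\<^bsub>M\<^esub>" if "b \<in> B" for b
      using hB[OF that] bij submodule_mem[OF B that] M.zero_closed
      unfolding bij_betw_def by (metis inj_onD)
    then have "B = {\<zero>\<^bsub>M\<^esub>}" using submodule_zero[OF B] by blast
    then show ?thesis ..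
  next
    assume "\<exists>n. \<forall>x\<in>carrier M. (h ^^ n) x = \<zero>\<^bsub>M\<^esub>"
    then obtain n where n: "\<forall>x\<in>carrier M. (h ^^ n) x = \<zero>\<^bsub>M\<^esub>" ..
    have "(h ^^ k) a = a" if "a \<in> A" for a k using hA[OF that] by (induction k) simp_all
    then have "a = \<zero>\<^bsub>M\<^esub>" if "a \<in> A" for a using n submodule_mem[OF A that] that by metis
    then have "A = {\<zero>\<^bsub>M\<^esub>}" using submodule_zero[OF A] by blast
    then show ?thesis ..
  qed
qed

end

text \<open>Such an S is the whole socle, at once simple and essential. It is kept as a set and
  turned into \<open>module_soc\<close> by \<open>soc_essential_simple\<close>.\<close>

definition essential_simple :: "('a, 'e) ring_scheme \<Rightarrow> ('a, 'm) module \<Rightarrow> 'm set \<Rightarrow> bool" where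
  "essential_simple R M S \<longleftrightarrow> simple_submodule R M S \<and>
     (\<forall>N. submodule N R M \<longrightarrow> N \<noteq> {\<zero>\<^bsub>M\<^esub>} \<longrightarrow> S \<subseteq> N)"

context right_module
begin

text \<open>A minimal nonzero submodule meets every nonzero submodule by uniformity, hence is
  contained in it.\<close>

lemma essential_simple_exists:
  assumes inj: "injective R M" and ind: "indecomposable R M"
    and asc: "chain_cond True R M" and desc: "chain_cond False R M"
  obtains S where "essential_simple R M S"
proof -
  define F where "F = {N. submodule N R M \<and> N \<noteq> {\<zero>\<^bsub>M\<^esub>}}"
  have "carrier M \<in> F" using ind carrier_submodule by (simp add: F_def indecomposable_def)
  then have "F \<noteq> {}" by auto
  moreover have "submodule N R M" if "N \<in> F" for N using that by (simp add: F_def)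
  ultimately obtain S where S: "S \<in> F" "\<forall>K\<in>F. K \<subseteq> S \<longrightarrow> K = S"
    by (rule minimal_submodule_exists[OF desc])
  have simple: "simple_submodule R M S"
    unfolding simple_submodule_def using S by (auto simp: F_def)
  have "S \<subseteq> N" if N: "submodule N R M" "N \<noteq> {\<zero>\<^bsub>M\<^esub>}" for N
  proof -
    have "\<not> S \<inter> N \<subseteq> {\<zero>\<^bsub>M\<^esub>}"
      using injective_uniform[OF inj ind asc desc _ N(1), of S] S(1) N(2) by (auto simp: F_def)
    moreover have "submodule (S \<inter> N) R M" using S(1) N(1) Int_submodule by (simp add: F_def)
    ultimately have "S \<inter> N = S" using S(2) by (auto simp: F_def)
    then show ?thesis by blast
  qed
  then show thesis using simple by (intro that[of S]) (simp add: essential_simple_def)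
qed

lemma essential_simple_submodule: "essential_simple R M S \<Longrightarrow> submodule S R M"
  by (simp add: essential_simple_def simple_submodule_def)

lemma soc_essential_simple:
  assumes S: "essential_simple R M S" shows "module_soc R M = M\<lparr>carrier := S\<rparr>"
proof -
  have "\<Inter>{N. submodule N R M \<and> (\<forall>S. simple_submodule R M S \<longrightarrow> S \<subseteq> N)} = S"
  proof
    have "T \<subseteq> S" if T: "simple_submodule R M T" for T
    proof -
      have "S \<subseteq> T" using S T by (simp add: essential_simple_def simple_submodule_def)
      then have "S = T" using S T unfolding essential_simple_def simple_submodule_def by blast
      then show ?thesis by simp
    qed
    then show "\<Inter>{N. submodule N R M \<and> (\<forall>S. simple_submodule R M S \<longrightarrow> S \<subseteq> N)} \<subseteq> S"
      using essential_simple_submodule[OF S] by blast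
    show "S \<subseteq> \<Inter>{N. submodule N R M \<and> (\<forall>S. simple_submodule R M S \<longrightarrow> S \<subseteq> N)}"
      using S by (auto simp: essential_simple_def)
  qed
  then show ?thesis by (simp add: module_soc_def)
qed

lemma essential_simple_nonzero:
  assumes "essential_simple R M S"
  obtains x where "x \<in> S" "x \<noteq> \<zero>\<^bsub>M\<^esub>"
  using assms submodule_zero[OF essential_simple_submodule[OF assms]]
  unfolding essential_simple_def simple_submodule_def by blast

lemma essential_simple_generated:
  assumes S: "essential_simple R M S" and x: "x \<in> S" "x \<noteq> \<zero>\<^bsub>M\<^esub>"
  shows "cyclic_submodule R M x = S"
proof -
  note sub = essential_simple_submodule[OF S]
  have xM: "x \<in> carrier M" using submodule_mem[OF sub x(1)] .
  have "cyclic_submodule R M x \<noteq> {\<zero>\<^bsub>M\<^esub>}" using cyclic_self[OF xM] x(2) by blast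
  then show ?thesis
    using S cyclic_is_submodule[OF xM] cyclic_least[OF sub x(1)]
    unfolding essential_simple_def by blast
qed

end

text \<open>Carries the socle of P to \<nu> Q, where \<alpha> takes its values.\<close>

lemma essential_simple_iso:
  assumes M: "right_module R M" and N: "right_module R N" and f: "f \<in> miso R M N"
    and S: "essential_simple R M S"
  shows "essential_simple R N (f ` S)"
proof -
  have hom: "f \<in> mhom R M N" and bij: "bij_betw f (carrier M) (carrier N)"
    using f by (auto simp: miso_def)
  interpret f: module_hom R M N f by (rule module_homI[OF M N hom])
  note sub = f.M.essential_simple_submodule[OF S]
  have img: "f ` {x \<in> carrier M. f x \<in> K} = K" if "submodule K R N" for K
    using bij submodule_subset[OF that] by (fastforce simp: bij_betw_def)
  have nz: "{x \<in> carrier M. f x \<in> K} \<noteq> {\<zero>\<^bsub>M\<^esub>}" if "submodule K R N" "K \<noteq> {\<zero>\<^bsub>N\<^esub>}" for K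
    using img[OF that(1)] that(2) f.zero by force
  have ess: "f ` S \<subseteq> K" if K: "submodule K R N" "K \<noteq> {\<zero>\<^bsub>N\<^esub>}" for K
  proof -
    have "S \<subseteq> {x \<in> carrier M. f x \<in> K}"
      using S f.vimage_submodule[OF K(1)] nz[OF K] unfolding essential_simple_def by blast
    then show ?thesis by blast
  qed
  obtain x where x: "x \<in> S" "x \<noteq> \<zero>\<^bsub>M\<^esub>" by (rule f.M.essential_simple_nonzero[OF S])
  have "f x \<noteq> \<zero>\<^bsub>N\<^esub>"
    using x submodule_mem[OF sub x(1)] bij f.zero f.M.M.zero_closed
    unfolding bij_betw_def by (metis inj_onD)
  then have "f ` S \<noteq> {\<zero>\<^bsub>N\<^esub>}" using x(1) by blast
  then show ?thesis
    using f.image_submodule[OF sub] ess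
    unfolding essential_simple_def simple_submodule_def by blast
qed

section \<open>Modules of the form \<open>e\<Lambda>\<close>\<close>

text \<open>The module \<open>Q\<close> is isomorphic to \<open>e\<Lambda>\<close>, with \<open>q\<close> corresponding to \<open>e\<close>.\<close>

locale idempotent_generated = right_module R Q
  for R :: "('a, 'e) ring_scheme" (structure) and Q :: "('a, 'm) module" (structure) +
  fixes e :: 'a and q :: 'm
  assumes e: "e \<in> carrier R" "e \<otimes>\<^bsub>R\<^esub> e = e"
    and q: "q \<in> carrier Q" "e \<odot>\<^bsub>Q\<^esub> q = q"
    and gen: "\<And>x. x \<in> carrier Q \<Longrightarrow> \<exists>r\<in>carrier R. x = r \<odot>\<^bsub>Q\<^esub> q"
    and ann: "\<And>r. \<lbrakk>r \<in> carrier R; r \<odot>\<^bsub>Q\<^esub> q = \<zero>\<^bsub>Q\<^esub>\<rbrakk> \<Longrightarrow> e \<otimes>\<^bsub>R\<^esub> r = \<zero>\<^bsub>R\<^esub>"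
begin

lemma carrier_cyclic: "carrier Q = cyclic_submodule R Q q"
  using gen q(1) by (auto simp: cyclic_submodule_def)

text \<open>Homomorphisms from e\<Lambda> to N correspond to the elements z with z e = z: what kills
  q is annihilated by e on the left, hence kills z = z e. Every map out of Q below is built this
  way.\<close>

lemma hom_from:
  assumes N: "right_module R N" and z: "z \<in> carrier N" "e \<odot>\<^bsub>N\<^esub> z = z"
  obtains g where "g \<in> mhom R Q N" "\<forall>r\<in>carrier R. g (r \<odot>\<^bsub>Q\<^esub> q) = r \<odot>\<^bsub>N\<^esub> z"
proof -
  interpret N: right_module R N by fact
  have *: "r \<odot>\<^bsub>N\<^esub> z = \<zero>\<^bsub>N\<^esub>" if "r \<in> carrier R" "r \<odot>\<^bsub>Q\<^esub> q = \<zero>\<^bsub>Q\<^esub>" for r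
  proof -
    have "r \<odot>\<^bsub>N\<^esub> (e \<odot>\<^bsub>N\<^esub> z) = (e \<otimes>\<^bsub>R\<^esub> r) \<odot>\<^bsub>N\<^esub> z"
      using that(1) e(1) z(1) by (simp add: N.smult_assoc)
    then show ?thesis using ann[OF that] z by simp
  qed
  obtain g where "g \<in> mhom R (Q\<lparr>carrier := cyclic_submodule R Q q\<rparr>) N"
    "\<forall>r\<in>carrier R. g (r \<odot>\<^bsub>Q\<^esub> q) = r \<odot>\<^bsub>N\<^esub> z"
    by (rule cyclic_hom[OF right_module_axioms N q(1) z(1) *])
  then show thesis by (intro that[of g]) (simp_all flip: carrier_cyclic)
qed

lemma fg: "fg_module R Q"
  using fg_cyclic[OF q(1)] by (simp flip: carrier_cyclic)

lemma hom_eqI: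
  assumes N: "right_module R N" "f \<in> mhom R Q N" "g \<in> mhom R Q N" "f q = g q"
  shows "f = g"
proof (rule mhom_ext[OF assms(2,3)])
  fix x assume "x \<in> carrier Q"
  then obtain r where "r \<in> carrier R" "x = r \<odot>\<^bsub>Q\<^esub> q" using gen by blast
  then show "f x = g x" using mhom_smult[OF assms(2) _ q(1)] mhom_smult[OF assms(3) _ q(1)] assms(4) by simp
qed

text \<open>A preimage x of g q is replaced by x e, which still lies over g q because q e = q, and q
  may be sent there.\<close>

lemma projective: "projective R Q"
  unfolding projective_def
proof (intro conjI fg allI impI ballI)
  fix X Y :: "('a, 'a small) module" and f g
  assume XY: "fg_module R X \<and> fg_module R Y" and f: "f \<in> mhom R X Y" and g: "g \<in> mhom R Q Y"
    and onto: "f ` carrier X = carrier Y"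
  interpret X: right_module R X using XY fg_right_module by blast
  interpret Y: right_module R Y using XY fg_right_module by blast
  have "g q \<in> f ` carrier X" using onto mhom_closed[OF g q(1)] by simp
  then obtain x where x: "x \<in> carrier X" "g q = f x" by blast
  have "e \<odot>\<^bsub>X\<^esub> (e \<odot>\<^bsub>X\<^esub> x) = e \<odot>\<^bsub>X\<^esub> x" using e x(1) by (simp flip: X.smult_assoc)
  then obtain h where h: "h \<in> mhom R Q X" "\<forall>r\<in>carrier R. h (r \<odot>\<^bsub>Q\<^esub> q) = r \<odot>\<^bsub>X\<^esub> (e \<odot>\<^bsub>X\<^esub> x)"
    by (rule hom_from[OF X.right_module_axioms X.smult_closed[OF e(1) x(1)]])
  have "h q = e \<odot>\<^bsub>X\<^esub> (e \<odot>\<^bsub>X\<^esub> x)" using h(2) e(1) q(2) by metis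
  then have hq: "h q = e \<odot>\<^bsub>X\<^esub> x" using e x(1) by (simp flip: X.smult_assoc)
  have "f (h q) = e \<odot>\<^bsub>Y\<^esub> g q" using mhom_smult[OF f e(1) x(1)] x(2) hq by simp
  also have "\<dots> = g q" using mhom_smult[OF g e(1) q(1)] q(2) by simp
  finally have "compose (carrier Q) f h = g"
    using q(1)
    by (intro hom_eqI[OF Y.right_module_axioms mhom_compose[OF right_module_axioms h(1) f] g])
      (simp add: compose_eq)
  then show "\<exists>h\<in>mhom R Q X. compose (carrier Q) f h = g" using h(1) by blast
qed

lemma submodule_with_generator:
  assumes "submodule N R Q" "q \<in> N" shows "N = carrier Q"
  using cyclic_least[OF assms] submodule_subset[OF assms(1)] carrier_cyclic by auto

text \<open>Writing \<open>q\<close> as a sum of elements of two maximal submodules gives an endomorphism with image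
  in the second one that is the identity modulo the first one.\<close>

lemma unique_maximal:
  assumes ind: "indecomposable R Q"
    and asc: "chain_cond True R Q" and desc: "chain_cond False R Q"
    and M: "maximal_submodule R Q M" "maximal_submodule R Q M'"
  shows "M = M'"
proof (rule ccontr)
  assume neq: "M \<noteq> M'"
  have sub: "submodule M R Q" "submodule M' R Q" using M by (simp_all add: maximal_submodule_def)
  have qM: "q \<notin> M" "q \<notin> M'"
    using submodule_with_generator[OF sub(1)] submodule_with_generator[OF sub(2)] M
    by (auto simp: maximal_submodule_def)
  have "M <+>\<^bsub>Q\<^esub> M' = carrier Q"
    using M sum_submodule[OF sub] sum_upper[OF sub] neq unfolding maximal_submodule_def by blast
  then have "q \<in> M <+>\<^bsub>Q\<^esub> M'" using q(1) by simp
  then obtain a b where ab: "a \<in> M" "b \<in> M'" "q = a \<oplus>\<^bsub>Q\<^esub> b" unfolding set_add_mem_iff by blast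
  have abQ: "a \<in> carrier Q" "b \<in> carrier Q"
    using submodule_mem[OF sub(1) ab(1)] submodule_mem[OF sub(2) ab(2)] by auto
  \<comment> \<open>Multiplying by e turns b into an admissible image of q and leaves the equation
    for q intact.\<close>
  define b' where "b' = e \<odot>\<^bsub>Q\<^esub> b"
  define a' where "a' = e \<odot>\<^bsub>Q\<^esub> a"
  have b': "b' \<in> M'" "b' \<in> carrier Q" and a': "a' \<in> M" "a' \<in> carrier Q"
    using submodule_smult[OF sub(1) e(1) ab(1)] submodule_smult[OF sub(2) e(1) ab(2)] abQ e(1)
    by (simp_all add: a'_def b'_def)
  have "e \<odot>\<^bsub>Q\<^esub> q = a' \<oplus>\<^bsub>Q\<^esub> b'" unfolding a'_def b'_def ab(3) using abQ e(1) by (rule smult_r_distr[rotated])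
  then have q': "q = a' \<oplus>\<^bsub>Q\<^esub> b'" using q(2) by simp
  have "e \<odot>\<^bsub>Q\<^esub> b' = b'" using e abQ by (simp add: b'_def flip: smult_assoc)
  then obtain h where h: "h \<in> mhom R Q Q" "\<forall>r\<in>carrier R. h (r \<odot>\<^bsub>Q\<^esub> q) = r \<odot>\<^bsub>Q\<^esub> b'"
    by (rule hom_from[OF right_module_axioms b'(2)])
  have hM': "h x \<in> M'" if x: "x \<in> carrier Q" for x
  proof -
    obtain r where "r \<in> carrier R" "x = r \<odot>\<^bsub>Q\<^esub> q" using gen[OF x] by blast
    then show ?thesis using h(2) submodule_smult[OF sub(2) _ b'(1)] by simp
  qed
  have hM: "\<exists>m\<in>M. x = m \<oplus>\<^bsub>Q\<^esub> h x" if x: "x \<in> carrier Q" for x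
  proof -
    obtain r where r: "r \<in> carrier R" "x = r \<odot>\<^bsub>Q\<^esub> q" using gen[OF x] by blast
    then have "x = r \<odot>\<^bsub>Q\<^esub> a' \<oplus>\<^bsub>Q\<^esub> r \<odot>\<^bsub>Q\<^esub> b'"
      using smult_r_distr[OF r(1) a'(2) b'(2)] q' by simp
    moreover have "r \<odot>\<^bsub>Q\<^esub> b' = h x" using h(2) r by simp
    ultimately show ?thesis using submodule_smult[OF sub(1) r(1) a'(1)] by metis
  qed
  from fitting[OF ind asc desc h(1)] show False
  proof
    assume "bij_betw h (carrier Q) (carrier Q)"
    then have "q \<in> h ` carrier Q" using q(1) by (simp add: bij_betw_def)
    then show False using hM' qM(2) by blast
  next
    assume "\<exists>n. \<forall>x\<in>carrier Q. (h ^^ n) x = \<zero>\<^bsub>Q\<^esub>"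
    then obtain n where n: "(h ^^ n) q = \<zero>\<^bsub>Q\<^esub>" using q(1) by blast
    \<comment> \<open>Every power of h is still the identity modulo M, so nilpotency would put q
      into M.\<close>
    have "(h ^^ k) q \<in> carrier Q \<and> (\<exists>m\<in>M. q = m \<oplus>\<^bsub>Q\<^esub> (h ^^ k) q)" for k
    proof (induction k)
      case 0
      show ?case using q(1) submodule_zero[OF sub(1)] by (auto intro!: bexI[of _ "\<zero>\<^bsub>Q\<^esub>"])
    next
      case (Suc k)
      then obtain m where m: "m \<in> M" "q = m \<oplus>\<^bsub>Q\<^esub> (h ^^ k) q" and cl: "(h ^^ k) q \<in> carrier Q" by blast
      obtain m' where m': "m' \<in> M" "(h ^^ k) q = m' \<oplus>\<^bsub>Q\<^esub> h ((h ^^ k) q)" using hM[OF cl] by blast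
      have cl': "h ((h ^^ k) q) \<in> carrier Q" using mhom_closed[OF h(1) cl] .
      have "q = m \<oplus>\<^bsub>Q\<^esub> (m' \<oplus>\<^bsub>Q\<^esub> h ((h ^^ k) q))" using m(2) m'(2) by metis
      also have "\<dots> = (m \<oplus>\<^bsub>Q\<^esub> m') \<oplus>\<^bsub>Q\<^esub> h ((h ^^ k) q)"
        using submodule_mem[OF sub(1) m(1)] submodule_mem[OF sub(1) m'(1)] cl' by (simp add: M.a_assoc)
      finally show ?case using submodule_add[OF sub(1) m(1) m'(1)] cl' by auto
    qed
    then obtain m where "m \<in> M" "q = m \<oplus>\<^bsub>Q\<^esub> \<zero>\<^bsub>Q\<^esub>" using n by metis
    then show False using qM(1) submodule_mem[OF sub(1)] by simp
  qed
qed

text \<open>A proper submodule avoids q, hence lies in a maximal one, and there is just one of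
  these; it is therefore the radical.\<close>

lemma radical_maximal:
  assumes ind: "indecomposable R Q"
    and asc: "chain_cond True R Q" and desc: "chain_cond False R Q"
  shows "maximal_submodule R Q (module_rad R Q)"
    and "\<And>N. \<lbrakk>submodule N R Q; N \<noteq> carrier Q\<rbrakk> \<Longrightarrow> N \<subseteq> module_rad R Q"
    and "\<And>N. maximal_submodule R Q N \<Longrightarrow> N = module_rad R Q"
proof -
  have ex: "\<exists>K. maximal_submodule R Q K \<and> N \<subseteq> K" if N: "submodule N R Q" "N \<noteq> carrier Q" for N
  proof -
    have "q \<notin> N" using submodule_with_generator N by blast
    then obtain K where K: "submodule K R Q" "N \<subseteq> K" "q \<notin> K"
      "\<forall>L. submodule L R Q \<longrightarrow> K \<subseteq> L \<longrightarrow> q \<notin> L \<longrightarrow> L = K"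
      by (rule maximal_avoiding[OF N(1) q(1)])
    have "L = K \<or> L = carrier Q" if "submodule L R Q" "K \<subseteq> L" for L
      using K(4) that submodule_with_generator by blast
    then show ?thesis
      using K q(1) unfolding maximal_submodule_def by (intro exI[of _ K]) auto
  qed
  have "{\<zero>\<^bsub>Q\<^esub>} \<noteq> carrier Q" using ind by (auto simp: indecomposable_def)
  then obtain K where K: "maximal_submodule R Q K" using ex[OF zero_submodule] by blast
  have uniq: "L = K" if "maximal_submodule R Q L" for L
    by (rule unique_maximal[OF ind asc desc that K])
  have "K \<subseteq> carrier Q" using K submodule_subset by (auto simp: maximal_submodule_def)
  then have rad: "module_rad R Q = K" using K uniq unfolding module_rad_def by blast
  show "maximal_submodule R Q (module_rad R Q)" using K rad by simp
  show "N \<subseteq> module_rad R Q" if "submodule N R Q" "N \<noteq> carrier Q" for N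
    using ex[OF that] uniq rad by blast
  show "N = module_rad R Q" if "maximal_submodule R Q N" for N using uniq[OF that] rad by simp
qed

text \<open>If \<open>s = se\<close> generates a simple submodule, then \<open>q \<mapsto> s\<close> identifies the top of \<open>Q\<close> with it.\<close>

lemma top_iso:
  assumes ind: "indecomposable R Q"
    and asc: "chain_cond True R Q" and desc: "chain_cond False R Q"
    and N: "right_module R N" and S: "essential_simple R N S"
    and s: "s \<in> S" "s \<noteq> \<zero>\<^bsub>N\<^esub>" "e \<odot>\<^bsub>N\<^esub> s = s"
  shows "isomorphic R (module_top R Q) (module_soc R N)"
proof -
  interpret N: right_module R N by fact
  note sub = N.essential_simple_submodule[OF S]
  note soc = N.soc_essential_simple[OF S]
  have sN: "s \<in> carrier N" using submodule_mem[OF sub s(1)] .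
  obtain g where g: "g \<in> mhom R Q N" "\<forall>r\<in>carrier R. g (r \<odot>\<^bsub>Q\<^esub> q) = r \<odot>\<^bsub>N\<^esub> s"
    by (rule hom_from[OF N sN s(3)])
  interpret g: module_hom R Q N g by (rule module_homI[OF right_module_axioms N g(1)])
  have "g ` cyclic_submodule R Q q = cyclic_submodule R N s"
    unfolding cyclic_submodule_def image_image by (rule image_cong) (simp_all only: refl g(2)[rule_format])
  then have img: "g ` carrier Q = S"
    by (simp only: N.essential_simple_generated[OF S s(1,2)] flip: carrier_cyclic)
  \<comment> \<open>The map g sends Q onto the simple S, so its kernel is maximal and must be the
    radical.\<close>
  have "maximal_submodule R Q (mker Q N g)"
    unfolding maximal_submodule_def
  proof (intro conjI allI impI g.ker_submodule)
    have "g q = s" using bspec[OF g(2) R.one_closed] q(1) sN by simp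
    then show "mker Q N g \<noteq> carrier Q" using s(2) q(1) by (auto simp: mker_def)
    fix K assume "submodule K R Q \<and> mker Q N g \<subseteq> K"
    then have K: "submodule K R Q" "mker Q N g \<subseteq> K" by simp_all
    have gK: "submodule (g ` K) R N" by (rule g.image_submodule[OF K(1)])
    have KQ: "x \<in> carrier Q" if "x \<in> K" for x by (rule submodule_mem[OF K(1) that])
    \<comment> \<open>K contains the kernel of g, so membership in K can be tested on
      images.\<close>
    have up: "x \<in> K" if x: "x \<in> carrier Q" "g x \<in> g ` K" for x
    proof -
      obtain y where y: "y \<in> K" "g x = g y" using x(2) by blast
      have "x \<ominus>\<^bsub>Q\<^esub> y \<in> mker Q N g"
        using x(1) KQ[OF y(1)] y(2) N.diff_eq_zero_iff by (simp add: mker_def)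
      then have "(x \<ominus>\<^bsub>Q\<^esub> y) \<oplus>\<^bsub>Q\<^esub> y \<in> K" using submodule_add[OF K(1) _ y(1)] K(2) by blast
      then show ?thesis using diff_add_cancel[OF x(1) KQ[OF y(1)]] by simp
    qed
    show "K = mker Q N g \<or> K = carrier Q"
    proof (cases "g ` K = {\<zero>\<^bsub>N\<^esub>}")
      case True
      then have "K \<subseteq> mker Q N g" using KQ by (auto simp: mker_def)
      then show ?thesis using K(2) by blast
    next
      case False
      then have "S \<subseteq> g ` K" using S gK unfolding essential_simple_def by blast
      then have "carrier Q \<subseteq> K" using up img by blast
      then show ?thesis using KQ by blast
    qed
  qed
  then have ker: "mker Q N g = module_rad R Q" by (rule radical_maximal(3)[OF ind asc desc])
  let ?r = "module_rad R Q"
  have rs: "submodule ?r R Q" using g.ker_submodule ker by simp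
  have eq: "?r +>\<^bsub>Q\<^esub> x = ?r +>\<^bsub>Q\<^esub> y \<longleftrightarrow> g x = g y" if "x \<in> carrier Q" "y \<in> carrier Q" for x y
    using coset_eq_iff[OF rs that] that N.diff_eq_zero_iff by (simp add: mker_def flip: ker)
  \<comment> \<open>The map induced by g on the top, through chosen representatives;
    \<open>eq\<close> gives both independence of the choice and injectivity.\<close>
  define t where "t X = g (SOME x. x \<in> carrier Q \<and> X = ?r +>\<^bsub>Q\<^esub> x)" for X
  have t: "t (?r +>\<^bsub>Q\<^esub> x) = g x" if x: "x \<in> carrier Q" for x
  proof -
    have "\<exists>y. y \<in> carrier Q \<and> ?r +>\<^bsub>Q\<^esub> x = ?r +>\<^bsub>Q\<^esub> y" using x by blast
    from someI_ex[OF this] show ?thesis using eq[OF x] unfolding t_def by metis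
  qed
  have top: "module_top R Q = quotient_module Q ?r" by (simp add: module_top_def)
  have "restrict t (carrier (module_top R Q)) \<in> mhom R (module_top R Q) (module_soc R N)"
    unfolding top
  proof (rule mhom_restrictI[OF quotient_right_module[OF rs]])
    fix X assume "X \<in> carrier (quotient_module Q ?r)"
    then obtain x where x: "x \<in> carrier Q" "X = ?r +>\<^bsub>Q\<^esub> x" by (auto simp: quotient_carrier)
    then show "t X \<in> carrier (module_soc R N)" using t img by (auto simp: soc)
    fix r assume "r \<in> carrier R"
    then show "t (r \<odot>\<^bsub>quotient_module Q ?r\<^esub> X) = r \<odot>\<^bsub>module_soc R N\<^esub> t X"
      using x t by (simp add: quotient_smult[OF rs] soc)
  next
    fix X Y assume "X \<in> carrier (quotient_module Q ?r)" "Y \<in> carrier (quotient_module Q ?r)"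
    then obtain x y where "x \<in> carrier Q" "X = ?r +>\<^bsub>Q\<^esub> x" "y \<in> carrier Q" "Y = ?r +>\<^bsub>Q\<^esub> y"
      by (auto simp: quotient_carrier)
    then show "t (X \<oplus>\<^bsub>quotient_module Q ?r\<^esub> Y) = t X \<oplus>\<^bsub>module_soc R N\<^esub> t Y"
      using t by (simp add: quotient_add[OF rs] soc)
  qed
  moreover have "bij_betw (restrict t (carrier (module_top R Q))) (carrier (module_top R Q))
      (carrier (module_soc R N))"
  proof -
    have "inj_on t (carrier (quotient_module Q ?r))"
    proof (rule inj_onI)
      fix X Y assume XY: "X \<in> carrier (quotient_module Q ?r)" "Y \<in> carrier (quotient_module Q ?r)" "t X = t Y"
      then obtain x y where "x \<in> carrier Q" "X = ?r +>\<^bsub>Q\<^esub> x" "y \<in> carrier Q" "Y = ?r +>\<^bsub>Q\<^esub> y"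
        by (auto simp: quotient_carrier)
      then show "X = Y" using XY(3) t[of x] t[of y] eq[of x y] by simp
    qed
    moreover have "t ` carrier (quotient_module Q ?r) = S"
      using img t by (auto simp: quotient_carrier image_iff)
    ultimately show ?thesis by (simp add: top soc bij_betw_def inj_on_def)
  qed
  ultimately show ?thesis unfolding isomorphic_def miso_def by blast
qed

end

section \<open>Duality over an Artin algebra\<close>

lemma restrict_scalars_simps [simp]:
  "carrier (restrict_scalars \<phi> M) = carrier M" "\<zero>\<^bsub>restrict_scalars \<phi> M\<^esub> = \<zero>\<^bsub>M\<^esub>"
  "x \<oplus>\<^bsub>restrict_scalars \<phi> M\<^esub> y = x \<oplus>\<^bsub>M\<^esub> y" "r \<odot>\<^bsub>restrict_scalars \<phi> M\<^esub> x = \<phi> r \<odot>\<^bsub>M\<^esub> x"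
  by (simp_all add: restrict_scalars_def)

lemma abelian_group_restrict_scalars: "abelian_group M \<Longrightarrow> abelian_group (restrict_scalars \<phi> M)"
proof -
  assume "abelian_group M"
  then interpret M: abelian_group M .
  show ?thesis
  proof (rule abelian_groupI)
    fix x assume "x \<in> carrier (restrict_scalars \<phi> M)"
    then show "\<exists>y\<in>carrier (restrict_scalars \<phi> M). y \<oplus>\<^bsub>restrict_scalars \<phi> M\<^esub> x = \<zero>\<^bsub>restrict_scalars \<phi> M\<^esub>"
      by (intro bexI[of _ "\<ominus>\<^bsub>M\<^esub> x"]) (simp_all add: M.l_neg)
  qed (simp_all add: M.a_ac)
qed

lemma hom_regular_simps [simp]:
  "carrier (hom_regular \<Lambda> M) = mhom \<Lambda> M (regular_module \<Lambda>)"
  "\<zero>\<^bsub>hom_regular \<Lambda> M\<^esub> = (\<lambda>x\<in>carrier M. \<zero>\<^bsub>\<Lambda>\<^esub>)"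
  "f \<oplus>\<^bsub>hom_regular \<Lambda> M\<^esub> g = (\<lambda>x\<in>carrier M. f x \<oplus>\<^bsub>\<Lambda>\<^esub> g x)"
  "a \<odot>\<^bsub>hom_regular \<Lambda> M\<^esub> f = (\<lambda>x\<in>carrier M. a \<otimes>\<^bsub>\<Lambda>\<^esub> f x)"
  by (simp_all add: hom_regular_def)

lemma dual_module_simps [simp]:
  "carrier (dual_module R \<phi> J M) = mhom R (restrict_scalars \<phi> M) J"
  "\<zero>\<^bsub>dual_module R \<phi> J M\<^esub> = (\<lambda>x\<in>carrier M. \<zero>\<^bsub>J\<^esub>)"
  "u \<oplus>\<^bsub>dual_module R \<phi> J M\<^esub> v = (\<lambda>x\<in>carrier M. u x \<oplus>\<^bsub>J\<^esub> v x)"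
  "a \<odot>\<^bsub>dual_module R \<phi> J M\<^esub> u = (\<lambda>x\<in>carrier M. u (a \<odot>\<^bsub>M\<^esub> x))"
  by (simp_all add: dual_module_def)

section \<open>Left modules and restriction of scalars to \<open>R\<close>\<close>

definition left_regular :: "('a, 'f) ring_scheme \<Rightarrow> ('a, 'a) module" where
  "left_regular \<Lambda> = \<lparr>carrier = carrier \<Lambda>, mult = mult \<Lambda>, one = one \<Lambda>, zero = zero \<Lambda>, add = add \<Lambda>,
     smult = (\<lambda>a x. a \<otimes>\<^bsub>\<Lambda>\<^esub> x)\<rparr>"

lemma left_regular_simps [simp]:
  "carrier (left_regular \<Lambda>) = carrier \<Lambda>" "\<zero>\<^bsub>left_regular \<Lambda>\<^esub> = \<zero>\<^bsub>\<Lambda>\<^esub>"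
  "x \<oplus>\<^bsub>left_regular \<Lambda>\<^esub> y = x \<oplus>\<^bsub>\<Lambda>\<^esub> y" "a \<odot>\<^bsub>left_regular \<Lambda>\<^esub> x = a \<otimes>\<^bsub>\<Lambda>\<^esub> x"
  by (simp_all add: left_regular_def)

text \<open>Differs from \<open>right_module\<close> in \<open>smult_assoc\<close> only. It covers
  \<Lambda> on its left side and the values of Hom(-, \<Lambda>).\<close>

locale left_module = R?: ring R + M?: abelian_group M
  for R :: "('a, 'e) ring_scheme" (structure) and M :: "('a, 'm) module" (structure) +
  assumes smult_closed [simp, intro]:
      "\<lbrakk>r \<in> carrier R; x \<in> carrier M\<rbrakk> \<Longrightarrow> r \<odot>\<^bsub>M\<^esub> x \<in> carrier M"
    and smult_l_distr:
      "\<lbrakk>r \<in> carrier R; s \<in> carrier R; x \<in> carrier M\<rbrakk>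
        \<Longrightarrow> (r \<oplus>\<^bsub>R\<^esub> s) \<odot>\<^bsub>M\<^esub> x = r \<odot>\<^bsub>M\<^esub> x \<oplus>\<^bsub>M\<^esub> s \<odot>\<^bsub>M\<^esub> x"
    and smult_r_distr:
      "\<lbrakk>r \<in> carrier R; x \<in> carrier M; y \<in> carrier M\<rbrakk>
        \<Longrightarrow> r \<odot>\<^bsub>M\<^esub> (x \<oplus>\<^bsub>M\<^esub> y) = r \<odot>\<^bsub>M\<^esub> x \<oplus>\<^bsub>M\<^esub> r \<odot>\<^bsub>M\<^esub> y"
    and smult_assoc:
      "\<lbrakk>r \<in> carrier R; s \<in> carrier R; x \<in> carrier M\<rbrakk>
        \<Longrightarrow> (r \<otimes>\<^bsub>R\<^esub> s) \<odot>\<^bsub>M\<^esub> x = r \<odot>\<^bsub>M\<^esub> (s \<odot>\<^bsub>M\<^esub> x)"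
    and smult_one [simp]:
      "x \<in> carrier M \<Longrightarrow> \<one>\<^bsub>R\<^esub> \<odot>\<^bsub>M\<^esub> x = x"

lemma (in ring) left_regular_module: "left_module R (left_regular R)"
proof -
  have "abelian_group (left_regular R)"
  proof (rule abelian_groupI)
    fix x assume "x \<in> carrier (left_regular R)"
    then show "\<exists>y\<in>carrier (left_regular R). y \<oplus>\<^bsub>left_regular R\<^esub> x = \<zero>\<^bsub>left_regular R\<^esub>"
      by (intro bexI[of _ "\<ominus>\<^bsub>R\<^esub> x"]) (simp_all add: l_neg)
  qed (simp_all add: a_ac)
  then show ?thesis
    by (intro left_module.intro left_module_axioms.intro ring_axioms)
      (simp_all add: l_distr r_distr m_assoc)
qed

lemma hom_regular_left_module:
  assumes "right_module \<Lambda> Q" shows "left_module \<Lambda> (hom_regular \<Lambda> Q)"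
proof -
  interpret Q: right_module \<Lambda> Q by fact
  note Reg = Q.R.regular_right_module
  have cl: "(\<lambda>x\<in>carrier Q. a \<otimes>\<^bsub>\<Lambda>\<^esub> f x) \<in> mhom \<Lambda> Q (regular_module \<Lambda>)"
    if "a \<in> carrier \<Lambda>" "f \<in> mhom \<Lambda> Q (regular_module \<Lambda>)" for a f
    using mhom_closed[OF that(2)] mhom_add[OF that(2)] mhom_smult[OF that(2)] that(1)
    by (intro mhom_restrictI[OF assms]) (simp_all add: Q.R.r_distr Q.R.m_assoc)
  have clo: "f x \<in> carrier \<Lambda>" if "f \<in> mhom \<Lambda> Q (regular_module \<Lambda>)" "x \<in> carrier Q" for f x
    using mhom_closed[OF that] by simp
  have "abelian_group (hom_regular \<Lambda> Q)"
    by (rule pointwise_abelian_group[OF assms Reg]) simp_all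
  then show ?thesis
  proof (intro left_module.intro left_module_axioms.intro Q.R.ring_axioms)
    show "\<one>\<^bsub>\<Lambda>\<^esub> \<odot>\<^bsub>hom_regular \<Lambda> Q\<^esub> f = f" if "f \<in> carrier (hom_regular \<Lambda> Q)" for f
      using that mhom_extensional[of f \<Lambda> Q "regular_module \<Lambda>"]
      by (intro extensionalityI[of _ "carrier Q"]) (simp_all add: clo)
  qed (auto simp: cl clo Q.R.l_distr Q.R.r_distr Q.R.m_assoc cong: restrict_cong)
qed

locale artin_alg = dualizing_ring R J + L: ring \<Lambda>
  for R :: "('r, 'e) ring_scheme" (structure) and J :: "('r, 'j) module"
    and \<Lambda> :: "('a, 'f) ring_scheme" and \<phi> :: "'r \<Rightarrow> 'a" +
  assumes alg: "artin_algebra R \<phi> \<Lambda>"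
begin

lemma phi_hom: "\<phi> \<in> ring_hom R \<Lambda>" using alg by (simp add: artin_algebra_def)

lemma phi [simp]: "r \<in> carrier R \<Longrightarrow> \<phi> r \<in> carrier \<Lambda>"
  "\<lbrakk>r \<in> carrier R; s \<in> carrier R\<rbrakk> \<Longrightarrow> \<phi> (r \<otimes>\<^bsub>R\<^esub> s) = \<phi> r \<otimes>\<^bsub>\<Lambda>\<^esub> \<phi> s"
  "\<lbrakk>r \<in> carrier R; s \<in> carrier R\<rbrakk> \<Longrightarrow> \<phi> (r \<oplus>\<^bsub>R\<^esub> s) = \<phi> r \<oplus>\<^bsub>\<Lambda>\<^esub> \<phi> s"
  "\<phi> \<one>\<^bsub>R\<^esub> = \<one>\<^bsub>\<Lambda>\<^esub>"
  using phi_hom by (simp_all add: ring_hom_closed ring_hom_mult ring_hom_add ring_hom_one)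

lemma phi_central: "\<lbrakk>r \<in> carrier R; x \<in> carrier \<Lambda>\<rbrakk> \<Longrightarrow> \<phi> r \<otimes>\<^bsub>\<Lambda>\<^esub> x = x \<otimes>\<^bsub>\<Lambda>\<^esub> \<phi> r"
  using alg by (simp add: artin_algebra_def)

lemma algebra_fg: "fg_module R (restrict_scalars \<phi> (regular_module \<Lambda>))"
  using alg by (simp add: artin_algebra_def)

lemma restrict_right_module:
  assumes "right_module \<Lambda> M" shows "right_module R (restrict_scalars \<phi> M)"
proof -
  interpret M: right_module \<Lambda> M by fact
  show ?thesis
    by (intro right_module.intro right_module_axioms.intro ring_axioms abelian_group_restrict_scalars
        M.M.abelian_group_axioms)
      (simp_all add: M.smult_l_distr M.smult_r_distr M.smult_assoc)
qed

text \<open>Over the commutative \<open>R\<close> both sides agree, so left modules also become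
  instances of \<open>right_module\<close> and share the results on
  \<open>Hom(M, J)\<close>.\<close>

lemma restrict_left_module:
  assumes "left_module \<Lambda> M" shows "right_module R (restrict_scalars \<phi> M)"
proof -
  interpret M: left_module \<Lambda> M by fact
  have assoc: "\<phi> (r \<otimes> s) \<odot>\<^bsub>M\<^esub> x = \<phi> s \<odot>\<^bsub>M\<^esub> (\<phi> r \<odot>\<^bsub>M\<^esub> x)"
    if "r \<in> carrier R" "s \<in> carrier R" "x \<in> carrier M" for r s x
    using that M.smult_assoc[of "\<phi> s" "\<phi> r" x] m_comm[of r s] by simp
  show ?thesis
    by (intro right_module.intro right_module_axioms.intro ring_axioms abelian_group_restrict_scalars
        M.M.abelian_group_axioms)
      (simp_all add: M.smult_l_distr M.smult_r_distr assoc del: phi(2))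
qed

lemma restrict_submodule:
  assumes M: "right_module \<Lambda> M" and N: "submodule N \<Lambda> M"
  shows "submodule N R (restrict_scalars \<phi> M)"
proof -
  interpret M: right_module R "restrict_scalars \<phi> M" by (rule restrict_right_module[OF M])
  show ?thesis
    using submodule_mem[OF N] submodule_zero[OF N] submodule_add[OF N] submodule_smult[OF N]
    by (intro M.submoduleI) auto
qed

text \<open>The products of module generators s with algebra generators t suffice. Two closures are
  used: for fixed s the coefficients carrying s into K form an \<open>R\<close>-submodule of
  \<Lambda>, and then the x whose multiples all lie in K form a \<Lambda>-submodule.\<close>

lemma restrict_fg:
  assumes M: "fg_module \<Lambda> M" shows "fg_module R (restrict_scalars \<phi> M)"
proof -
  interpret M: right_module \<Lambda> M by (rule fg_right_module[OF M])
  interpret RM: right_module R "restrict_scalars \<phi> M"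
    by (rule restrict_right_module[OF M.right_module_axioms])
  interpret RL: right_module R "restrict_scalars \<phi> (regular_module \<Lambda>)"
    by (rule fg_right_module[OF algebra_fg])
  obtain S where S: "finite S" "S \<subseteq> carrier M"
    "\<forall>K. submodule K \<Lambda> M \<longrightarrow> S \<subseteq> K \<longrightarrow> K = carrier M"
    by (rule fg_moduleE[OF M])
  obtain T where T: "finite T" "T \<subseteq> carrier (restrict_scalars \<phi> (regular_module \<Lambda>))"
    "\<forall>K. submodule K R (restrict_scalars \<phi> (regular_module \<Lambda>)) \<longrightarrow> T \<subseteq> K
      \<longrightarrow> K = carrier (restrict_scalars \<phi> (regular_module \<Lambda>))"
    by (rule fg_moduleE[OF algebra_fg])
  show ?thesis
  proof (rule fg_moduleI[OF RM.right_module_axioms, of "(\<lambda>(t, s). t \<odot>\<^bsub>M\<^esub> s) ` (T \<times> S)"])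
    show "finite ((\<lambda>(t, s). t \<odot>\<^bsub>M\<^esub> s) ` (T \<times> S))" using S(1) T(1) by simp
    show "(\<lambda>(t, s). t \<odot>\<^bsub>M\<^esub> s) ` (T \<times> S) \<subseteq> carrier (restrict_scalars \<phi> M)"
      using S(2) T(2) by auto
    fix K assume K: "submodule K R (restrict_scalars \<phi> M)" "(\<lambda>(t, s). t \<odot>\<^bsub>M\<^esub> s) ` (T \<times> S) \<subseteq> K"
    have Kadd: "x \<oplus>\<^bsub>M\<^esub> y \<in> K" if "x \<in> K" "y \<in> K" for x y
      using submodule_add[OF K(1) that] by simp
    have Ksm: "\<phi> r \<odot>\<^bsub>M\<^esub> x \<in> K" if "r \<in> carrier R" "x \<in> K" for x r
      using submodule_smult[OF K(1) that] by simp
    have K0: "\<zero>\<^bsub>M\<^esub> \<in> K" using submodule_zero[OF K(1)] by simp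
    have gen: "a \<odot>\<^bsub>M\<^esub> s \<in> K" if s: "s \<in> S" and a: "a \<in> carrier \<Lambda>" for s a
    proof -
      have sM: "s \<in> carrier M" using s S(2) by blast
      have "submodule {a \<in> carrier \<Lambda>. a \<odot>\<^bsub>M\<^esub> s \<in> K} R (restrict_scalars \<phi> (regular_module \<Lambda>))"
        using sM K0 by (intro RL.submoduleI)
          (auto simp: M.smult_l_distr M.smult_assoc Kadd Ksm)
      moreover have "T \<subseteq> {a \<in> carrier \<Lambda>. a \<odot>\<^bsub>M\<^esub> s \<in> K}"
      proof
        fix t assume t: "t \<in> T"
        then have "(\<lambda>(t, s). t \<odot>\<^bsub>M\<^esub> s) (t, s) \<in> K" using s by (intro subsetD[OF K(2)] imageI) simp
        then show "t \<in> {a \<in> carrier \<Lambda>. a \<odot>\<^bsub>M\<^esub> s \<in> K}" using subsetD[OF T(2) t] by simp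
      qed
      ultimately have "{a \<in> carrier \<Lambda>. a \<odot>\<^bsub>M\<^esub> s \<in> K} = carrier (restrict_scalars \<phi> (regular_module \<Lambda>))"
        by (rule T(3)[rule_format])
      then have "{a \<in> carrier \<Lambda>. a \<odot>\<^bsub>M\<^esub> s \<in> K} = carrier \<Lambda>" by simp
      then show ?thesis using a by blast
    qed
    \<comment> \<open>K itself is closed only under \<open>R\<close>; the elements all of whose
      \<Lambda>-multiples lie in K are closed under \<Lambda>.\<close>
    have "submodule {x \<in> carrier M. \<forall>a\<in>carrier \<Lambda>. a \<odot>\<^bsub>M\<^esub> x \<in> K} \<Lambda> M"
      using K0 by (intro M.submoduleI) (auto simp: M.smult_r_distr Kadd simp flip: M.smult_assoc)
    moreover have "S \<subseteq> {x \<in> carrier M. \<forall>a\<in>carrier \<Lambda>. a \<odot>\<^bsub>M\<^esub> x \<in> K}" using gen S(2) by blast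
    ultimately have *: "{x \<in> carrier M. \<forall>a\<in>carrier \<Lambda>. a \<odot>\<^bsub>M\<^esub> x \<in> K} = carrier M"
      by (rule S(3)[rule_format])
    have "x \<in> K" if "x \<in> carrier M" for x
    proof -
      have "\<one>\<^bsub>\<Lambda>\<^esub> \<odot>\<^bsub>M\<^esub> x \<in> K" using * that L.one_closed by blast
      then show ?thesis using that by simp
    qed
    then show "K = carrier (restrict_scalars \<phi> M)" using submodule_subset[OF K(1)] by auto
  qed
qed

text \<open>A chain of \<Lambda>-submodules is in particular a chain of
  \<open>R\<close>-submodules.\<close>

lemma fg_chain_cond: "fg_module \<Lambda> M \<Longrightarrow> chain_cond asc \<Lambda> M"
proof -
  assume M: "fg_module \<Lambda> M"
  have "chain_cond asc R (restrict_scalars \<phi> M)"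
    using restrict_fg[OF M] fg_ascending fg_descending by (cases asc) auto
  then show ?thesis
    using restrict_submodule[OF fg_right_module[OF M]] unfolding chain_cond_def by meson
qed

lemma dual_smult_closed:
  assumes M: "left_module \<Lambda> M" and a: "a \<in> carrier \<Lambda>" and u: "u \<in> mhom R (restrict_scalars \<phi> M) J"
  shows "(\<lambda>x\<in>carrier M. u (a \<odot>\<^bsub>M\<^esub> x)) \<in> mhom R (restrict_scalars \<phi> M) J"
proof -
  interpret M: left_module \<Lambda> M by fact
  have com: "a \<odot>\<^bsub>M\<^esub> (\<phi> r \<odot>\<^bsub>M\<^esub> x) = \<phi> r \<odot>\<^bsub>M\<^esub> (a \<odot>\<^bsub>M\<^esub> x)" if "r \<in> carrier R" "x \<in> carrier M" for r x
    using that a by (simp add: phi_central flip: M.smult_assoc)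
  have "restrict (\<lambda>x. u (a \<odot>\<^bsub>M\<^esub> x)) (carrier (restrict_scalars \<phi> M)) \<in> mhom R (restrict_scalars \<phi> M) J"
    using mhom_closed[OF u] mhom_add[OF u] mhom_smult[OF u] a
    by (intro mhom_restrictI[OF restrict_left_module[OF M]]) (simp_all add: com M.smult_r_distr)
  then show ?thesis by simp
qed

lemma dual_right_module:
  assumes M: "left_module \<Lambda> M" shows "right_module \<Lambda> (dual_module R \<phi> J M)"
proof -
  interpret M: left_module \<Lambda> M by fact
  note RM = restrict_left_module[OF M]
  have u: "u x \<in> carrier J" "x \<in> carrier M \<Longrightarrow> y \<in> carrier M \<Longrightarrow> u (x \<oplus>\<^bsub>M\<^esub> y) = u x \<oplus>\<^bsub>J\<^esub> u y"
    if "u \<in> mhom R (restrict_scalars \<phi> M) J" "x \<in> carrier M" for u x y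
    using mhom_closed[OF that(1)] mhom_add[OF that(1)] that(2) by simp_all
  have "abelian_group (dual_module R \<phi> J M)"
    by (rule pointwise_abelian_group[OF RM J.right_module_axioms]) simp_all
  then show ?thesis
  proof (intro right_module.intro right_module_axioms.intro L.ring_axioms)
    show "a \<odot>\<^bsub>dual_module R \<phi> J M\<^esub> u \<in> carrier (dual_module R \<phi> J M)"
      if "a \<in> carrier \<Lambda>" "u \<in> carrier (dual_module R \<phi> J M)" for a u
      using dual_smult_closed[OF M that(1)] that(2) by simp
    show "\<one>\<^bsub>\<Lambda>\<^esub> \<odot>\<^bsub>dual_module R \<phi> J M\<^esub> u = u" if "u \<in> carrier (dual_module R \<phi> J M)" for u
      using that mhom_extensional[of u R "restrict_scalars \<phi> M" J]
      by (intro extensionalityI[of _ "carrier M"]) simp_all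
  qed (auto simp: M.smult_l_distr M.smult_assoc u cong: restrict_cong)
qed

text \<open>Functionals are \<open>R\<close>-linear, so letting \<open>\<phi> r\<close> act on the
  argument is multiplication of the value by r; \<Lambda>-submodules of the dual are thus
  \<open>R\<close>-submodules of the module of functionals.\<close>

lemma dual_chain_cond:
  assumes M: "left_module \<Lambda> M" and fg: "fg_module R (restrict_scalars \<phi> M)"
  shows "chain_cond True \<Lambda> (dual_module R \<phi> J M)"
proof -
  note RM = restrict_left_module[OF M]
  interpret H: right_module R "hom_module R (restrict_scalars \<phi> M) J"
    by (rule hom_module_right_module[OF RM J.right_module_axioms is_cring])
  have "submodule N R (hom_module R (restrict_scalars \<phi> M) J)"
    if N: "submodule N \<Lambda> (dual_module R \<phi> J M)" for N
  proof (rule H.submoduleI)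
    have mem: "u \<in> mhom R (restrict_scalars \<phi> M) J" if "u \<in> N" for u
      using submodule_mem[OF N that] by simp
    then show "N \<subseteq> carrier (hom_module R (restrict_scalars \<phi> M) J)" by auto
    show "\<zero>\<^bsub>hom_module R (restrict_scalars \<phi> M) J\<^esub> \<in> N" using submodule_zero[OF N] by simp
    show "u \<oplus>\<^bsub>hom_module R (restrict_scalars \<phi> M) J\<^esub> v \<in> N" if "u \<in> N" "v \<in> N" for u v
      using submodule_add[OF N that] by simp
    show "r \<odot>\<^bsub>hom_module R (restrict_scalars \<phi> M) J\<^esub> u \<in> N" if "r \<in> carrier R" "u \<in> N" for r u
    proof -
      have "r \<odot>\<^bsub>hom_module R (restrict_scalars \<phi> M) J\<^esub> u = \<phi> r \<odot>\<^bsub>dual_module R \<phi> J M\<^esub> u"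
        using mhom_smult[OF mem[OF that(2)] that(1)] by (auto cong: restrict_cong)
      then show ?thesis using submodule_smult[OF N _ that(2), of "\<phi> r"] that(1) by simp
    qed
  qed
  then show ?thesis
    using hom_chain_cond[OF fg fg_ascending[OF J_fg]] unfolding chain_cond_def by meson
qed

section \<open>The right module D\<Lambda>\<close>

abbreviation "LReg \<equiv> left_regular \<Lambda>"
abbreviation "D\<Lambda> \<equiv> dual_module R \<phi> J LReg"

text \<open>As \<open>\<phi>\<close> has central values, the identity is \<open>R\<close>-linear
  between the two regular modules.\<close>

lemma left_regular_fg: "fg_module R (restrict_scalars \<phi> LReg)"
proof (rule fg_surjective_image[OF algebra_fg restrict_left_module[OF L.left_regular_module]])
  have "restrict (\<lambda>x. x) (carrier (restrict_scalars \<phi> (regular_module \<Lambda>)))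
      \<in> mhom R (restrict_scalars \<phi> (regular_module \<Lambda>)) (restrict_scalars \<phi> LReg)"
    by (rule mhom_restrictI[OF fg_right_module[OF algebra_fg]]) (simp_all add: phi_central)
  then show "(\<lambda>x\<in>carrier \<Lambda>. x)
      \<in> mhom R (restrict_scalars \<phi> (regular_module \<Lambda>)) (restrict_scalars \<phi> LReg)" by simp
qed auto

lemma dual_algebra_right_module: "right_module \<Lambda> D\<Lambda>"
  by (rule dual_right_module[OF L.left_regular_module])

text \<open>Finite generation is read off from the ascending chain condition, with D\<Lambda> as a
  submodule of itself. It is needed to extend maps along P -> D\<Lambda>.\<close>

lemma dual_algebra_fg: "fg_module \<Lambda> D\<Lambda>"
proof -
  interpret D: right_module \<Lambda> D\<Lambda> by (rule dual_algebra_right_module)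
  show ?thesis
    using D.fg_submodule[OF dual_chain_cond[OF L.left_regular_module left_regular_fg] D.carrier_submodule]
    by (simp del: dual_module_simps)
qed

lemma functional_separates:
  assumes "x \<in> carrier \<Lambda>" "x \<noteq> \<zero>\<^bsub>\<Lambda>\<^esub>"
  obtains u where "u \<in> carrier D\<Lambda>" "u x \<noteq> \<zero>\<^bsub>J\<^esub>"
  using nonvanishing_hom[OF left_regular_fg, of x] assms by auto

end

section \<open>The projective module attached to a projective-injective one\<close>

context artin_alg
begin

lemma algebra_diff_eq_zero:
  assumes "x \<in> carrier \<Lambda>" "y \<in> carrier \<Lambda>"
  shows "x \<ominus>\<^bsub>\<Lambda>\<^esub> y = \<zero>\<^bsub>\<Lambda>\<^esub> \<longleftrightarrow> x = y"
proof
  have "(x \<ominus>\<^bsub>\<Lambda>\<^esub> y) \<oplus>\<^bsub>\<Lambda>\<^esub> y = x" using assms by (simp add: a_minus_def L.a_assoc L.l_neg)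
  then show "x = y" if "x \<ominus>\<^bsub>\<Lambda>\<^esub> y = \<zero>\<^bsub>\<Lambda>\<^esub>" using that assms by simp
qed (use assms in \<open>simp add: a_minus_def L.r_neg\<close>)

lemma dual_apply:
  assumes "u \<in> carrier D\<Lambda>"
  shows "x \<in> carrier \<Lambda> \<Longrightarrow> u x \<in> carrier J"
    and "\<lbrakk>x \<in> carrier \<Lambda>; y \<in> carrier \<Lambda>\<rbrakk> \<Longrightarrow> u (x \<oplus>\<^bsub>\<Lambda>\<^esub> y) = u x \<oplus>\<^bsub>J\<^esub> u y"
    and "\<lbrakk>r \<in> carrier R; x \<in> carrier \<Lambda>\<rbrakk> \<Longrightarrow> u (\<phi> r \<otimes>\<^bsub>\<Lambda>\<^esub> x) = r \<odot>\<^bsub>J\<^esub> u x"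
    and "u \<zero>\<^bsub>\<Lambda>\<^esub> = \<zero>\<^bsub>J\<^esub>"
    and "\<lbrakk>x \<in> carrier \<Lambda>; y \<in> carrier \<Lambda>\<rbrakk> \<Longrightarrow> u (x \<ominus>\<^bsub>\<Lambda>\<^esub> y) = u x \<ominus>\<^bsub>J\<^esub> u y"
proof -
  have u: "u \<in> mhom R (restrict_scalars \<phi> LReg) J" using assms by simp
  interpret u: module_hom R "restrict_scalars \<phi> LReg" J u
    by (rule module_homI[OF restrict_left_module[OF L.left_regular_module] J.right_module_axioms u])
  show cl: "u x \<in> carrier J" if "x \<in> carrier \<Lambda>" for x using u.closed that by simp
  show add: "u (x \<oplus>\<^bsub>\<Lambda>\<^esub> y) = u x \<oplus>\<^bsub>J\<^esub> u y" if "x \<in> carrier \<Lambda>" "y \<in> carrier \<Lambda>" for x y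
    using u.add that by simp
  show "u (\<phi> r \<otimes>\<^bsub>\<Lambda>\<^esub> x) = r \<odot>\<^bsub>J\<^esub> u x" if "r \<in> carrier R" "x \<in> carrier \<Lambda>" for r x
    using u.smult that by simp
  show "u \<zero>\<^bsub>\<Lambda>\<^esub> = \<zero>\<^bsub>J\<^esub>" using u.zero by simp
  show "u (x \<ominus>\<^bsub>\<Lambda>\<^esub> y) = u x \<ominus>\<^bsub>J\<^esub> u y" if "x \<in> carrier \<Lambda>" "y \<in> carrier \<Lambda>" for x y
  proof -
    have "(x \<ominus>\<^bsub>\<Lambda>\<^esub> y) \<oplus>\<^bsub>\<Lambda>\<^esub> y = x" using that by (simp add: a_minus_def L.a_assoc L.l_neg)
    then have "u (x \<ominus>\<^bsub>\<Lambda>\<^esub> y) \<oplus>\<^bsub>J\<^esub> u y = (u x \<ominus>\<^bsub>J\<^esub> u y) \<oplus>\<^bsub>J\<^esub> u y"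
      using add[of "x \<ominus>\<^bsub>\<Lambda>\<^esub> y" y] that cl J.diff_add_cancel[of "u x" "u y"] by simp
    then show ?thesis
      using J.M.add.right_cancel[of "u y" "u (x \<ominus>\<^bsub>\<Lambda>\<^esub> y)" "u x \<ominus>\<^bsub>J\<^esub> u y"] that cl by simp
  qed
qed

lemma dual_ext:
  assumes "u \<in> carrier D\<Lambda>" "v \<in> carrier D\<Lambda>" "\<And>x. x \<in> carrier \<Lambda> \<Longrightarrow> u x = v x"
  shows "u = v"
  using assms mhom_ext[of u R "restrict_scalars \<phi> LReg" J v J] by simp

text \<open>Right multiplication by b is left linear on \<Lambda> and so acts on functionals; this
  is the form that endomorphisms of D\<Lambda> take.\<close>

lemma dual_translate:
  assumes "u \<in> carrier D\<Lambda>" "b \<in> carrier \<Lambda>"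
  shows "(\<lambda>x\<in>carrier \<Lambda>. u (x \<otimes>\<^bsub>\<Lambda>\<^esub> b)) \<in> carrier D\<Lambda>"
proof -
  have "restrict (\<lambda>x. u (x \<otimes>\<^bsub>\<Lambda>\<^esub> b)) (carrier (restrict_scalars \<phi> LReg)) \<in> mhom R (restrict_scalars \<phi> LReg) J"
    using dual_apply[OF assms(1)] assms(2)
    by (intro mhom_restrictI[OF restrict_left_module[OF L.left_regular_module]])
      (simp_all add: L.l_distr L.m_assoc)
  then show ?thesis by simp
qed

text \<open>A functional \<open>\<chi>\<close> that does not vanish on the socle embeds \<open>P\<close> into \<open>D\<Lambda>\<close> by
  \<open>p \<mapsto> (x \<mapsto> \<chi>(px))\<close>. The embedding splits, and by double duality the resulting idempotent
  endomorphism of \<open>D\<Lambda>\<close> is induced by right multiplication with an idempotent \<open>e\<close> of \<open>\<Lambda>\<close>.\<close>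

lemma idempotent_embedding:
  assumes inj: "injective \<Lambda> P" and S: "essential_simple \<Lambda> P S"
  obtains e \<Phi> where "e \<in> carrier \<Lambda>" "e \<otimes>\<^bsub>\<Lambda>\<^esub> e = e" "\<Phi> \<in> mhom \<Lambda> P D\<Lambda>" "inj_on \<Phi> (carrier P)"
    "\<Phi> ` carrier P = {u \<in> carrier D\<Lambda>. \<forall>x\<in>carrier \<Lambda>. u (x \<otimes>\<^bsub>\<Lambda>\<^esub> e) = u x}"
proof -
  have fg: "fg_module \<Lambda> P" using inj by (simp add: injective_def)
  interpret P: right_module \<Lambda> P by (rule fg_right_module[OF fg])
  interpret D: right_module \<Lambda> D\<Lambda> by (rule dual_algebra_right_module)
  note sub = P.essential_simple_submodule[OF S]
  obtain s where s: "s \<in> S" "s \<noteq> \<zero>\<^bsub>P\<^esub>" by (rule P.essential_simple_nonzero[OF S])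
  have sP: "s \<in> carrier P" using submodule_mem[OF sub s(1)] .
  obtain \<chi> where \<chi>: "\<chi> \<in> mhom R (restrict_scalars \<phi> P) J" "\<chi> s \<noteq> \<zero>\<^bsub>J\<^esub>"
    by (rule nonvanishing_hom[OF restrict_fg[OF fg], of s]) (use sP s(2) in simp_all)
  have \<chi>_cl: "\<chi> p \<in> carrier J" if "p \<in> carrier P" for p
    using mhom_closed[OF \<chi>(1)] that by simp
  have \<chi>_add: "\<chi> (p \<oplus>\<^bsub>P\<^esub> p') = \<chi> p \<oplus>\<^bsub>J\<^esub> \<chi> p'" if "p \<in> carrier P" "p' \<in> carrier P" for p p'
    using mhom_add[OF \<chi>(1)] that by simp
  have \<chi>_smult: "\<chi> (\<phi> r \<odot>\<^bsub>P\<^esub> p) = r \<odot>\<^bsub>J\<^esub> \<chi> p" if "r \<in> carrier R" "p \<in> carrier P" for r p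
    using mhom_smult[OF \<chi>(1)] that by simp
  define F where "F p = (\<lambda>x\<in>carrier \<Lambda>. \<chi> (x \<odot>\<^bsub>P\<^esub> p))" for p
  have FD: "F p \<in> carrier D\<Lambda>" if p: "p \<in> carrier P" for p
  proof -
    have "restrict (\<lambda>x. \<chi> (x \<odot>\<^bsub>P\<^esub> p)) (carrier (restrict_scalars \<phi> LReg)) \<in> mhom R (restrict_scalars \<phi> LReg) J"
      using p by (intro mhom_restrictI[OF restrict_left_module[OF L.left_regular_module]])
        (simp_all add: \<chi>_cl \<chi>_add \<chi>_smult P.smult_l_distr P.smult_assoc phi_central)
    then show ?thesis by (simp add: F_def)
  qed
  define \<Phi> where "\<Phi> = restrict F (carrier P)"
  have \<Phi>: "\<Phi> \<in> mhom \<Lambda> P D\<Lambda>"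
    unfolding \<Phi>_def
  proof (rule mhom_restrictI[OF P.right_module_axioms FD])
    show "F (p \<oplus>\<^bsub>P\<^esub> p') = F p \<oplus>\<^bsub>D\<Lambda>\<^esub> F p'" if "p \<in> carrier P" "p' \<in> carrier P" for p p'
      using that by (auto simp: F_def P.smult_r_distr \<chi>_add cong: restrict_cong)
    show "F (a \<odot>\<^bsub>P\<^esub> p) = a \<odot>\<^bsub>D\<Lambda>\<^esub> F p" if "a \<in> carrier \<Lambda>" "p \<in> carrier P" for a p
      using that by (auto simp: F_def P.smult_assoc cong: restrict_cong)
  qed
  interpret \<Phi>: module_hom \<Lambda> P D\<Lambda> \<Phi>
    by (rule module_homI[OF P.right_module_axioms dual_algebra_right_module \<Phi>])
  \<comment> \<open>A nonzero kernel would contain the socle element s, but the functional attached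
    to s has the nonzero value \<open>\<chi> s\<close> at 1.\<close>
  have "mker P D\<Lambda> \<Phi> = {\<zero>\<^bsub>P\<^esub>}"
  proof (rule ccontr)
    assume "mker P D\<Lambda> \<Phi> \<noteq> {\<zero>\<^bsub>P\<^esub>}"
    then have "s \<in> mker P D\<Lambda> \<Phi>"
      using S s(1) \<Phi>.ker_submodule unfolding essential_simple_def by blast
    then have "F s = (\<lambda>x\<in>carrier \<Lambda>. \<zero>\<^bsub>J\<^esub>)" using sP by (simp add: mker_def \<Phi>_def)
    then have "F s \<one>\<^bsub>\<Lambda>\<^esub> = \<zero>\<^bsub>J\<^esub>" by simp
    then show False using \<chi>(2) sP by (simp add: F_def)
  qed
  then have \<Phi>_inj: "inj_on \<Phi> (carrier P)" using \<Phi>.inj_iff_ker by simp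
  have idP: "(\<lambda>x\<in>carrier P. x) \<in> mhom \<Lambda> P P"
    by (rule mhom_restrictI[OF P.right_module_axioms]) simp_all
  \<comment> \<open>Injectivity of P gives a retraction of \<Phi>, so that \<open>\<psi>\<close>
    becomes an idempotent endomorphism with image \<Phi>(P).\<close>
  obtain \<rho> where \<rho>: "\<rho> \<in> mhom \<Lambda> D\<Lambda> P" "\<forall>p\<in>carrier P. \<rho> (\<Phi> p) = (\<lambda>x\<in>carrier P. x) p"
    by (rule injective_extend[OF inj fg dual_algebra_fg \<Phi> \<Phi>_inj idP])
  have \<rho>\<Phi>: "\<rho> (\<Phi> p) = p" if "p \<in> carrier P" for p using \<rho>(2) that by simp
  define \<psi> where "\<psi> u = \<Phi> (\<rho> u)" for u
  have \<psi>D: "\<psi> u \<in> carrier D\<Lambda>" if "u \<in> carrier D\<Lambda>" for u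
    unfolding \<psi>_def using that by (intro \<Phi>.closed mhom_closed[OF \<rho>(1)])
  have \<psi>_add: "\<psi> (u \<oplus>\<^bsub>D\<Lambda>\<^esub> v) = \<psi> u \<oplus>\<^bsub>D\<Lambda>\<^esub> \<psi> v" if "u \<in> carrier D\<Lambda>" "v \<in> carrier D\<Lambda>" for u v
    unfolding \<psi>_def mhom_add[OF \<rho>(1) that] by (intro \<Phi>.add mhom_closed[OF \<rho>(1)] that)
  have \<psi>_smult: "\<psi> (a \<odot>\<^bsub>D\<Lambda>\<^esub> u) = a \<odot>\<^bsub>D\<Lambda>\<^esub> \<psi> u" if "a \<in> carrier \<Lambda>" "u \<in> carrier D\<Lambda>" for a u
    unfolding \<psi>_def mhom_smult[OF \<rho>(1) that] by (intro \<Phi>.smult mhom_closed[OF \<rho>(1)] that)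
  have \<psi>\<psi>: "\<psi> (\<psi> u) = \<psi> u" if "u \<in> carrier D\<Lambda>" for u
    unfolding \<psi>_def using \<rho>\<Phi>[OF mhom_closed[OF \<rho>(1) that]] by simp
  let ?A = "restrict_scalars \<phi> LReg"
  let ?H = "hom_module R ?A J"
  interpret H: right_module R ?H
    by (rule hom_module_right_module[OF restrict_left_module[OF L.left_regular_module]
        J.right_module_axioms is_cring])
  have HD: "carrier ?H = carrier D\<Lambda>" by simp
  \<comment> \<open>Sending u to the value of \<open>\<psi> u\<close> at 1 is an
    \<open>R\<close>-linear functional on D\<Lambda>; by double duality it is evaluation at some
    e.\<close>
  have "restrict (\<lambda>u. \<psi> u \<one>\<^bsub>\<Lambda>\<^esub>) (carrier ?H) \<in> mhom R ?H J"
  proof (rule mhom_restrictI[OF H.right_module_axioms], unfold HD)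
    show "\<psi> u \<one>\<^bsub>\<Lambda>\<^esub> \<in> carrier J" if "u \<in> carrier D\<Lambda>" for u
      using dual_apply(1)[OF \<psi>D[OF that]] by simp
    show "\<psi> (u \<oplus>\<^bsub>?H\<^esub> v) \<one>\<^bsub>\<Lambda>\<^esub> = \<psi> u \<one>\<^bsub>\<Lambda>\<^esub> \<oplus>\<^bsub>J\<^esub> \<psi> v \<one>\<^bsub>\<Lambda>\<^esub>" if "u \<in> carrier D\<Lambda>" "v \<in> carrier D\<Lambda>" for u v
      using \<psi>_add[OF that] by simp
    show "\<psi> (r \<odot>\<^bsub>?H\<^esub> u) \<one>\<^bsub>\<Lambda>\<^esub> = r \<odot>\<^bsub>J\<^esub> \<psi> u \<one>\<^bsub>\<Lambda>\<^esub>" if r: "r \<in> carrier R" and u: "u \<in> carrier D\<Lambda>" for r u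
    proof -
      have "r \<odot>\<^bsub>?H\<^esub> u = \<phi> r \<odot>\<^bsub>D\<Lambda>\<^esub> u"
        using dual_apply(3)[OF u r] by (auto cong: restrict_cong)
      then show ?thesis
        using \<psi>_smult[OF _ u, of "\<phi> r"] r dual_apply(3)[OF \<psi>D[OF u] r, of "\<one>\<^bsub>\<Lambda>\<^esub>"] by simp
    qed
  qed
  then obtain e where e: "e \<in> carrier ?A"
    "\<forall>u\<in>mhom R ?A J. restrict (\<lambda>u. \<psi> u \<one>\<^bsub>\<Lambda>\<^esub>) (carrier ?H) u = u e"
    by (rule evaluation[OF left_regular_fg])
  have eL: "e \<in> carrier \<Lambda>" using e(1) by simp
  have \<psi>1: "\<psi> u \<one>\<^bsub>\<Lambda>\<^esub> = u e" if "u \<in> carrier D\<Lambda>" for u using e(2) that by simp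
  \<comment> \<open>By linearity the value of \<open>\<psi> u\<close> at x is the value at 1 after u
    has been acted on by x.\<close>
  have \<psi>_eq: "\<psi> u x = u (x \<otimes>\<^bsub>\<Lambda>\<^esub> e)" if u: "u \<in> carrier D\<Lambda>" and x: "x \<in> carrier \<Lambda>" for u x
  proof -
    have "\<psi> u x = (x \<odot>\<^bsub>D\<Lambda>\<^esub> \<psi> u) \<one>\<^bsub>\<Lambda>\<^esub>" using x by simp
    also have "\<dots> = \<psi> (x \<odot>\<^bsub>D\<Lambda>\<^esub> u) \<one>\<^bsub>\<Lambda>\<^esub>" using \<psi>_smult[OF x u] by simp
    also have "\<dots> = (x \<odot>\<^bsub>D\<Lambda>\<^esub> u) e" by (rule \<psi>1[OF D.smult_closed[OF x u]])
    also have "\<dots> = u (x \<otimes>\<^bsub>\<Lambda>\<^esub> e)" using eL by simp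
    finally show ?thesis .
  qed
  \<comment> \<open>Idempotency of \<open>\<psi>\<close>, read at 1, says that every u takes equal
    values at e e and at e; functionals separate the elements of \<Lambda>.\<close>
  have ee: "e \<otimes>\<^bsub>\<Lambda>\<^esub> e = e"
  proof (rule ccontr)
    assume neq: "e \<otimes>\<^bsub>\<Lambda>\<^esub> e \<noteq> e"
    have "(e \<otimes>\<^bsub>\<Lambda>\<^esub> e) \<ominus>\<^bsub>\<Lambda>\<^esub> e \<noteq> \<zero>\<^bsub>\<Lambda>\<^esub>" using neq eL algebra_diff_eq_zero by simp
    then obtain u where u: "u \<in> carrier D\<Lambda>" "u ((e \<otimes>\<^bsub>\<Lambda>\<^esub> e) \<ominus>\<^bsub>\<Lambda>\<^esub> e) \<noteq> \<zero>\<^bsub>J\<^esub>"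
      by (rule functional_separates[OF L.minus_closed[OF L.m_closed[OF eL eL] eL]])
    have "u (e \<otimes>\<^bsub>\<Lambda>\<^esub> e) = \<psi> u e" using \<psi>_eq[OF u(1) eL] by simp
    also have "\<dots> = \<psi> (\<psi> u) \<one>\<^bsub>\<Lambda>\<^esub>" by (rule \<psi>1[OF \<psi>D[OF u(1)], symmetric])
    also have "\<dots> = u e" using \<psi>\<psi>[OF u(1)] \<psi>1[OF u(1)] by simp
    finally show False
      using u(2) dual_apply(1,5)[OF u(1)] eL J.diff_eq_zero_iff[of "u e" "u e"] by simp
  qed
  \<comment> \<open>Both sides are the fixed points of \<open>\<psi>\<close>.\<close>
  have "\<Phi> ` carrier P = {u \<in> carrier D\<Lambda>. \<forall>x\<in>carrier \<Lambda>. u (x \<otimes>\<^bsub>\<Lambda>\<^esub> e) = u x}"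
  proof (intro equalityI subsetI)
    fix u assume "u \<in> \<Phi> ` carrier P"
    then obtain p where p: "p \<in> carrier P" "u = \<Phi> p" by blast
    then have "u \<in> carrier D\<Lambda>" "\<psi> u = u" using \<rho>\<Phi> \<Phi>.closed by (simp_all add: \<psi>_def)
    then show "u \<in> {u \<in> carrier D\<Lambda>. \<forall>x\<in>carrier \<Lambda>. u (x \<otimes>\<^bsub>\<Lambda>\<^esub> e) = u x}"
      using \<psi>_eq[of u] by (simp only: mem_Collect_eq simp_thms ball_simps) metis
  next
    fix u assume u: "u \<in> {u \<in> carrier D\<Lambda>. \<forall>x\<in>carrier \<Lambda>. u (x \<otimes>\<^bsub>\<Lambda>\<^esub> e) = u x}"
    then have "\<psi> u = u" using \<psi>_eq \<psi>D by (intro dual_ext) simp_all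
    then show "u \<in> \<Phi> ` carrier P"
      using mhom_closed[OF \<rho>(1), of u] u unfolding \<psi>_def by (metis (mono_tags) image_eqI mem_Collect_eq)
  qed
  then show thesis using that eL ee \<Phi> \<Phi>_inj by blast
qed

text \<open>The right ideal e\<Lambda>, copied to the element type required of Q; the copy of e is
  the generator.\<close>

lemma idempotent_generated_small:
  assumes e: "e \<in> carrier \<Lambda>" "e \<otimes>\<^bsub>\<Lambda>\<^esub> e = e"
  obtains Q :: "('a, 'a small) module" and q where "idempotent_generated \<Lambda> Q e q"
proof -
  interpret LR: right_module \<Lambda> "regular_module \<Lambda>" by (rule L.regular_right_module)
  have eL: "e \<in> carrier (regular_module \<Lambda>)" using e by simp
  let ?E = "(regular_module \<Lambda>)\<lparr>carrier := cyclic_submodule \<Lambda> (regular_module \<Lambda>) e\<rparr>"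
  obtain Q :: "('a, 'a small) module" and f g where Q: "fg_module \<Lambda> Q" "f \<in> mhom \<Lambda> ?E Q"
    "g \<in> mhom \<Lambda> Q ?E" "\<forall>x\<in>carrier ?E. g (f x) = x" "\<forall>y\<in>carrier Q. f (g y) = y"
    by (rule fg_isomorphic_small[OF LR.fg_cyclic[OF eL]])
  have eE: "e \<in> carrier ?E" using LR.cyclic_self[OF eL] by simp
  interpret Q: right_module \<Lambda> Q by (rule fg_right_module[OF Q(1)])
  interpret E: right_module \<Lambda> ?E by (rule fg_right_module[OF LR.fg_cyclic[OF eL]])
  interpret f: module_hom \<Lambda> ?E Q f by (rule module_homI[OF E.right_module_axioms Q.right_module_axioms Q(2)])
  interpret g: module_hom \<Lambda> Q ?E g by (rule module_homI[OF Q.right_module_axioms E.right_module_axioms Q(3)])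
  have fr: "r \<odot>\<^bsub>Q\<^esub> f e = f (e \<otimes>\<^bsub>\<Lambda>\<^esub> r)" if "r \<in> carrier \<Lambda>" for r
    using f.smult[OF that eE] by simp
  have "idempotent_generated \<Lambda> Q e (f e)"
  proof (intro idempotent_generated.intro idempotent_generated_axioms.intro Q.right_module_axioms e)
    show "f e \<in> carrier Q" using eE by (rule f.closed)
    show "e \<odot>\<^bsub>Q\<^esub> f e = f e" using fr[OF e(1)] e(2) by simp
    show "\<exists>r\<in>carrier \<Lambda>. x = r \<odot>\<^bsub>Q\<^esub> f e" if x: "x \<in> carrier Q" for x
    proof -
      have "g x \<in> cyclic_submodule \<Lambda> (regular_module \<Lambda>) e" using g.closed[OF x] by simp
      then obtain r where r: "r \<in> carrier \<Lambda>" "g x = e \<otimes>\<^bsub>\<Lambda>\<^esub> r" by (auto simp: cyclic_submodule_def)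
      have "x = f (g x)" using Q(5) x by simp
      then have "x = r \<odot>\<^bsub>Q\<^esub> f e" using fr[OF r(1)] r(2) by simp
      then show ?thesis using r(1) by blast
    qed
    show "e \<otimes>\<^bsub>\<Lambda>\<^esub> r = \<zero>\<^bsub>\<Lambda>\<^esub>" if r: "r \<in> carrier \<Lambda>" "r \<odot>\<^bsub>Q\<^esub> f e = \<zero>\<^bsub>Q\<^esub>" for r
    proof -
      have "r \<odot>\<^bsub>?E\<^esub> e \<in> carrier ?E" using E.smult_closed[OF r(1) eE] .
      then have "g (f (e \<otimes>\<^bsub>\<Lambda>\<^esub> r)) = e \<otimes>\<^bsub>\<Lambda>\<^esub> r" using Q(4) by simp
      then show ?thesis using fr[OF r(1)] r(2) g.zero by simp
    qed
  qed
  then show thesis by (rule that)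
qed

end

text \<open>Identifies P with D(\<Lambda>e): a functional on \<Lambda> that is unchanged by right
  multiplication of its argument with e is determined by its restriction to \<Lambda>e.\<close>

locale dual_pair = artin_alg R J \<Lambda> \<phi> + Q: idempotent_generated \<Lambda> Q e q + P: right_module \<Lambda> P
  for R :: "('r, 'e) ring_scheme" (structure) and J :: "('r, 'j) module"
    and \<Lambda> :: "('a, 'f) ring_scheme" and \<phi> :: "'r \<Rightarrow> 'a" and Q :: "('a, 'm) module" and e q
    and P :: "('a, 'p) module" +
  fixes \<Phi> :: "'p \<Rightarrow> 'a \<Rightarrow> 'j"
  assumes \<Phi>: "\<Phi> \<in> mhom \<Lambda> P D\<Lambda>" "inj_on \<Phi> (carrier P)"
    and image: "\<Phi> ` carrier P = {u \<in> carrier D\<Lambda>. \<forall>x\<in>carrier \<Lambda>. u (x \<otimes>\<^bsub>\<Lambda>\<^esub> e) = u x}"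
begin

lemma \<Phi>_closed: "p \<in> carrier P \<Longrightarrow> \<Phi> p \<in> carrier D\<Lambda>"
  by (rule mhom_closed[OF \<Phi>(1)])

lemma \<Phi>_add: "\<lbrakk>p \<in> carrier P; p' \<in> carrier P; x \<in> carrier \<Lambda>\<rbrakk> \<Longrightarrow> \<Phi> (p \<oplus>\<^bsub>P\<^esub> p') x = \<Phi> p x \<oplus>\<^bsub>J\<^esub> \<Phi> p' x"
  using mhom_add[OF \<Phi>(1)] by simp

lemma \<Phi>_smult: "\<lbrakk>a \<in> carrier \<Lambda>; p \<in> carrier P; x \<in> carrier \<Lambda>\<rbrakk> \<Longrightarrow> \<Phi> (a \<odot>\<^bsub>P\<^esub> p) x = \<Phi> p (a \<otimes>\<^bsub>\<Lambda>\<^esub> x)"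
  using mhom_smult[OF \<Phi>(1)] by simp

lemma \<Phi>_e: "\<lbrakk>p \<in> carrier P; x \<in> carrier \<Lambda>\<rbrakk> \<Longrightarrow> \<Phi> p (x \<otimes>\<^bsub>\<Lambda>\<^esub> e) = \<Phi> p x"
  using image by blast

lemma \<Phi>_eqI:
  assumes "p \<in> carrier P" "p' \<in> carrier P" "\<And>x. x \<in> carrier \<Lambda> \<Longrightarrow> \<Phi> p x = \<Phi> p' x"
  shows "p = p'"
  using dual_ext[OF \<Phi>_closed \<Phi>_closed, OF assms(1,2)] assms inj_onD[OF \<Phi>(2)] by blast

lemma \<Phi>_zero: "x \<in> carrier \<Lambda> \<Longrightarrow> \<Phi> \<zero>\<^bsub>P\<^esub> x = \<zero>\<^bsub>J\<^esub>"
  using module_hom.zero[OF module_homI[OF P.right_module_axioms dual_algebra_right_module \<Phi>(1)]] by simp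

lemma \<Phi>_onto:
  assumes "u \<in> carrier D\<Lambda>" "\<And>x. x \<in> carrier \<Lambda> \<Longrightarrow> u (x \<otimes>\<^bsub>\<Lambda>\<^esub> e) = u x"
  obtains p where "p \<in> carrier P" "\<Phi> p = u"
proof -
  have "u \<in> \<Phi> ` carrier P" unfolding image using assms by blast
  then show thesis using that by blast
qed

text \<open>If \<Phi> p is nonzero at x, then s = p x e works: the value of \<Phi> s at 1 is that of
  \<Phi> p at x e, hence at x. The condition s e = s allows q to be sent to s.\<close>

lemma socle_generator:
  assumes S: "essential_simple \<Lambda> P S"
  obtains s where "s \<in> S" "s \<noteq> \<zero>\<^bsub>P\<^esub>" "e \<odot>\<^bsub>P\<^esub> s = s"
proof -
  note sub = P.essential_simple_submodule[OF S]
  obtain p where p: "p \<in> S" "p \<noteq> \<zero>\<^bsub>P\<^esub>" by (rule P.essential_simple_nonzero[OF S])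
  have pP: "p \<in> carrier P" using submodule_mem[OF sub p(1)] .
  obtain x where x: "x \<in> carrier \<Lambda>" "\<Phi> p x \<noteq> \<zero>\<^bsub>J\<^esub>"
    using \<Phi>_eqI[OF pP P.M.zero_closed] p(2) \<Phi>_zero by auto
  define s where "s = (x \<otimes>\<^bsub>\<Lambda>\<^esub> e) \<odot>\<^bsub>P\<^esub> p"
  have "\<Phi> s \<one>\<^bsub>\<Lambda>\<^esub> = \<Phi> p x"
    using \<Phi>_smult[OF _ pP] \<Phi>_e[OF pP x(1)] x(1) Q.e(1) by (simp add: s_def)
  then have "s \<noteq> \<zero>\<^bsub>P\<^esub>" using x(2) \<Phi>_zero by auto
  moreover have "s \<in> S" unfolding s_def using x(1) Q.e(1) by (intro submodule_smult[OF sub _ p(1)]) simp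
  moreover have "e \<odot>\<^bsub>P\<^esub> s = s"
    using x(1) Q.e pP by (simp add: s_def L.m_assoc flip: P.smult_assoc)
  ultimately show thesis by (intro that[of s])
qed

text \<open>A decomposition of \<open>Q\<close> yields an idempotent \<open>a = eae\<close>, which in turn decomposes \<open>P\<close>.\<close>

lemma corner_idempotent_trivial:
  assumes ind: "indecomposable \<Lambda> P"
    and a: "a \<in> carrier \<Lambda>" "e \<otimes>\<^bsub>\<Lambda>\<^esub> a = a" "a \<otimes>\<^bsub>\<Lambda>\<^esub> e = a" "a \<otimes>\<^bsub>\<Lambda>\<^esub> a = a"
  shows "a = \<zero>\<^bsub>\<Lambda>\<^esub> \<or> a = e"
proof -
  note e = Q.e
  \<comment> \<open>Under \<Phi> these are D(\<Lambda>a) and D(\<Lambda>(e - a)).\<close>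
  define U where "U = {p \<in> carrier P. \<forall>x\<in>carrier \<Lambda>. \<Phi> p (x \<otimes>\<^bsub>\<Lambda>\<^esub> a) = \<Phi> p x}"
  define V where "V = {p \<in> carrier P. \<forall>x\<in>carrier \<Lambda>. \<Phi> p (x \<otimes>\<^bsub>\<Lambda>\<^esub> a) = \<zero>\<^bsub>J\<^esub>}"
  have U: "submodule U \<Lambda> P"
    using a(1) by (intro P.submoduleI)
      (auto simp: U_def \<Phi>_zero \<Phi>_add \<Phi>_smult simp flip: L.m_assoc)
  have V: "submodule V \<Lambda> P"
    using a(1) by (intro P.submoduleI)
      (auto simp: V_def \<Phi>_zero \<Phi>_add \<Phi>_smult simp flip: L.m_assoc)
  have "U = {\<zero>\<^bsub>P\<^esub>} \<or> V = {\<zero>\<^bsub>P\<^esub>}"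
  proof (rule P.decomposition_trivial[OF ind U V])
    fix p assume "p \<in> U" "p \<in> V"
    then have p: "p \<in> carrier P" "\<And>x. x \<in> carrier \<Lambda> \<Longrightarrow> \<Phi> p x = \<zero>\<^bsub>J\<^esub>" by (auto simp: U_def V_def)
    then show "p = \<zero>\<^bsub>P\<^esub>" using \<Phi>_zero by (intro \<Phi>_eqI) simp_all
  next
    fix p assume p: "p \<in> carrier P"
    \<comment> \<open>Composition with right multiplication by a projects p onto its component in
      U.\<close>
    define v where "v = (\<lambda>x\<in>carrier \<Lambda>. \<Phi> p (x \<otimes>\<^bsub>\<Lambda>\<^esub> a))"
    have "v \<in> carrier D\<Lambda>" unfolding v_def by (rule dual_translate[OF \<Phi>_closed[OF p] a(1)])
    moreover have "v (x \<otimes>\<^bsub>\<Lambda>\<^esub> e) = v x" if "x \<in> carrier \<Lambda>" for x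
      using that a e(1) by (simp add: v_def L.m_assoc)
    ultimately obtain p1 where p1: "p1 \<in> carrier P" "\<Phi> p1 = v" by (rule \<Phi>_onto)
    have "p1 \<in> U" using p1 a by (simp add: U_def v_def L.m_assoc)
    moreover have "p \<ominus>\<^bsub>P\<^esub> p1 \<in> V"
    proof -
      have "\<Phi> (p \<ominus>\<^bsub>P\<^esub> p1) (x \<otimes>\<^bsub>\<Lambda>\<^esub> a) = \<zero>\<^bsub>J\<^esub>" if x: "x \<in> carrier \<Lambda>" for x
      proof -
        have xa: "x \<otimes>\<^bsub>\<Lambda>\<^esub> a \<in> carrier \<Lambda>" using x a(1) by simp
        have "\<Phi> (p \<ominus>\<^bsub>P\<^esub> p1) (x \<otimes>\<^bsub>\<Lambda>\<^esub> a) \<oplus>\<^bsub>J\<^esub> \<Phi> p1 (x \<otimes>\<^bsub>\<Lambda>\<^esub> a) = \<Phi> p (x \<otimes>\<^bsub>\<Lambda>\<^esub> a)"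
          using \<Phi>_add[of "p \<ominus>\<^bsub>P\<^esub> p1" p1, OF _ p1(1) xa] P.diff_add_cancel[OF p p1(1)] p p1(1) by simp
        moreover have "\<Phi> p1 (x \<otimes>\<^bsub>\<Lambda>\<^esub> a) = \<Phi> p (x \<otimes>\<^bsub>\<Lambda>\<^esub> a)"
          using x a p1(2) by (simp add: v_def L.m_assoc)
        ultimately show ?thesis
          using dual_apply(1)[OF \<Phi>_closed xa] p p1(1) J.M.add.r_cancel_one
          by (metis P.M.minus_closed)
      qed
      then show ?thesis using p p1(1) by (simp add: V_def)
    qed
    moreover have "p = p1 \<oplus>\<^bsub>P\<^esub> (p \<ominus>\<^bsub>P\<^esub> p1)"
      using P.diff_add_cancel[OF p p1(1)] p p1(1) by (simp add: P.M.a_comm)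
    ultimately show "\<exists>u\<in>U. \<exists>v\<in>V. p = u \<oplus>\<^bsub>P\<^esub> v" by blast
  qed
  then show ?thesis
  proof
    assume U0: "U = {\<zero>\<^bsub>P\<^esub>}"
    have "a = \<zero>\<^bsub>\<Lambda>\<^esub>"
    proof (rule ccontr)
      assume "a \<noteq> \<zero>\<^bsub>\<Lambda>\<^esub>"
      then obtain u where u: "u \<in> carrier D\<Lambda>" "u a \<noteq> \<zero>\<^bsub>J\<^esub>" by (rule functional_separates[OF a(1)])
      \<comment> \<open>A functional nonzero at a is translated by a into a nonzero element of
        U.\<close>
      define v where "v = (\<lambda>x\<in>carrier \<Lambda>. u (x \<otimes>\<^bsub>\<Lambda>\<^esub> a))"
      have "v \<in> carrier D\<Lambda>" unfolding v_def by (rule dual_translate[OF u(1) a(1)])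
      moreover have "v (x \<otimes>\<^bsub>\<Lambda>\<^esub> e) = v x" if "x \<in> carrier \<Lambda>" for x
        using that a e(1) by (simp add: v_def L.m_assoc)
      ultimately obtain p where p: "p \<in> carrier P" "\<Phi> p = v" by (rule \<Phi>_onto)
      have "p \<in> U" using p a by (simp add: U_def v_def L.m_assoc)
      then have "v \<one>\<^bsub>\<Lambda>\<^esub> = \<zero>\<^bsub>J\<^esub>" using U0 p(2) \<Phi>_zero by auto
      then show False using u(2) a(1) by (simp add: v_def)
    qed
    then show ?thesis ..
  next
    assume V0: "V = {\<zero>\<^bsub>P\<^esub>}"
    have "a = e"
    proof (rule ccontr)
      \<comment> \<open>The complementary idempotent. Since a b = 0, translating a functional by b
        lands in V.\<close>
      define b where "b = e \<ominus>\<^bsub>\<Lambda>\<^esub> a"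
      have b: "b \<in> carrier \<Lambda>" "e \<otimes>\<^bsub>\<Lambda>\<^esub> b = b" "a \<otimes>\<^bsub>\<Lambda>\<^esub> b = \<zero>\<^bsub>\<Lambda>\<^esub>"
        using a e by (simp_all add: b_def a_minus_def L.r_distr L.r_minus L.r_neg)
      assume "a \<noteq> e"
      then have "b \<noteq> \<zero>\<^bsub>\<Lambda>\<^esub>" using a(1) e(1) algebra_diff_eq_zero by (auto simp: b_def)
      then obtain u where u: "u \<in> carrier D\<Lambda>" "u b \<noteq> \<zero>\<^bsub>J\<^esub>" by (rule functional_separates[OF b(1)])
      define v where "v = (\<lambda>x\<in>carrier \<Lambda>. u (x \<otimes>\<^bsub>\<Lambda>\<^esub> b))"
      have "v \<in> carrier D\<Lambda>" unfolding v_def by (rule dual_translate[OF u(1) b(1)])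
      moreover have "v (x \<otimes>\<^bsub>\<Lambda>\<^esub> e) = v x" if "x \<in> carrier \<Lambda>" for x
        using that b e(1) by (simp add: v_def L.m_assoc)
      ultimately obtain p where p: "p \<in> carrier P" "\<Phi> p = v" by (rule \<Phi>_onto)
      have "p \<in> V" using p a b dual_apply(4)[OF u(1)] by (simp add: V_def v_def L.m_assoc)
      then have "v \<one>\<^bsub>\<Lambda>\<^esub> = \<zero>\<^bsub>J\<^esub>" using V0 p(2) \<Phi>_zero by auto
      then show False using u(2) b(1) by (simp add: v_def)
    qed
    then show ?thesis ..
  qed
qed

text \<open>In q = n + k the component n is a multiple q c, and compressing c by e gives an element
  a of e\<Lambda>e with q a in N and the rest of q in K. Triviality of the intersection makes a
  idempotent, and a = 0 or a = e puts q into one summand.\<close>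

lemma indecomposable_idempotent_generated:
  assumes ind: "indecomposable \<Lambda> P"
  shows "indecomposable \<Lambda> Q"
  unfolding indecomposable_def
proof (intro conjI allI impI Q.right_module_axioms)
  note e = Q.e and q = Q.q
  show "carrier Q \<noteq> {\<zero>\<^bsub>Q\<^esub>}"
  proof
    assume "carrier Q = {\<zero>\<^bsub>Q\<^esub>}"
    then have "e \<odot>\<^bsub>Q\<^esub> q = \<zero>\<^bsub>Q\<^esub>" using q by simp
    then have e0: "e = \<zero>\<^bsub>\<Lambda>\<^esub>" using Q.ann[OF e(1)] e(2) by simp
    have "p = \<zero>\<^bsub>P\<^esub>" if p: "p \<in> carrier P" for p
    proof (rule \<Phi>_eqI[OF p P.M.zero_closed])
      fix x assume x: "x \<in> carrier \<Lambda>"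
      have "\<Phi> p x = \<Phi> p (x \<otimes>\<^bsub>\<Lambda>\<^esub> \<zero>\<^bsub>\<Lambda>\<^esub>)" using \<Phi>_e[OF p x] e0 by simp
      then show "\<Phi> p x = \<Phi> \<zero>\<^bsub>P\<^esub> x" using dual_apply(4)[OF \<Phi>_closed[OF p]] \<Phi>_zero[OF x] x by simp
    qed
    then have "carrier P = {\<zero>\<^bsub>P\<^esub>}" by auto
    then show False using ind by (simp add: indecomposable_def)
  qed
  fix N K assume NK: "submodule N \<Lambda> Q \<and> submodule K \<Lambda> Q \<and> N \<inter> K = {\<zero>\<^bsub>Q\<^esub>} \<and> N <+>\<^bsub>Q\<^esub> K = carrier Q"
  then have N: "submodule N \<Lambda> Q" and K: "submodule K \<Lambda> Q" and disj: "N \<inter> K = {\<zero>\<^bsub>Q\<^esub>}"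
    and "q \<in> N <+>\<^bsub>Q\<^esub> K" using q(1) by auto
  then obtain n k where nk: "n \<in> N" "k \<in> K" "q = n \<oplus>\<^bsub>Q\<^esub> k" unfolding Q.set_add_mem_iff by blast
  have nkQ: "n \<in> carrier Q" "k \<in> carrier Q" using submodule_mem[OF N nk(1)] submodule_mem[OF K nk(2)] .
  obtain c where c: "c \<in> carrier \<Lambda>" "n = c \<odot>\<^bsub>Q\<^esub> q" using Q.gen[OF nkQ(1)] by blast
  \<comment> \<open>The compression replaces n by n e = q a and makes a comparable with e on both
    sides.\<close>
  define a where "a = e \<otimes>\<^bsub>\<Lambda>\<^esub> c \<otimes>\<^bsub>\<Lambda>\<^esub> e"
  define k' where "k' = e \<odot>\<^bsub>Q\<^esub> k"
  have aL: "a \<in> carrier \<Lambda>" using c(1) e(1) by (simp add: a_def)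
  have ea: "e \<otimes>\<^bsub>\<Lambda>\<^esub> a = a" "a \<otimes>\<^bsub>\<Lambda>\<^esub> e = a"
  proof -
    show "a \<otimes>\<^bsub>\<Lambda>\<^esub> e = a" using c(1) e by (simp add: a_def L.m_assoc)
    have "e \<otimes>\<^bsub>\<Lambda>\<^esub> a = (e \<otimes>\<^bsub>\<Lambda>\<^esub> e) \<otimes>\<^bsub>\<Lambda>\<^esub> c \<otimes>\<^bsub>\<Lambda>\<^esub> e" using c(1) e(1) by (simp add: a_def L.m_assoc)
    then show "e \<otimes>\<^bsub>\<Lambda>\<^esub> a = a" using e(2) by (simp add: a_def)
  qed
  have aq: "a \<odot>\<^bsub>Q\<^esub> q = e \<odot>\<^bsub>Q\<^esub> n" using c e(1) q by (simp add: a_def Q.smult_assoc)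
  have aN: "a \<odot>\<^bsub>Q\<^esub> q \<in> N" unfolding aq by (rule submodule_smult[OF N e(1) nk(1)])
  have kK: "k' \<in> K" unfolding k'_def by (rule submodule_smult[OF K e(1) nk(2)])
  have aQ: "a \<odot>\<^bsub>Q\<^esub> q \<in> carrier Q" "k' \<in> carrier Q" using submodule_mem[OF N aN] submodule_mem[OF K kK] .
  have "e \<odot>\<^bsub>Q\<^esub> (n \<oplus>\<^bsub>Q\<^esub> k) = a \<odot>\<^bsub>Q\<^esub> q \<oplus>\<^bsub>Q\<^esub> k'"
    unfolding aq k'_def by (rule Q.smult_r_distr[OF e(1) nkQ])
  then have qd: "q = a \<odot>\<^bsub>Q\<^esub> q \<oplus>\<^bsub>Q\<^esub> k'" using nk(3) q(2) by simp
  define w where "w = a \<odot>\<^bsub>Q\<^esub> q"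
  have wQ: "w \<in> carrier Q" and wN: "w \<in> N" using aQ aN by (simp_all add: w_def)
  have awN: "a \<odot>\<^bsub>Q\<^esub> w \<in> N" "a \<odot>\<^bsub>Q\<^esub> w \<in> carrier Q" and akK: "a \<odot>\<^bsub>Q\<^esub> k' \<in> K" "a \<odot>\<^bsub>Q\<^esub> k' \<in> carrier Q"
    using submodule_smult[OF N aL wN] submodule_smult[OF K aL kK] aL wQ aQ by simp_all
  have "a \<odot>\<^bsub>Q\<^esub> (w \<oplus>\<^bsub>Q\<^esub> k') = a \<odot>\<^bsub>Q\<^esub> w \<oplus>\<^bsub>Q\<^esub> a \<odot>\<^bsub>Q\<^esub> k'" by (rule Q.smult_r_distr[OF aL wQ aQ(2)])
  moreover have "w \<oplus>\<^bsub>Q\<^esub> k' = q" using qd by (simp add: w_def)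
  ultimately have wd: "w = a \<odot>\<^bsub>Q\<^esub> k' \<oplus>\<^bsub>Q\<^esub> a \<odot>\<^bsub>Q\<^esub> w" using awN(2) akK(2) by (simp add: w_def Q.M.a_comm)
  \<comment> \<open>With w = q a, the element w - w a lies in N and equals k' a in K, so it is
    zero.\<close>
  have "w \<ominus>\<^bsub>Q\<^esub> a \<odot>\<^bsub>Q\<^esub> w = a \<odot>\<^bsub>Q\<^esub> k'"
  proof -
    have "(w \<ominus>\<^bsub>Q\<^esub> a \<odot>\<^bsub>Q\<^esub> w) \<oplus>\<^bsub>Q\<^esub> a \<odot>\<^bsub>Q\<^esub> w = a \<odot>\<^bsub>Q\<^esub> k' \<oplus>\<^bsub>Q\<^esub> a \<odot>\<^bsub>Q\<^esub> w"
      using Q.diff_add_cancel[OF wQ awN(2)] wd by (rule trans)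
    then show ?thesis
      using Q.M.add.right_cancel[of "a \<odot>\<^bsub>Q\<^esub> w"] awN(2) akK(2) Q.M.minus_closed[OF wQ awN(2)] by blast
  qed
  moreover have "w \<ominus>\<^bsub>Q\<^esub> a \<odot>\<^bsub>Q\<^esub> w \<in> N" by (rule submodule_diff[OF N wN awN(1)])
  ultimately have "w \<ominus>\<^bsub>Q\<^esub> a \<odot>\<^bsub>Q\<^esub> w \<in> N \<inter> K" using akK(1) by simp
  then have "w \<ominus>\<^bsub>Q\<^esub> a \<odot>\<^bsub>Q\<^esub> w = \<zero>\<^bsub>Q\<^esub>" using disj by blast
  then have "(a \<ominus>\<^bsub>\<Lambda>\<^esub> a \<otimes>\<^bsub>\<Lambda>\<^esub> a) \<odot>\<^bsub>Q\<^esub> q = \<zero>\<^bsub>Q\<^esub>"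
    using aL q(1) by (simp add: w_def Q.smult_l_diff Q.smult_assoc)
  then have "e \<otimes>\<^bsub>\<Lambda>\<^esub> (a \<ominus>\<^bsub>\<Lambda>\<^esub> a \<otimes>\<^bsub>\<Lambda>\<^esub> a) = \<zero>\<^bsub>\<Lambda>\<^esub>" using aL by (intro Q.ann) simp_all
  moreover have "e \<otimes>\<^bsub>\<Lambda>\<^esub> (a \<ominus>\<^bsub>\<Lambda>\<^esub> a \<otimes>\<^bsub>\<Lambda>\<^esub> a) = a \<ominus>\<^bsub>\<Lambda>\<^esub> a \<otimes>\<^bsub>\<Lambda>\<^esub> a"
    using aL e(1) ea(1) by (simp add: a_minus_def L.r_distr L.r_minus flip: L.m_assoc)
  ultimately have "a \<otimes>\<^bsub>\<Lambda>\<^esub> a = a" using aL algebra_diff_eq_zero[of a "a \<otimes>\<^bsub>\<Lambda>\<^esub> a"] by simp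
  then have "a = \<zero>\<^bsub>\<Lambda>\<^esub> \<or> a = e" by (intro corner_idempotent_trivial[OF ind aL ea])
  then show "N = {\<zero>\<^bsub>Q\<^esub>} \<or> K = {\<zero>\<^bsub>Q\<^esub>}"
  proof
    assume "a = \<zero>\<^bsub>\<Lambda>\<^esub>"
    then have "w = \<zero>\<^bsub>Q\<^esub>" using q(1) by (simp add: w_def)
    then have "q = k'" using \<open>w \<oplus>\<^bsub>Q\<^esub> k' = q\<close> aQ(2) by simp
    then have "K = carrier Q" using kK by (intro Q.submodule_with_generator[OF K]) simp
    then have "N = {\<zero>\<^bsub>Q\<^esub>}" using disj submodule_subset[OF N] by blast
    then show ?thesis ..
  next
    assume "a = e"
    then have "q \<in> N" using wN q(2) by (simp add: w_def)
    then have "N = carrier Q" by (rule Q.submodule_with_generator[OF N])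
    then have "K = {\<zero>\<^bsub>Q\<^esub>}" using disj submodule_subset[OF K] by blast
    then show ?thesis ..
  qed
qed

lemma nakayama_right_module: "right_module \<Lambda> (nakayama R \<phi> \<Lambda> J Q)"
  unfolding nakayama_def
  by (rule dual_right_module[OF hom_regular_left_module[OF Q.right_module_axioms]])

text \<open>The isomorphism is \<open>p \<mapsto> (f \<mapsto> \<Phi> p (f q))\<close>; the values \<open>f q\<close> are the elements of \<open>\<Lambda>e\<close>.\<close>

lemma nakayama_iso: "isomorphic \<Lambda> P (nakayama R \<phi> \<Lambda> J Q)"
proof -
  note e = Q.e and q = Q.q
  let ?N = "nakayama R \<phi> \<Lambda> J Q" and ?H = "hom_regular \<Lambda> Q" and ?Reg = "regular_module \<Lambda>"
  have N: "carrier ?N = mhom R (restrict_scalars \<phi> ?H) J"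
    "\<And>u v. u \<oplus>\<^bsub>?N\<^esub> v = (\<lambda>x\<in>mhom \<Lambda> Q ?Reg. u x \<oplus>\<^bsub>J\<^esub> v x)"
    "\<And>a u. a \<odot>\<^bsub>?N\<^esub> u = (\<lambda>x\<in>mhom \<Lambda> Q ?Reg. u (a \<odot>\<^bsub>?H\<^esub> x))"
    by (simp_all add: nakayama_def)
  interpret H: left_module \<Lambda> ?H by (rule hom_regular_left_module[OF Q.right_module_axioms])
  have RH: "right_module R (restrict_scalars \<phi> ?H)" by (rule restrict_left_module[OF H.left_module_axioms])
  have fq: "f q \<in> carrier \<Lambda>" "f q \<otimes>\<^bsub>\<Lambda>\<^esub> e = f q" if "f \<in> mhom \<Lambda> Q ?Reg" for f
    using mhom_closed[OF that q(1)] mhom_smult[OF that e(1) q(1)] q(2) by simp_all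
  define T where "T p = (\<lambda>f\<in>mhom \<Lambda> Q ?Reg. \<Phi> p (f q))" for p
  have TN: "T p \<in> carrier ?N" if p: "p \<in> carrier P" for p
  proof -
    have "restrict (\<lambda>f. \<Phi> p (f q)) (carrier (restrict_scalars \<phi> ?H)) \<in> mhom R (restrict_scalars \<phi> ?H) J"
      using dual_apply[OF \<Phi>_closed[OF p]] fq q(1)
      by (intro mhom_restrictI[OF RH]) simp_all
    then show ?thesis by (simp add: T_def N)
  qed
  have "restrict T (carrier P) \<in> mhom \<Lambda> P ?N"
  proof (rule mhom_restrictI[OF P.right_module_axioms TN])
    show "T (p \<oplus>\<^bsub>P\<^esub> p') = T p \<oplus>\<^bsub>?N\<^esub> T p'" if "p \<in> carrier P" "p' \<in> carrier P" for p p'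
      using that fq by (auto simp: T_def N \<Phi>_add cong: restrict_cong)
    show "T (a \<odot>\<^bsub>P\<^esub> p) = a \<odot>\<^bsub>?N\<^esub> T p" if a: "a \<in> carrier \<Lambda>" and p: "p \<in> carrier P" for a p
    proof -
      have "a \<odot>\<^bsub>?H\<^esub> f \<in> mhom \<Lambda> Q ?Reg" if "f \<in> mhom \<Lambda> Q ?Reg" for f
        using H.smult_closed[OF a, of f] that by simp
      then show ?thesis
        using a p fq q(1) by (auto simp: T_def N \<Phi>_smult cong: restrict_cong)
    qed
  qed
  \<comment> \<open>G x is the homomorphism sending q to x e. On \<Lambda>e it inverts f \<mapsto> f
    q, and it is left linear by uniqueness.\<close>
  define G where "G x = (SOME f. f \<in> mhom \<Lambda> Q ?Reg \<and> f q = x \<otimes>\<^bsub>\<Lambda>\<^esub> e)" for x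
  have G: "G x \<in> mhom \<Lambda> Q ?Reg \<and> G x q = x \<otimes>\<^bsub>\<Lambda>\<^esub> e" if x: "x \<in> carrier \<Lambda>" for x
  proof -
    have z: "x \<otimes>\<^bsub>\<Lambda>\<^esub> e \<in> carrier ?Reg" "e \<odot>\<^bsub>?Reg\<^esub> (x \<otimes>\<^bsub>\<Lambda>\<^esub> e) = x \<otimes>\<^bsub>\<Lambda>\<^esub> e"
      using x e by (simp_all add: L.m_assoc)
    obtain g where g: "g \<in> mhom \<Lambda> Q ?Reg" "\<forall>r\<in>carrier \<Lambda>. g (r \<odot>\<^bsub>Q\<^esub> q) = r \<odot>\<^bsub>?Reg\<^esub> (x \<otimes>\<^bsub>\<Lambda>\<^esub> e)"
      by (rule Q.hom_from[OF L.regular_right_module z])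
    have "g q = x \<otimes>\<^bsub>\<Lambda>\<^esub> e" using bspec[OF g(2) e(1)] q(2) z(2) by simp
    then have "\<exists>f. f \<in> mhom \<Lambda> Q ?Reg \<and> f q = x \<otimes>\<^bsub>\<Lambda>\<^esub> e" using g(1) by blast
    from someI_ex[OF this] show ?thesis unfolding G_def .
  qed
  have G_unique: "f = G x" if "f \<in> mhom \<Lambda> Q ?Reg" "x \<in> carrier \<Lambda>" "f q = x \<otimes>\<^bsub>\<Lambda>\<^esub> e" for f x
    using that G by (intro Q.hom_eqI[OF L.regular_right_module]) simp_all
  have "inj_on T (carrier P)"
  proof (rule inj_onI)
    fix p p' assume p: "p \<in> carrier P" "p' \<in> carrier P" "T p = T p'"
    show "p = p'"
    proof (rule \<Phi>_eqI[OF p(1,2)])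
      fix x assume x: "x \<in> carrier \<Lambda>"
      have "T p (G x) = T p' (G x)" using p(3) by simp
      then have "\<Phi> p (x \<otimes>\<^bsub>\<Lambda>\<^esub> e) = \<Phi> p' (x \<otimes>\<^bsub>\<Lambda>\<^esub> e)" using G[OF x] by (simp add: T_def)
      then show "\<Phi> p x = \<Phi> p' x" using \<Phi>_e x p by simp
    qed
  qed
  moreover have "carrier ?N \<subseteq> T ` carrier P"
  proof
    fix w assume "w \<in> carrier ?N"
    then have w: "w \<in> mhom R (restrict_scalars \<phi> ?H) J" by (simp add: N)
    \<comment> \<open>Pulling w back along G gives a functional on \<Lambda>; it is unchanged under
      multiplication by e since G x depends on x e only.\<close>
    define v where "v = (\<lambda>x\<in>carrier \<Lambda>. w (G x))"
    have G_add: "G (x \<oplus>\<^bsub>\<Lambda>\<^esub> y) = G x \<oplus>\<^bsub>?H\<^esub> G y" if x: "x \<in> carrier \<Lambda>" and y: "y \<in> carrier \<Lambda>" for x y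
    proof (rule G_unique[symmetric])
      show "G x \<oplus>\<^bsub>?H\<^esub> G y \<in> mhom \<Lambda> Q ?Reg" using H.M.a_closed[of "G x" "G y"] G x y by simp
      show "(G x \<oplus>\<^bsub>?H\<^esub> G y) q = (x \<oplus>\<^bsub>\<Lambda>\<^esub> y) \<otimes>\<^bsub>\<Lambda>\<^esub> e" using G x y q(1) e(1) by (simp add: L.l_distr)
    qed (use x y in simp)
    have G_smult: "G (a \<otimes>\<^bsub>\<Lambda>\<^esub> x) = a \<odot>\<^bsub>?H\<^esub> G x" if a: "a \<in> carrier \<Lambda>" and x: "x \<in> carrier \<Lambda>" for a x
    proof (rule G_unique[symmetric])
      show "a \<odot>\<^bsub>?H\<^esub> G x \<in> mhom \<Lambda> Q ?Reg" using H.smult_closed[of a "G x"] G x a by simp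
      show "(a \<odot>\<^bsub>?H\<^esub> G x) q = (a \<otimes>\<^bsub>\<Lambda>\<^esub> x) \<otimes>\<^bsub>\<Lambda>\<^esub> e" using G a x q(1) e(1) by (simp add: L.m_assoc)
    qed (use a x in simp)
    have "restrict (\<lambda>x. w (G x)) (carrier (restrict_scalars \<phi> LReg)) \<in> mhom R (restrict_scalars \<phi> LReg) J"
      using mhom_closed[OF w] mhom_add[OF w] mhom_smult[OF w] G
      by (intro mhom_restrictI[OF restrict_left_module[OF L.left_regular_module]])
        (simp_all add: G_add G_smult del: hom_regular_simps(3,4))
    then have "v \<in> carrier D\<Lambda>" by (simp add: v_def)
    moreover have "v (x \<otimes>\<^bsub>\<Lambda>\<^esub> e) = v x" if x: "x \<in> carrier \<Lambda>" for x
    proof -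
      have "G x = G (x \<otimes>\<^bsub>\<Lambda>\<^esub> e)" using G[OF x] x e by (intro G_unique) (simp_all add: L.m_assoc)
      then show ?thesis using x e(1) by (simp add: v_def)
    qed
    ultimately obtain p where p: "p \<in> carrier P" "\<Phi> p = v" by (rule \<Phi>_onto)
    have "T p = w"
    proof (rule mhom_ext)
      show "T p \<in> mhom R (restrict_scalars \<phi> ?H) J" using TN[OF p(1)] by (simp add: N)
      show "w \<in> mhom R (restrict_scalars \<phi> ?H) J" by (rule w)
      fix f assume "f \<in> carrier (restrict_scalars \<phi> ?H)"
      then have f: "f \<in> mhom \<Lambda> Q ?Reg" by simp
      have "f = G (f q)" using f fq[OF f] by (intro G_unique) simp_all
      then show "T p f = w f" using f fq[OF f] p(2) by (simp add: T_def v_def)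
    qed
    then show "w \<in> T ` carrier P" using p(1) by blast
  qed
  ultimately have "bij_betw (restrict T (carrier P)) (carrier P) (carrier ?N)"
    using TN by (auto simp: bij_betw_def inj_on_def)
  then show ?thesis
    using \<open>restrict T (carrier P) \<in> mhom \<Lambda> P ?N\<close> unfolding isomorphic_def miso_def by blast
qed

end

section \<open>The almost split sequence\<close>

text \<open>Gives the partial map on w(X) that injectivity of P then extends to all of Y.\<close>

lemma factor_through_image:
  assumes X: "right_module R X" and Y: "right_module R Y" and N: "right_module R N"
    and w: "w \<in> mhom R X Y" and a: "a \<in> mhom R X N"
    and ker: "\<And>x. \<lbrakk>x \<in> carrier X; w x = \<zero>\<^bsub>Y\<^esub>\<rbrakk> \<Longrightarrow> a x = \<zero>\<^bsub>N\<^esub>"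
  obtains b where "b \<in> mhom R (Y\<lparr>carrier := w ` carrier X\<rparr>) N" "\<forall>x\<in>carrier X. b (w x) = a x"
proof -
  interpret w: module_hom R X Y w by (rule module_homI[OF X Y w])
  interpret a: module_hom R X N a by (rule module_homI[OF X N a])
  define b where "b y = a (SOME x. x \<in> carrier X \<and> y = w x)" for y
  have bw: "b (w x) = a x" if x: "x \<in> carrier X" for x
  proof -
    have "\<exists>z. z \<in> carrier X \<and> w x = w z" using x by blast
    from someI_ex[OF this] obtain z where z: "z \<in> carrier X" "w x = w z" "b (w x) = a z"
      unfolding b_def by blast
    have "w (x \<ominus>\<^bsub>X\<^esub> z) = \<zero>\<^bsub>Y\<^esub>" using x z(1,2) by (simp add: w.N.diff_eq_zero_iff)
    then have "a (x \<ominus>\<^bsub>X\<^esub> z) = \<zero>\<^bsub>N\<^esub>" using x z(1) by (intro ker) simp_all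
    then show ?thesis using x z(1,3) by (simp add: a.N.diff_eq_zero_iff)
  qed
  note im = w.image_submodule[OF w.M.carrier_submodule]
  have "restrict b (carrier (Y\<lparr>carrier := w ` carrier X\<rparr>)) \<in> mhom R (Y\<lparr>carrier := w ` carrier X\<rparr>) N"
  proof (rule mhom_restrictI[OF w.N.submodule_is_right_module[OF im]])
    fix y assume y: "y \<in> carrier (Y\<lparr>carrier := w ` carrier X\<rparr>)"
    then obtain x where x: "x \<in> carrier X" "y = w x" by auto
    then show "b y \<in> carrier N" using bw by simp
    show "b (r \<odot>\<^bsub>Y\<lparr>carrier := w ` carrier X\<rparr>\<^esub> y) = r \<odot>\<^bsub>N\<^esub> b y" if r: "r \<in> carrier R" for r
      using bw[OF x(1)] bw[OF w.M.smult_closed[OF r x(1)]] x r by simp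
    fix y' assume "y' \<in> carrier (Y\<lparr>carrier := w ` carrier X\<rparr>)"
    then obtain x' where x': "x' \<in> carrier X" "y' = w x'" by auto
    then show "b (y \<oplus>\<^bsub>Y\<lparr>carrier := w ` carrier X\<rparr>\<^esub> y') = b y \<oplus>\<^bsub>N\<^esub> b y'"
      using bw[OF x(1)] bw[OF x'(1)] bw[OF w.M.M.a_closed[OF x(1) x'(1)]] x by simp
  qed
  then show thesis using bw by (intro that[of "restrict b (w ` carrier X)"]) simp_all
qed

lemma projective_iso:
  fixes P :: "('a, 'p) module" and N :: "('a, 'n) module"
  assumes P: "projective R P" and N: "right_module R N" and f: "f \<in> miso R P N"
  shows "projective R N"
  unfolding projective_def
proof (intro conjI allI impI ballI)
  have fg: "fg_module R P" using P by (simp add: projective_def)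
  have hom: "f \<in> mhom R P N" and bij: "bij_betw f (carrier P) (carrier N)"
    using f by (auto simp: miso_def)
  note rmP = fg_right_module[OF fg]
  show "fg_module R N"
    using bij by (intro fg_surjective_image[OF fg N hom]) (simp add: bij_betw_def)
  obtain f' where f': "f' \<in> miso R N P" "\<forall>x\<in>carrier P. f' (f x) = x" "\<forall>y\<in>carrier N. f (f' y) = y"
    by (rule miso_inverse[OF rmP N f])
  have f'h: "f' \<in> mhom R N P" using f'(1) by (simp add: miso_def)
  fix X Y :: "('a, 'a small) module" and w g
  assume XY: "fg_module R X \<and> fg_module R Y" and w: "w \<in> mhom R X Y" and g: "g \<in> mhom R N Y"
    and onto: "w ` carrier X = carrier Y"
  have "compose (carrier P) g f \<in> mhom R P Y" by (rule mhom_compose[OF rmP hom g])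
  from P[unfolded projective_def, THEN conjunct2, rule_format, OF XY w this onto]
  obtain h where h: "h \<in> mhom R P X" "compose (carrier P) w h = compose (carrier P) g f" by blast
  have "compose (carrier N) w (compose (carrier N) h f') = g"
  proof (rule mhom_ext)
    show "compose (carrier N) w (compose (carrier N) h f') \<in> mhom R N Y"
      by (rule mhom_compose[OF N mhom_compose[OF N f'h h(1)] w])
    show "g \<in> mhom R N Y" by (rule g)
    fix y assume y: "y \<in> carrier N"
    have "compose (carrier P) w h (f' y) = compose (carrier P) g f (f' y)" using h(2) by simp
    then show "compose (carrier N) w (compose (carrier N) h f') y = g y"
      using y f'(3) mhom_closed[OF f'h y] by (simp add: compose_eq)
  qed
  then show "\<exists>h\<in>mhom R N X. compose (carrier N) w h = g"
    using mhom_compose[OF N f'h h(1)] by blast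
qed

section \<open>The zero module\<close>

lemma zero_module_simps [simp]:
  "carrier zero_module = {()}" by (simp add: zero_module_def)

lemma (in ring) zero_right_module: "right_module R (zero_module :: ('a, unit) module)"
proof -
  have "abelian_group (zero_module :: ('a, unit) module)"
    by (rule abelian_groupI) simp_all
  then show ?thesis
    by (intro right_module.intro right_module_axioms.intro ring_axioms) simp_all
qed

lemma zero_map_hom:
  assumes "right_module R M" "right_module R N" shows "zero_map M N \<in> mhom R M N"
  unfolding zero_map_def by (rule zero_in_mhom[OF assms])

lemma from_zero_module:
  assumes M: "right_module R M" and f: "f \<in> mhom R zero_module M"
  shows "f () = \<zero>\<^bsub>M\<^esub>"
proof -
  interpret right_module R M by fact
  have "f (() \<oplus>\<^bsub>zero_module\<^esub> ()) = f () \<oplus>\<^bsub>M\<^esub> f ()" using mhom_add[OF f] by simp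
  then show ?thesis
    using mhom_closed[OF f] M.add.r_cancel_one[of "f ()" "f ()"] by simp
qed

lemma (in ring) zero_fg: "fg_module R (zero_module :: ('a, unit) module)"
proof (rule fg_moduleI[OF zero_right_module, of "{}"])
  fix K :: "unit set" assume "submodule K R (zero_module :: ('a, unit) module)"
  from submodule_zero[OF this] show "K = carrier (zero_module :: ('a, unit) module)" by auto
qed simp_all

lemma (in ring) zero_projective: "projective R (zero_module :: ('a, unit) module)"
  unfolding projective_def
proof (intro conjI zero_fg allI impI ballI)
  fix X Y :: "('a, 'a small) module" and f g
  assume XY: "fg_module R X \<and> fg_module R Y" and f: "f \<in> mhom R X Y" and g: "g \<in> mhom R zero_module Y"
  have X: "right_module R X" and Y: "right_module R Y" using XY fg_right_module by blast+
  have "compose (carrier zero_module) f (zero_map zero_module X) = g"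
    using from_zero_module[OF Y g] module_hom.zero[OF module_homI[OF X Y f]]
    by (intro ext) (simp add: compose_def zero_map_def)
  then show "\<exists>h\<in>mhom R zero_module X. compose (carrier zero_module) f h = g"
    using zero_map_hom[OF zero_right_module X] by blast
qed

text \<open>Settles every equation between maps into \<open>zero_module\<close>.\<close>

lemma unit_valued_eq: "f = (g :: 'x \<Rightarrow> unit)"
  by (rule ext) simp

section \<open>The map \<alpha> and the sequence built from it\<close>

context idempotent_generated
begin

text \<open>Gathers all that is used about \<alpha>, so that the result covers every choice of the
  isomorphism \<theta>.\<close>

lemma alpha_properties:
  assumes ind: "indecomposable R Q"
    and asc: "chain_cond True R Q" and desc: "chain_cond False R Q"
    and N: "right_module R N" and S: "essential_simple R N S" and \<alpha>: "is_alpha R Q N \<alpha>"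
  shows "\<alpha> \<in> mhom R Q N" "\<alpha> ` carrier Q = S"
    "\<And>x. x \<in> carrier Q \<Longrightarrow> \<alpha> x = \<zero>\<^bsub>N\<^esub> \<longleftrightarrow> x \<in> module_rad R Q"
proof -
  interpret N: right_module R N by fact
  let ?r = "module_rad R Q"
  have rs: "submodule ?r R Q"
    using radical_maximal(1)[OF ind asc desc] by (simp add: maximal_submodule_def)
  have top: "module_top R Q = quotient_module Q ?r" by (simp add: module_top_def)
  note soc = N.soc_essential_simple[OF S]
  have SN: "S \<subseteq> carrier N" by (rule submodule_subset[OF N.essential_simple_submodule[OF S]])
  obtain \<theta> where \<theta>: "\<theta> \<in> mhom R (quotient_module Q ?r) (N\<lparr>carrier := S\<rparr>)"
    "bij_betw \<theta> (carrier (quotient_module Q ?r)) S"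
    and \<alpha>_eq: "\<alpha> = (\<lambda>x\<in>carrier Q. \<theta> (?r +>\<^bsub>Q\<^esub> x))"
    using \<alpha> unfolding is_alpha_def miso_def top soc by auto
  have \<theta>N: "\<theta> \<in> mhom R (quotient_module Q ?r) N" by (rule mhom_coextend[OF \<theta>(1) SN])
  have "\<alpha> = compose (carrier Q) \<theta> (\<lambda>x\<in>carrier Q. ?r +>\<^bsub>Q\<^esub> x)"
    by (auto simp: \<alpha>_eq compose_def)
  then show hom: "\<alpha> \<in> mhom R Q N"
    using mhom_compose[OF right_module_axioms quotient_proj_hom[OF rs] \<theta>N] by simp
  show "\<alpha> ` carrier Q = S"
    using \<theta>(2) by (simp add: \<alpha>_eq bij_betw_def quotient_carrier image_image)
  fix x assume x: "x \<in> carrier Q"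
  interpret \<theta>: module_hom R "quotient_module Q ?r" N \<theta>
    by (rule module_homI[OF quotient_right_module[OF rs] N \<theta>N])
  have "\<alpha> x = \<zero>\<^bsub>N\<^esub> \<longleftrightarrow> \<theta> (?r +>\<^bsub>Q\<^esub> x) = \<theta> \<zero>\<^bsub>quotient_module Q ?r\<^esub>"
    using x by (simp add: \<alpha>_eq)
  also have "\<dots> \<longleftrightarrow> ?r +>\<^bsub>Q\<^esub> x = \<zero>\<^bsub>quotient_module Q ?r\<^esub>"
    using \<theta>(2) x by (intro inj_on_eq_iff[of \<theta> "carrier (quotient_module Q ?r)"])
      (simp_all add: bij_betw_def quotient_carrier \<theta>.M.M.zero_closed[unfolded quotient_carrier])
  also have "\<dots> \<longleftrightarrow> x \<in> ?r" using coset_eq_zero_iff[OF rs x] by (simp add: quotient_zero)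
  finally show "\<alpha> x = \<zero>\<^bsub>N\<^esub> \<longleftrightarrow> x \<in> ?r" .
qed

lemma alpha_exists:
  assumes ind: "indecomposable R Q"
    and asc: "chain_cond True R Q" and desc: "chain_cond False R Q"
    and N: "right_module R N" and S: "essential_simple R N S"
    and s: "s \<in> S" "s \<noteq> \<zero>\<^bsub>N\<^esub>" "e \<odot>\<^bsub>N\<^esub> s = s"
  shows "\<exists>\<alpha>. is_alpha R Q N \<alpha>"
  using top_iso[OF assms] unfolding isomorphic_def is_alpha_def by blast

text \<open>N stands for \<nu> Q and f0 identifies P with it; injectivity is used on P and
  transported along f0.\<close>

lemma almost_split:
  fixes P :: "('a, 'p) module" and N :: "('a, 'n) module"
  assumes ind: "indecomposable R Q"
    and noeth: "\<And>Y :: ('a, 'a small) module. fg_module R Y \<Longrightarrow> chain_cond True R Y"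
    and asc: "chain_cond True R Q" and desc: "chain_cond False R Q"
    and proj: "projective R P" and inj: "injective R P" and S: "essential_simple R P S"
    and N: "right_module R N" and f0: "f0 \<in> miso R P N" and \<alpha>: "is_alpha R Q N \<alpha>"
  shows "\<exists>f g. almost_split_sequence_P R (from_zero P) f \<lparr>Dom = Q, Cod = N, arr = \<alpha>\<rparr> g (to_zero Q)"
proof -
  let ?B = "\<lparr>Dom = Q, Cod = N, arr = \<alpha>\<rparr>" and ?Z = "zero_module :: ('a, unit) module"
  have fgP: "fg_module R P" using inj by (simp add: injective_def)
  note P = fg_right_module[OF fgP]
  interpret P: right_module R P by (rule P)
  interpret N: right_module R N by (rule N)
  have Zm: "right_module R ?Z" by (rule R.zero_right_module)
  note ns = essential_simple_iso[OF P N f0 S]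
  note \<alpha>_hom = alpha_properties(1)[OF ind asc desc N ns \<alpha>]
  note \<alpha>_im = alpha_properties(2)[OF ind asc desc N ns \<alpha>]
  note \<alpha>_ker = alpha_properties(3)[OF ind asc desc N ns \<alpha>]
  interpret \<alpha>: module_hom R Q N \<alpha> by (rule module_homI[OF right_module_axioms N \<alpha>_hom])
  have f0h: "f0 \<in> mhom R P N" and f0b: "bij_betw f0 (carrier P) (carrier N)"
    using f0 by (auto simp: miso_def)
  interpret f0: module_hom R P N f0 by (rule module_homI[OF P N f0h])
  obtain f1 where f1: "f1 \<in> miso R N P" "\<forall>x\<in>carrier P. f1 (f0 x) = x" "\<forall>y\<in>carrier N. f0 (f1 y) = y"
    by (rule miso_inverse[OF P N f0])
  have f1h: "f1 \<in> mhom R N P" using f1(1) by (simp add: miso_def)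
  note subS = P.essential_simple_submodule[OF S]
  \<comment> \<open>The element of soc P that corresponds to \<open>\<alpha> q\<close>. It inherits
    s e = s from q, so its lifts can be corrected to images of q.\<close>
  obtain s where s: "s \<in> S" "s \<noteq> \<zero>\<^bsub>P\<^esub>" "f0 s = \<alpha> q"
  proof -
    have "\<alpha> q \<in> f0 ` S" using \<alpha>_im q(1) by blast
    then obtain s where s: "s \<in> S" "f0 s = \<alpha> q" by auto
    have "q \<notin> module_rad R Q"
      using radical_maximal(1)[OF ind asc desc] submodule_with_generator
      by (auto simp: maximal_submodule_def)
    then have "\<alpha> q \<noteq> \<zero>\<^bsub>N\<^esub>" using \<alpha>_ker[OF q(1)] by simp
    then show thesis using s f0.zero by (intro that[of s]) auto
  qed
  have sP: "s \<in> carrier P" using submodule_mem[OF subS s(1)] .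
  have "f0 (e \<odot>\<^bsub>P\<^esub> s) = e \<odot>\<^bsub>N\<^esub> \<alpha> q" using s(3) sP e(1) by simp
  also have "\<dots> = \<alpha> q" using \<alpha>.smult[OF e(1) q(1)] q(2) by simp
  finally have es: "e \<odot>\<^bsub>P\<^esub> s = s"
    using inj_onD[OF bij_betw_imp_inj_on[OF f0b], of "e \<odot>\<^bsub>P\<^esub> s" s] s(3) sP e(1) by simp
  have \<alpha>q: "\<alpha> q \<noteq> \<zero>\<^bsub>N\<^esub>"
    using s(2,3) sP f0.zero inj_onD[OF bij_betw_imp_inj_on[OF f0b], of s "\<zero>\<^bsub>P\<^esub>"] by auto
  \<comment> \<open>Componentwise the sequence is trivial: 0, Q, Q on domains and P, N, 0 on
    codomains. All its content is in \<alpha>, which links the two rows.\<close>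
  define f where "f = (zero_map ?Z Q, f0)"
  define g where "g = ((\<lambda>x\<in>carrier Q. x), zero_map N ?Z)"
  have idQ: "(\<lambda>x\<in>carrier Q. x) \<in> mhom R Q Q"
    by (rule mhom_restrictI[OF right_module_axioms]) simp_all
  have f_hom: "f \<in> H_hom R (from_zero P) ?B"
    using zero_map_hom[OF Zm right_module_axioms] f0h
    by (auto simp: H_hom_def f_def from_zero_def compose_def zero_map_def)
  have g_hom: "g \<in> H_hom R ?B (to_zero Q)"
    using zero_map_hom[OF N Zm] idQ unit_valued_eq
    by (auto simp: H_hom_def g_def to_zero_def)
  have conf: "conflation_P R (from_zero P) f ?B g (to_zero Q)"
    unfolding conflation_P_def
  proof (intro conjI f_hom g_hom)
    have fgN: "fg_module R N" using projective_iso[OF proj N f0] by (simp add: projective_def)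
    show "is_P R (from_zero P)"
      using R.zero_projective R.zero_fg proj fgP zero_map_hom[OF Zm P]
      by (simp add: is_P_def is_H_def from_zero_def)
    show "is_P R (to_zero Q)"
      using R.zero_projective R.zero_fg projective fg zero_map_hom[OF right_module_axioms Zm]
      by (simp add: is_P_def is_H_def to_zero_def)
    show "is_P R ?B"
      using projective fg projective_iso[OF proj N f0] fgN \<alpha>_hom by (simp add: is_P_def is_H_def)
    show "short_exact (Dom (from_zero P)) (fst f) (Dom ?B) (fst g) (Dom (to_zero Q))"
      by (auto simp: short_exact_def from_zero_def to_zero_def f_def g_def zero_map_def)
    show "short_exact (Cod (from_zero P)) (snd f) (Cod ?B) (snd g) (Cod (to_zero Q))"
      using f0b N.M.zero_closed
      by (auto simp: short_exact_def from_zero_def to_zero_def f_def g_def bij_betw_def)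
  qed
  have left: "left_almost_split_P R (from_zero P) f ?B"
    unfolding left_almost_split_P_def
  proof (intro conjI allI impI ballI)
    \<comment> \<open>The square of a retraction forces r2 to vanish on the image of \<alpha>, yet
      r2 must send \<open>f0 s\<close>, which is \<open>\<alpha> q\<close>, back to s.\<close>
    show "\<not> H_section R (from_zero P) ?B f"
    proof
      assume "H_section R (from_zero P) ?B f"
      then obtain r1 r2 where r: "(r1, r2) \<in> H_hom R ?B (from_zero P)"
          "H_comp (from_zero P) (r1, r2) f = H_id (from_zero P)"
        unfolding H_section_def by auto
      have 1: "compose (carrier Q) r2 \<alpha> = compose (carrier Q) (zero_map ?Z P) r1"
        using r(1) by (simp add: H_hom_def from_zero_def)
      have 2: "compose (carrier P) r2 f0 = (\<lambda>y\<in>carrier P. y)"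
        using r(2) by (simp add: H_comp_def H_id_def from_zero_def f_def)
      have "r2 (\<alpha> q) = \<zero>\<^bsub>P\<^esub>" using fun_cong[OF 1, of q] q(1) by (simp add: compose_eq zero_map_def)
      moreover have "r2 (f0 s) = s" using fun_cong[OF 2, of s] sP by (simp add: compose_eq)
      ultimately show False using s(2,3) by simp
    qed
  next
    fix Z :: "('a, 'a small, 'a small) morph" and h
    assume Z: "is_P R Z" and h: "h \<in> H_hom R (from_zero P) Z" and nsec: "\<not> H_section R (from_zero P) Z h"
    define X where "X = Dom Z"
    define Y where "Y = Cod Z"
    define w where "w = arr Z"
    define t where "t = snd h"
    have fgX: "fg_module R X" and fgY: "fg_module R Y" and w: "w \<in> mhom R X Y"
      using Z by (simp_all add: is_P_def is_H_def X_def Y_def w_def)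
    have h1: "fst h \<in> mhom R ?Z X" and t: "t \<in> mhom R P Y"
      using h by (auto simp: H_hom_def from_zero_def X_def Y_def t_def)
    note Xm = fg_right_module[OF fgX] and Ym = fg_right_module[OF fgY]
    interpret Y: right_module R Y by (rule Ym)
    interpret w: module_hom R X Y w by (rule module_homI[OF Xm Ym w])
    interpret t: module_hom R P Y t by (rule module_homI[OF P Ym t])
    note im = w.image_submodule[OF w.M.carrier_submodule]
    note tim = t.image_submodule[OF P.carrier_submodule]
    \<comment> \<open>K = 0 says at once that t is injective and that t(P) meets w(X)
      trivially.\<close>
    define K where "K = {p \<in> carrier P. t p \<in> w ` carrier X}"
    have K: "submodule K R P" unfolding K_def by (rule t.vimage_submodule[OF im])
    have "K \<noteq> {\<zero>\<^bsub>P\<^esub>}"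
    proof
      assume K0: "K = {\<zero>\<^bsub>P\<^esub>}"
      have tker: "(\<lambda>x\<in>carrier P. x) p = \<zero>\<^bsub>P\<^esub>" if p: "p \<in> carrier P" "t p = \<zero>\<^bsub>Y\<^esub>" for p
      proof -
        have "p \<in> K" using p submodule_zero[OF im] by (simp add: K_def)
        then show ?thesis using K0 p(1) by simp
      qed
      have idP: "(\<lambda>x\<in>carrier P. x) \<in> mhom R P P" by (rule mhom_restrictI[OF P]) simp_all
      \<comment> \<open>b inverts t on its image; c extends b by zero on w(X), and r extends c to
        all of Y.\<close>
      obtain b where b: "b \<in> mhom R (Y\<lparr>carrier := t ` carrier P\<rparr>) P"
        "\<forall>p\<in>carrier P. b (t p) = (\<lambda>x\<in>carrier P. x) p"
        by (rule factor_through_image[OF P Ym P t idP tker])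
      have disj: "t ` carrier P \<inter> w ` carrier X \<subseteq> {\<zero>\<^bsub>Y\<^esub>}"
      proof
        fix y assume y: "y \<in> t ` carrier P \<inter> w ` carrier X"
        then obtain p where p: "p \<in> carrier P" "y = t p" by blast
        then have "p \<in> K" using y by (simp add: K_def)
        then show "y \<in> {\<zero>\<^bsub>Y\<^esub>}" using K0 p(2) by simp
      qed
      obtain c where c: "c \<in> mhom R (Y\<lparr>carrier := t ` carrier P <+>\<^bsub>Y\<^esub> w ` carrier X\<rparr>) P"
        "\<forall>y\<in>t ` carrier P. \<forall>z\<in>w ` carrier X. c (y \<oplus>\<^bsub>Y\<^esub> z) = b y"
        by (rule Y.sum_projection[OF tim im disj P b(1)])
      note sum = Y.sum_submodule[OF tim im]
      obtain r where r: "r \<in> mhom R Y P" "\<forall>y\<in>t ` carrier P <+>\<^bsub>Y\<^esub> w ` carrier X. r y = c y"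
        by (rule injective_extend_submodule[OF inj fgY sum Y.fg_submodule[OF noeth[OF fgY] sum] c(1)])
      have rt: "r (t p) = p" if p: "p \<in> carrier P" for p
      proof -
        have "c (t p \<oplus>\<^bsub>Y\<^esub> \<zero>\<^bsub>Y\<^esub>) = b (t p)" using c(2) p submodule_zero[OF im] by blast
        moreover have "t p \<in> t ` carrier P <+>\<^bsub>Y\<^esub> w ` carrier X"
          using Y.sum_upper(1)[OF tim im] p by blast
        ultimately show ?thesis using r(2) b(2) p by simp
      qed
      have rw: "r (w x) = \<zero>\<^bsub>P\<^esub>" if x: "x \<in> carrier X" for x
      proof -
        have "c (t \<zero>\<^bsub>P\<^esub> \<oplus>\<^bsub>Y\<^esub> w x) = b (t \<zero>\<^bsub>P\<^esub>)" using c(2) x P.M.zero_closed by blast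
        then have "c (w x) = \<zero>\<^bsub>P\<^esub>" using b(2) x P.M.zero_closed by (simp del: t.zero) (simp add: x)
        moreover have "w x \<in> t ` carrier P <+>\<^bsub>Y\<^esub> w ` carrier X"
          using Y.sum_upper(2)[OF tim im] x by blast
        ultimately show ?thesis using r(2) by simp
      qed
      \<comment> \<open>Vanishing on w(X) is what makes r a morphism to (0 -> P).\<close>
      have "compose (carrier X) r w = compose (carrier X) (zero_map ?Z P) (zero_map X ?Z)"
        using rw by (auto simp: compose_def zero_map_def)
      then have rH: "(zero_map X ?Z, r) \<in> H_hom R Z (from_zero P)"
        using zero_map_hom[OF Xm Zm] r(1)
        by (simp add: H_hom_def from_zero_def X_def Y_def w_def)
      have "compose (carrier P) r t = (\<lambda>y\<in>carrier P. y)" using rt by (auto simp: compose_def)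
      then have "H_comp (from_zero P) (zero_map X ?Z, r) h = H_id (from_zero P)"
        using unit_valued_eq by (auto simp: H_comp_def H_id_def from_zero_def t_def)
      then show False using nsec rH unfolding H_section_def by blast
    qed
    then have "S \<subseteq> K" using S K unfolding essential_simple_def by blast
    then obtain x where x: "x \<in> carrier X" "t s = w x" using s(1) by (auto simp: K_def)
    \<comment> \<open>x e still lies over t s because s e = s, and it is an admissible image of
      q.\<close>
    define z where "z = e \<odot>\<^bsub>X\<^esub> x"
    have z: "z \<in> carrier X" "e \<odot>\<^bsub>X\<^esub> z = z"
      using x(1) e by (simp_all add: z_def flip: w.M.smult_assoc)
    have wz: "w z = t s"
      using w.smult[OF e(1) x(1)] t.smult[OF e(1) sP] x(2) es by (simp add: z_def)
    obtain k1 where k1: "k1 \<in> mhom R Q X" "\<forall>r\<in>carrier R. k1 (r \<odot>\<^bsub>Q\<^esub> q) = r \<odot>\<^bsub>X\<^esub> z"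
      by (rule hom_from[OF Xm z])
    have k1q: "k1 q = z" using bspec[OF k1(2) e(1)] q(2) z(2) by simp
    \<comment> \<open>The condition that k restricts to t along f0 determines this component;
      commutation with k1 is then checked at q alone.\<close>
    define k2 where "k2 = compose (carrier N) t f1"
    have k2: "k2 \<in> mhom R N Y" unfolding k2_def by (rule mhom_compose[OF N f1h t])
    have k2f0: "k2 (f0 p) = t p" if "p \<in> carrier P" for p
      using that f1(2) by (simp add: k2_def compose_eq)
    have "compose (carrier Q) k2 \<alpha> = compose (carrier Q) w k1"
      using q(1) k2f0[OF sP] s(3) k1q wz
      by (intro hom_eqI[OF Ym mhom_compose[OF right_module_axioms \<alpha>_hom k2]
            mhom_compose[OF right_module_axioms k1(1) w]]) (simp add: compose_eq)
    then have kH: "(k1, k2) \<in> H_hom R ?B Z"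
      using k1(1) k2 by (simp add: H_hom_def X_def Y_def w_def)
    have "compose (carrier P) k2 f0 = t"
      using k2f0 by (intro mhom_ext[OF mhom_compose[OF P f0h k2] t]) (simp add: compose_eq)
    moreover have "compose (carrier ?Z) k1 (zero_map ?Z Q) = fst h"
    proof
      fix u :: unit
      have "k1 \<zero>\<^bsub>Q\<^esub> = \<zero>\<^bsub>X\<^esub>" by (rule module_hom.zero[OF module_homI[OF right_module_axioms Xm k1(1)]])
      then show "compose (carrier ?Z) k1 (zero_map ?Z Q) u = fst h u"
        using from_zero_module[OF Xm h1] by (simp add: compose_def zero_map_def)
    qed
    ultimately have "H_comp (from_zero P) (k1, k2) f = h"
      by (simp add: H_comp_def from_zero_def f_def t_def)
    then show "\<exists>k\<in>H_hom R ?B Z. H_comp (from_zero P) k f = h" using kH by blast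
  qed
  have right: "right_almost_split_P R ?B g (to_zero Q)"
    unfolding right_almost_split_P_def
  proof (intro conjI allI impI ballI)
    \<comment> \<open>The square of a section gives \<open>\<alpha> q = v ()\<close>, which is zero
      since v starts at the zero module.\<close>
    show "\<not> H_retraction R ?B (to_zero Q) g"
    proof
      assume "H_retraction R ?B (to_zero Q) g"
      then obtain u v where uv: "(u, v) \<in> H_hom R (to_zero Q) ?B"
          "H_comp (to_zero Q) g (u, v) = H_id (to_zero Q)"
        unfolding H_retraction_def by auto
      have u: "u \<in> mhom R Q Q" and v: "v \<in> mhom R ?Z N"
        and 1: "compose (carrier Q) v (zero_map Q ?Z) = compose (carrier Q) \<alpha> u"
        using uv(1) by (simp_all add: H_hom_def to_zero_def)
      have 2: "compose (carrier Q) (\<lambda>x\<in>carrier Q. x) u = (\<lambda>x\<in>carrier Q. x)"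
        using uv(2) by (simp add: H_comp_def H_id_def to_zero_def g_def)
      have "u q = q" using fun_cong[OF 2, of q] q(1) mhom_closed[OF u q(1)] by (simp add: compose_eq)
      then have "\<alpha> q = v ()" using fun_cong[OF 1, of q] q(1) by (simp add: compose_eq)
      then show False using \<alpha>q from_zero_module[OF N v] by simp
    qed
  next
    fix Z :: "('a, 'a small, 'a small) morph" and h
    assume Z: "is_P R Z" and h: "h \<in> H_hom R Z (to_zero Q)" and nret: "\<not> H_retraction R Z (to_zero Q) h"
    define X where "X = Dom Z"
    define Y where "Y = Cod Z"
    define w where "w = arr Z"
    define a where "a = fst h"
    have fgX: "fg_module R X" and fgY: "fg_module R Y" and w: "w \<in> mhom R X Y"
      using Z by (simp_all add: is_P_def is_H_def X_def Y_def w_def)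
    have a: "a \<in> mhom R X Q"
      using h by (auto simp: H_hom_def to_zero_def X_def a_def)
    note Xm = fg_right_module[OF fgX] and Ym = fg_right_module[OF fgY]
    interpret w: module_hom R X Y w by (rule module_homI[OF Xm Ym w])
    interpret a: module_hom R X Q a by (rule module_homI[OF Xm right_module_axioms a])
    \<comment> \<open>If a x is outside the radical it generates Q, so a multiple of x lies over q.
      Its product z with e is still in the kernel of w, and q \<mapsto> z defines a section of
      h.\<close>
    have ker: "\<alpha> (a x) = \<zero>\<^bsub>N\<^esub>" if x: "x \<in> carrier X" "w x = \<zero>\<^bsub>Y\<^esub>" for x
    proof (rule ccontr)
      assume "\<alpha> (a x) \<noteq> \<zero>\<^bsub>N\<^esub>"
      then have "a x \<notin> module_rad R Q" using \<alpha>_ker x(1) by simp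
      then have "\<not> cyclic_submodule R Q (a x) \<subseteq> module_rad R Q"
        using cyclic_self[of "a x"] x(1) by auto
      then have "cyclic_submodule R Q (a x) = carrier Q"
        using radical_maximal(2)[OF ind asc desc cyclic_is_submodule[OF a.closed[OF x(1)]]] by blast
      then have "q \<in> cyclic_submodule R Q (a x)" using q(1) by simp
      then obtain r where r: "r \<in> carrier R" "q = r \<odot>\<^bsub>Q\<^esub> a x" by (rule cyclicE)
      define z where "z = e \<odot>\<^bsub>X\<^esub> (r \<odot>\<^bsub>X\<^esub> x)"
      have rx: "r \<odot>\<^bsub>X\<^esub> x \<in> carrier X" using r(1) x(1) by simp
      have z: "z \<in> carrier X" "e \<odot>\<^bsub>X\<^esub> z = z"
        using rx e by (simp_all add: z_def flip: w.M.smult_assoc[OF e(1) e(1)])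
      have "a (r \<odot>\<^bsub>X\<^esub> x) = q" using a.smult[OF r(1) x(1)] r(2) by simp
      then have az: "a z = q" using a.smult[OF e(1) rx] q(2) by (simp add: z_def)
      have "w (r \<odot>\<^bsub>X\<^esub> x) = \<zero>\<^bsub>Y\<^esub>" using w.smult[OF r(1) x(1)] x(2) r(1) by simp
      then have wz: "w z = \<zero>\<^bsub>Y\<^esub>" using w.smult[OF e(1) rx] e(1) by (simp add: z_def)
      obtain u where u: "u \<in> mhom R Q X" "\<forall>r\<in>carrier R. u (r \<odot>\<^bsub>Q\<^esub> q) = r \<odot>\<^bsub>X\<^esub> z"
        by (rule hom_from[OF Xm z])
      have uq: "u q = z" using bspec[OF u(2) e(1)] q(2) z(2) by simp
      have "compose (carrier Q) w u = zero_map Q Y"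
        using q(1) uq wz
        by (intro hom_eqI[OF Ym mhom_compose[OF right_module_axioms u(1) w]
              zero_map_hom[OF right_module_axioms Ym]]) (simp add: compose_eq zero_map_def)
      moreover have "compose (carrier Q) (zero_map ?Z Y) (zero_map Q ?Z) = zero_map Q Y"
        by (auto simp: compose_def zero_map_def)
      ultimately have uH: "(u, zero_map ?Z Y) \<in> H_hom R (to_zero Q) Z"
        using u(1) zero_map_hom[OF Zm Ym] by (simp add: H_hom_def to_zero_def X_def Y_def w_def)
      have "compose (carrier Q) a u = (\<lambda>x\<in>carrier Q. x)"
        using q(1) uq az
        by (intro hom_eqI[OF right_module_axioms mhom_compose[OF right_module_axioms u(1) a] idQ])
          (simp add: compose_eq)
      then have "H_comp (to_zero Q) h (u, zero_map ?Z Y) = H_id (to_zero Q)"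
        using unit_valued_eq by (auto simp: H_comp_def H_id_def to_zero_def a_def)
      then show False using nret uH unfolding H_retraction_def by blast
    qed
    \<comment> \<open>The composite of \<alpha> and a is moved to P, where injectivity applies; f0
      moves the extension back to N.\<close>
    define a' where "a' = compose (carrier X) f1 (compose (carrier X) \<alpha> a)"
    have \<alpha>a: "compose (carrier X) \<alpha> a \<in> mhom R X N" by (rule mhom_compose[OF Xm a \<alpha>_hom])
    have a': "a' \<in> mhom R X P" unfolding a'_def by (rule mhom_compose[OF Xm \<alpha>a f1h])
    have a'_eq: "f0 (a' x) = \<alpha> (a x)" if "x \<in> carrier X" for x
      using that f1(3) by (simp add: a'_def compose_eq)
    have f1_zero: "f1 \<zero>\<^bsub>N\<^esub> = \<zero>\<^bsub>P\<^esub>" by (rule module_hom.zero[OF module_homI[OF N P f1h]])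
    have ker': "a' x = \<zero>\<^bsub>P\<^esub>" if "x \<in> carrier X" "w x = \<zero>\<^bsub>Y\<^esub>" for x
      using ker[OF that] f1_zero that(1) by (simp add: a'_def compose_eq)
    obtain b where b: "b \<in> mhom R (Y\<lparr>carrier := w ` carrier X\<rparr>) P" "\<forall>x\<in>carrier X. b (w x) = a' x"
      by (rule factor_through_image[OF Xm Ym P w a' ker'])
    obtain b' where b': "b' \<in> mhom R Y P" "\<forall>y\<in>w ` carrier X. b' y = b y"
      by (rule injective_extend_submodule[OF inj fgY w.image_submodule[OF w.M.carrier_submodule]
          fg_submodule_image[OF fgX Ym w] b(1)])
    define k2 where "k2 = compose (carrier Y) f0 b'"
    have k2: "k2 \<in> mhom R Y N" unfolding k2_def by (rule mhom_compose[OF Ym b'(1) f0h])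
    have "compose (carrier X) k2 w = compose (carrier X) \<alpha> a"
      using b(2) b'(2) a'_eq
      by (intro mhom_ext[OF mhom_compose[OF Xm w k2] \<alpha>a]) (simp add: compose_eq k2_def)
    then have kH: "(a, k2) \<in> H_hom R Z ?B"
      using a k2 by (simp add: H_hom_def X_def Y_def w_def)
    have "compose (carrier X) (\<lambda>x\<in>carrier Q. x) a = a"
      by (intro mhom_ext[OF mhom_compose[OF Xm a idQ] a]) (simp add: compose_eq)
    then have "H_comp Z g (a, k2) = h"
      using unit_valued_eq by (auto simp: H_comp_def g_def a_def X_def prod_eq_iff)
    then show "\<exists>k\<in>H_hom R Z ?B. H_comp Z g k = h" using kH by blast
  qed
  show ?thesis
    unfolding almost_split_sequence_P_def using conf left right by blast
qed

end

theorem proposition5p5: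
  fixes R :: "'r ring" and \<Lambda> :: "'a ring" and \<phi> :: "'r \<Rightarrow> 'a"
    and J :: "('r, 'j) module" and P :: "('a, 'p) module"
  assumes "artin_algebra R \<phi> \<Lambda>"
    and "dualizing_module R J"
    and "indecomposable \<Lambda> P" and "projective \<Lambda> P" and "injective \<Lambda> P"
  shows "\<exists>Q :: ('a, 'a small) module.
    indecomposable \<Lambda> Q \<and> projective \<Lambda> Q \<and>
    isomorphic \<Lambda> P (nakayama R \<phi> \<Lambda> J Q) \<and>
    isomorphic \<Lambda> (module_top \<Lambda> Q) (module_soc \<Lambda> P) \<and>
    (\<exists>\<alpha>. is_alpha \<Lambda> Q (nakayama R \<phi> \<Lambda> J Q) \<alpha>) \<and>
    (\<forall>\<alpha>. is_alpha \<Lambda> Q (nakayama R \<phi> \<Lambda> J Q) \<alpha> \<longrightarrow>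
      (\<exists>f g. almost_split_sequence_P \<Lambda>
        (from_zero P) f
        \<lparr>Dom = Q, Cod = nakayama R \<phi> \<Lambda> J Q, arr = \<alpha>\<rparr> g
        (to_zero Q)))"
proof -
  have "cring R" "artinian R" "ring \<Lambda>" using assms(1) by (simp_all add: artin_algebra_def)
  then interpret artin_alg R J \<Lambda> \<phi>
    using assms(1,2)
    by (intro artin_alg.intro dualizing_ring.intro dualizing_ring_axioms.intro artin_alg_axioms.intro)
  have fg: "fg_module \<Lambda> P" using assms(4) by (simp add: projective_def)
  interpret P: right_module \<Lambda> P by (rule fg_right_module[OF fg])
  obtain S where S: "essential_simple \<Lambda> P S"
    by (rule P.essential_simple_exists[OF assms(5,3) fg_chain_cond[OF fg] fg_chain_cond[OF fg]])
  obtain e \<Phi> where e: "e \<in> carrier \<Lambda>" "e \<otimes>\<^bsub>\<Lambda>\<^esub> e = e"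
    and \<Phi>: "\<Phi> \<in> mhom \<Lambda> P D\<Lambda>" "inj_on \<Phi> (carrier P)"
      "\<Phi> ` carrier P = {u \<in> carrier D\<Lambda>. \<forall>x\<in>carrier \<Lambda>. u (x \<otimes>\<^bsub>\<Lambda>\<^esub> e) = u x}"
    by (rule idempotent_embedding[OF assms(5) S])
  obtain Q :: "('a, 'a small) module" and q where Q: "idempotent_generated \<Lambda> Q e q"
    by (rule idempotent_generated_small[OF e])
  interpret dual_pair R J \<Lambda> \<phi> Q e q P \<Phi>
    by (intro dual_pair.intro dual_pair_axioms.intro artin_alg_axioms Q P.right_module_axioms \<Phi>)
  let ?N = "nakayama R \<phi> \<Lambda> J Q"
  note N = nakayama_right_module
  have ind: "indecomposable \<Lambda> Q" by (rule indecomposable_idempotent_generated[OF assms(3)])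
  \<comment> \<open>Listed twice, once for each value of the flag in
    \<open>chain_cond\<close>.\<close>
  note cc = fg_chain_cond[OF Q.fg] fg_chain_cond[OF Q.fg]
  obtain f0 where f0: "f0 \<in> miso \<Lambda> P ?N" using nakayama_iso unfolding isomorphic_def by blast
  then have f0h: "f0 \<in> mhom \<Lambda> P ?N" and f0b: "inj_on f0 (carrier P)"
    by (auto simp: miso_def bij_betw_def)
  obtain s where s: "s \<in> S" "s \<noteq> \<zero>\<^bsub>P\<^esub>" "e \<odot>\<^bsub>P\<^esub> s = s" by (rule socle_generator[OF S])
  have sP: "s \<in> carrier P" by (rule submodule_mem[OF P.essential_simple_submodule[OF S] s(1)])
  \<comment> \<open>f0 s is a nonzero element of the socle of \<nu> Q fixed by e, which is what
    makes the top of Q isomorphic to that socle.\<close>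
  have "f0 s \<noteq> \<zero>\<^bsub>?N\<^esub>"
    using s(2) inj_onD[OF f0b _ sP P.M.zero_closed]
      module_hom.zero[OF module_homI[OF P.right_module_axioms N f0h]] by auto
  moreover have "e \<odot>\<^bsub>?N\<^esub> f0 s = f0 s" using mhom_smult[OF f0h e(1) sP] s(3) by simp
  ultimately have "\<exists>\<alpha>. is_alpha \<Lambda> Q ?N \<alpha>"
    using s(1) by (intro Q.alpha_exists[OF ind cc N essential_simple_iso[OF P.right_module_axioms N f0 S]])
      auto
  moreover have "isomorphic \<Lambda> (module_top \<Lambda> Q) (module_soc \<Lambda> P)"
    by (rule Q.top_iso[OF ind cc P.right_module_axioms S s])
  moreover have "\<exists>f g. almost_split_sequence_P \<Lambda> (from_zero P) f \<lparr>Dom = Q, Cod = ?N, arr = \<alpha>\<rparr> g (to_zero Q)"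
    if "is_alpha \<Lambda> Q ?N \<alpha>" for \<alpha>
    by (rule Q.almost_split[OF ind fg_chain_cond cc assms(4,5) S N f0 that])
  ultimately show ?thesis using ind Q.projective nakayama_iso by blast
qed

end
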